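(* The price at time $t<T$ of a call option written on the forward contract $F(\cdot,T_j)$ with strike price $\kappa$ and maturity $T$, with $T_j>T$, i.e. $C(t,T)=\mathbb E_{\mathbb Q}[(F(T,T_j)-\kappa)^+\mid\mathcal F_t]$, is $$C(t,T)=\sigma(t,T,T_j)\big(d_jN(d_j)+n(d_j)\big)=(F(t,T_j)-\kappa)N(d_j)+\sigma(t,T,T_j)\,n(d_j),$$ where $$\sigma(t,T,T_j):=\sqrt{\int_t^T|K(T_j,u)|^2du},\qquad d_j=d_j(t,T,T_j):=\frac{F(t,T_j)-\kappa}{\sigma(t,T,T_j)},$$ and $n(x)=\frac1{\sqrt{2\pi}}e^{-x^2/2}$, $N(y)=\int_{-\infty}^yn(x)\,dx$ are the density and cumulative distribution function of the standard normal law. Moreover, the hedging portfolio for this call option is composed of the only asset $F(\cdot,T_j)$ (together with the money market account), and the quantity of this asset to be held at time $t$ is $N(d_j(t,T,T_j))$.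
   Context: $(\Omega,\mathcal F,\mathbb P)$ is a probability space with the completed filtration $(\mathcal F_t)$ generated by an $n$-dimensional Brownian motion $W$. The interest rate is $0$ (money market account of constant price $1$). The market of forwards with maturities $T_1<\dots<T_m\le\bar T$ is arbitrage free: there is $\mathbb Q\sim\mathbb P$, with density process $\exp(-\int_0^t\theta_s\cdot dW_s-\frac12\int_0^t|\theta_s|^2ds)$ for a deterministic $\theta:[0,\bar T]\to\mathbb R^n$, $\int_0^{\bar T}|\theta_s|^2ds<\infty$, such that $dF(t,T_j)=K(T_j,t)\cdot dW_t^{\mathbb Q}$ on $[0,T_j]$, where $W^{\mathbb Q}_t=W_t+\int_0^t\theta_sds$ is an $n$-dimensional $\mathbb Q$-Brownian motion and $K:[0,\bar T]^2\to\mathbb R^n$ is a deterministic kernel vector with $\int_0^{s}|K(s,u)|^2du<\infty$ for all $s\in[0,\bar T]$; in particular $F(\cdot,T_j)$ is a $\mathbb Q$-martingale. The market is not assumed complete. The hedging portfolio is the self-financing portfolio replicating the payoff $(F(T,T_j)-\kappa)^+$ at time $T$. It is understood that $\sigma(t,T,T_j)>0$, so that $d_j$ is defined. *)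

theory Defs
  imports "HOL-Probability.Probability"
begin

definition completed_filtration ::
  "'a measure \<Rightarrow> (real \<Rightarrow> 'a \<Rightarrow> 'b::topological_space) \<Rightarrow> real \<Rightarrow> 'a measure" where
  "completed_filtration M W t =
     sigma (space M)
       ({W s -` A \<inter> space M | s A. 0 \<le> s \<and> s \<le> t \<and> A \<in> sets borel} \<union> null_sets M)"

text \<open>Standard Brownian motion on the time interval from \<open>0\<close> to \<open>S\<close>, relative to the filtration
  \<open>Fil\<close>. The last three conjuncts say that \<open>W t - W s\<close> is independent of \<open>Fil s\<close> and has the normal law
  with mean zero and covariance matrix \<open>(t - s)\<close> times the identity.\<close>

definition brownian_motion ::
  "'a measure \<Rightarrow> (real \<Rightarrow> 'a measure) \<Rightarrow> real \<Rightarrow> (real \<Rightarrow> 'a \<Rightarrow> real^'n) \<Rightarrow> bool" where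
  "brownian_motion M Fil S W \<longleftrightarrow>
     prob_space M \<and>
     (\<forall>t\<in>{0..S}. W t \<in> borel_measurable M \<and> W t \<in> borel_measurable (Fil t)) \<and>
     (AE \<omega> in M. W 0 \<omega> = 0) \<and>
     (AE \<omega> in M. continuous_on {0..S} (\<lambda>t. W t \<omega>)) \<and>
     (\<forall>s t. 0 \<le> s \<and> s < t \<and> t \<le> S \<longrightarrow>
        prob_space.indep_set M (sets (Fil s))
          {(\<lambda>\<omega>. W t \<omega> - W s \<omega>) -` A \<inter> space M | A. A \<in> sets borel} \<and>
        prob_space.indep_vars M (\<lambda>_. borel) (\<lambda>i \<omega>. (W t \<omega> - W s \<omega>) $ i) UNIV \<and>
        (\<forall>i. distributed M lborel (\<lambda>\<omega>. (W t \<omega> - W s \<omega>) $ i) (normal_density 0 (sqrt (t - s)))))"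

text \<open>A simple adapted process equals \<open>\<xi> i\<close> on the time interval from \<open>\<tau> i\<close> (excluded) to
  \<open>\<tau> (Suc i)\<close> (included), for \<open>i < N\<close>, and vanishes at all other times.\<close>

definition simple_adapted ::
  "(real \<Rightarrow> 'a measure) \<Rightarrow> real \<Rightarrow> nat \<Rightarrow> (nat \<Rightarrow> real) \<Rightarrow> (nat \<Rightarrow> 'a \<Rightarrow> real^'n) \<Rightarrow> bool" where
  "simple_adapted Fil S N \<tau> \<xi> \<longleftrightarrow>
     (\<forall>i<N. 0 \<le> \<tau> i \<and> \<tau> i \<le> \<tau> (Suc i) \<and> \<tau> (Suc i) \<le> S \<and>
        \<xi> i \<in> borel_measurable (Fil (\<tau> i)) \<and>
        (\<exists>B. \<forall>\<omega>\<in>space (Fil (\<tau> i)). norm (\<xi> i \<omega>) \<le> B))"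

definition simple_proc ::
  "nat \<Rightarrow> (nat \<Rightarrow> real) \<Rightarrow> (nat \<Rightarrow> 'a \<Rightarrow> real^'n) \<Rightarrow> real \<Rightarrow> 'a \<Rightarrow> real^'n" where
  "simple_proc N \<tau> \<xi> t \<omega> = (\<Sum>i<N. indicator {\<tau> i<..\<tau> (Suc i)} t *\<^sub>R \<xi> i \<omega>)"

definition simple_integral_wrt ::
  "(real \<Rightarrow> 'a \<Rightarrow> real^'n) \<Rightarrow> nat \<Rightarrow> (nat \<Rightarrow> real) \<Rightarrow> (nat \<Rightarrow> 'a \<Rightarrow> real^'n) \<Rightarrow> real \<Rightarrow> 'a \<Rightarrow> real" where
  "simple_integral_wrt W N \<tau> \<xi> t \<omega> =
     (\<Sum>i<N. \<xi> i \<omega> \<bullet> (W (min t (\<tau> (Suc i))) \<omega> - W (min t (\<tau> i)) \<omega>))"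

text \<open>\<open>has_ito_integral M Fil W S H X\<close>: the process \<open>X\<close> is the continuous adapted version of the
  Ito integral of \<open>H\<close> with respect to \<open>W\<close>, under the probability \<open>M\<close> and for times from \<open>0\<close> to \<open>S\<close>.
  This is the usual construction for adapted integrands that are square integrable with respect to
  time and \<open>M\<close>: the \<open>L\<^sup>2\<close> limit of the integrals of simple adapted processes approximating \<open>H\<close>.
  Joint measurability refers to the completed product measure because path properties only hold
  almost surely.\<close>

definition has_ito_integral ::
  "'a measure \<Rightarrow> (real \<Rightarrow> 'a measure) \<Rightarrow> (real \<Rightarrow> 'a \<Rightarrow> real^'n) \<Rightarrow> real \<Rightarrow>
     (real \<Rightarrow> 'a \<Rightarrow> real^'n) \<Rightarrow> (real \<Rightarrow> 'a \<Rightarrow> real) \<Rightarrow> bool" where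
  "has_ito_integral M Fil W S H X \<longleftrightarrow>
     (\<lambda>(t, \<omega>). H t \<omega>) \<in> borel_measurable (completion (restrict_space lborel {0..S} \<Otimes>\<^sub>M M)) \<and>
     (\<forall>t\<in>{0..S}. H t \<in> borel_measurable (Fil t)) \<and>
     (\<integral>\<^sup>+(t, \<omega>). ennreal ((norm (H t \<omega>))\<^sup>2) \<partial>(restrict_space lborel {0..S} \<Otimes>\<^sub>M M)) < \<infinity> \<and>
     (\<forall>t\<in>{0..S}. X t \<in> borel_measurable (Fil t)) \<and>
     (AE \<omega> in M. continuous_on {0..S} (\<lambda>t. X t \<omega>)) \<and>
     (\<exists>N \<tau> \<xi>. (\<forall>k::nat. simple_adapted Fil S (N k) (\<tau> k) (\<xi> k)) \<and>
        (\<lambda>k. \<integral>\<^sup>+(t, \<omega>). ennreal ((norm (simple_proc (N k) (\<tau> k) (\<xi> k) t \<omega> - H t \<omega>))\<^sup>2)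
               \<partial>(restrict_space lborel {0..S} \<Otimes>\<^sub>M M)) \<longlonglongrightarrow> 0 \<and>
        (\<forall>t\<in>{0..S}.
          (\<lambda>k. \<integral>\<^sup>+\<omega>. ennreal ((simple_integral_wrt W (N k) (\<tau> k) (\<xi> k) t \<omega> - X t \<omega>)\<^sup>2) \<partial>M)
            \<longlonglongrightarrow> 0))"

definition std_normal_cdf :: "real \<Rightarrow> real" where
  "std_normal_cdf y = (LBINT x:{..y}. std_normal_density x)"

definition fwd_vol :: "(real \<Rightarrow> real \<Rightarrow> real^'n) \<Rightarrow> real \<Rightarrow> real \<Rightarrow> real \<Rightarrow> real" where
  "fwd_vol K t T U = sqrt (LBINT u:{t..T}. (norm (K U u))\<^sup>2)"

definition moneyness ::
  "(real \<Rightarrow> real \<Rightarrow> real^'n) \<Rightarrow> (real \<Rightarrow> real \<Rightarrow> 'a \<Rightarrow> real) \<Rightarrow> real \<Rightarrow> real \<Rightarrow> real \<Rightarrow> real \<Rightarrow> 'a \<Rightarrow> real" where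
  "moneyness K F \<kappa> t T U \<omega> = (F t U \<omega> - \<kappa>) / fwd_vol K t T U"

text \<open>A portfolio holds \<open>\<phi> i t\<close> units of the forward with maturity \<open>Tm i\<close>, for \<open>i\<close> from \<open>1\<close> to \<open>m\<close>, and
  \<open>\<psi> t\<close> units of the money market account, whose price is constantly \<open>1\<close>.\<close>

definition portfolio_value ::
  "nat \<Rightarrow> (nat \<Rightarrow> real) \<Rightarrow> (real \<Rightarrow> real \<Rightarrow> 'a \<Rightarrow> real) \<Rightarrow>
     (nat \<Rightarrow> real \<Rightarrow> 'a \<Rightarrow> real) \<Rightarrow> (real \<Rightarrow> 'a \<Rightarrow> real) \<Rightarrow> real \<Rightarrow> 'a \<Rightarrow> real" where
  "portfolio_value m Tm F \<phi> \<psi> t \<omega> = \<psi> t \<omega> + (\<Sum>i=1..m. \<phi> i t \<omega> * F t (Tm i) \<omega>)"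

text \<open>The self-financing condition is \<open>dV = (\<Sum>i. \<phi> i dF(\<cdot>, Tm i))\<close>, since the money market account is
  constant. As \<open>dF(t, Tm i) = K (Tm i) t \<bullet> dW\<close>, the gains process is the Ito integral of
  \<open>(\<Sum>i. \<phi> i t *\<^sub>R K (Tm i) t)\<close> with respect to \<open>W\<close>; square integrability of this integrand is the
  admissibility condition. No position is held in a forward after its maturity.\<close>

definition self_financing ::
  "'a measure \<Rightarrow> (real \<Rightarrow> 'a measure) \<Rightarrow> (real \<Rightarrow> 'a \<Rightarrow> real^'n) \<Rightarrow> (real \<Rightarrow> real \<Rightarrow> real^'n) \<Rightarrow>
     nat \<Rightarrow> (nat \<Rightarrow> real) \<Rightarrow> (real \<Rightarrow> real \<Rightarrow> 'a \<Rightarrow> real) \<Rightarrow> real \<Rightarrow>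
     (nat \<Rightarrow> real \<Rightarrow> 'a \<Rightarrow> real) \<Rightarrow> (real \<Rightarrow> 'a \<Rightarrow> real) \<Rightarrow> bool" where
  "self_financing Q Fil W K m Tm F T \<phi> \<psi> \<longleftrightarrow>
     (\<forall>t\<in>{0..T}. \<psi> t \<in> borel_measurable (Fil t)) \<and>
     (\<forall>i\<in>{1..m}. \<forall>t\<in>{0..T}. \<phi> i t \<in> borel_measurable (Fil t)) \<and>
     (\<forall>i\<in>{1..m}. \<forall>t\<in>{0..T}. Tm i < t \<longrightarrow> (\<forall>\<omega>\<in>space Q. \<phi> i t \<omega> = 0)) \<and>
     has_ito_integral Q Fil W T
       (\<lambda>t \<omega>. \<Sum>i=1..m. \<phi> i t \<omega> *\<^sub>R K (Tm i) t)
       (\<lambda>t \<omega>. portfolio_value m Tm F \<phi> \<psi> t \<omega> - portfolio_value m Tm F \<phi> \<psi> 0 \<omega>)"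

definition hedging_portfolio ::
  "'a measure \<Rightarrow> (real \<Rightarrow> 'a measure) \<Rightarrow> (real \<Rightarrow> 'a \<Rightarrow> real^'n) \<Rightarrow> (real \<Rightarrow> real \<Rightarrow> real^'n) \<Rightarrow>
     nat \<Rightarrow> (nat \<Rightarrow> real) \<Rightarrow> (real \<Rightarrow> real \<Rightarrow> 'a \<Rightarrow> real) \<Rightarrow> real \<Rightarrow> ('a \<Rightarrow> real) \<Rightarrow>
     (nat \<Rightarrow> real \<Rightarrow> 'a \<Rightarrow> real) \<Rightarrow> (real \<Rightarrow> 'a \<Rightarrow> real) \<Rightarrow> bool" where
  "hedging_portfolio Q Fil W K m Tm F T payoff \<phi> \<psi> \<longleftrightarrow>
     self_financing Q Fil W K m Tm F T \<phi> \<psi> \<and>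
     (AE \<omega> in Q. portfolio_value m Tm F \<phi> \<psi> T \<omega> = payoff \<omega>)"

definition holds_only ::
  "'a measure \<Rightarrow> nat \<Rightarrow> nat \<Rightarrow> real \<Rightarrow> (nat \<Rightarrow> real \<Rightarrow> 'a \<Rightarrow> real) \<Rightarrow> bool" where
  "holds_only Q m j T \<phi> \<longleftrightarrow> (\<forall>i\<in>{1..m} - {j}. \<forall>t\<in>{0..T}. \<forall>\<omega>\<in>space Q. \<phi> i t \<omega> = 0)"

end

theory Submission
  imports Defs "HOL-Real_Asymp.Real_Asymp"
begin

text \<open>Under \<open>Q\<close> the increment \<open>F(T) - F(t)\<close> is an Ito integral of a deterministic kernel. Approximating the
  kernel by deterministic step functions shows that it is normal with variance \<open>\<sigma>\<^sup>2\<close> and independent of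
  \<open>Fil t\<close>, so the price is the Bachelier function of \<open>F(t)\<close> and \<open>\<sigma>\<close>, a Gaussian average of the payoff.

  For the hedge, Ito's formula is replaced by a direct estimate: over one step of a partition the change
  of the price minus delta times the change of \<open>F\<close> is a martingale difference, and a Taylor estimate bounds
  its second moment by \<open>C s\<^sup>4 / \<epsilon>\<^sup>2\<close>, where \<open>s\<^sup>2\<close> is the variance of the increment and \<open>\<epsilon>\<^sup>2\<close> is an extra variance
  that smooths the kink of the payoff. Orthogonality makes the total error vanish with the mesh, and then
  \<open>\<epsilon>\<close> tends to \<open>0\<close>. Uniqueness is the Ito isometry, as \<open>Fil 0\<close> is trivial and Ito integrals have mean zero.\<close>

text \<open>The estimates are written in the remaining variance instead of time: for a kernel that
  is merely square integrable this variance is continuous and monotone in time, which is all that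
  the partitions use. Squared step errors of fourth order in the standard deviation sum to at most
  the largest variance increment times the total variance, so uniform continuity makes them small.
  Smoothing is forced by the second derivative of the price in the forward, which is of order one
  over the remaining volatility and explodes at expiry; it moves the price by at most \<epsilon>,
  uniformly in time and path. The kernel also has to be replaced by a step function, since a simple
  strategy is delta times such a function. Weighted by the delta, which lies between 0 and 1, the
  resulting error is a transform of the martingale "step integral minus gain of the forward";
  orthogonality bounds it by the second moment of that martingale at expiry, for every partition.
  Hence the kernel is approximated before the mesh is refined, and the two approximations do not
  interfere.\<close>

section \<open>The Bachelier price and its delta as Gaussian averages\<close>

definition bachelier :: "real \<Rightarrow> real \<Rightarrow> real" where
  "bachelier v x = (\<integral>z. max (x + v * z) 0 \<partial>std_normal_distribution)"

definition bachelier_delta :: "real \<Rightarrow> real \<Rightarrow> real" where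
  "bachelier_delta v x = (\<integral>z. indicator {0<..} (x + v * z) \<partial>std_normal_distribution)"

interpretation std_normal: real_distribution std_normal_distribution
  by (rule real_dist_normal_dist)

lemma std_normal_moments:
  "integrable std_normal_distribution (\<lambda>z. z)"
  "(\<integral>z. z \<partial>std_normal_distribution) = 0"
  "integrable std_normal_distribution (\<lambda>z. z\<^sup>2)"
  "(\<integral>z. z\<^sup>2 \<partial>std_normal_distribution) = 1"
  "integrable std_normal_distribution (\<lambda>z. z ^ 4)"
  "(\<integral>z. z ^ 4 \<partial>std_normal_distribution) = 3"
proof -
  show "integrable std_normal_distribution (\<lambda>z. z)"
    using integrable_std_normal_distribution_moment[of 1] by simp
  show "(\<integral>z. z \<partial>std_normal_distribution) = 0"
    using integral_std_normal_distribution_moment_odd[of 1] by simp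
  show "integrable std_normal_distribution (\<lambda>z. z\<^sup>2)"
    using integrable_std_normal_distribution_moment[of 2] by simp
  show "(\<integral>z. z\<^sup>2 \<partial>std_normal_distribution) = 1"
    using std_normal_distribution_even_moments(1)[of 1] by (simp add: fact_numeral)
  show "integrable std_normal_distribution (\<lambda>z. z ^ 4)"
    using integrable_std_normal_distribution_moment[of 4] by simp
  show "(\<integral>z. z ^ 4 \<partial>std_normal_distribution) = 3"
    using std_normal_distribution_even_moments(1)[of 2] by (simp add: fact_numeral)
qed

text \<open>Since |z| \<le> (1 + z^2) / 2, the unit second moment bounds the first absolute moment;
  this bound is the source of the Lipschitz constant 1 in the volatility.\<close>

lemma std_normal_abs_moment:
  "integrable std_normal_distribution (\<lambda>z. \<bar>z\<bar>)"
  "(\<integral>z. \<bar>z\<bar> \<partial>std_normal_distribution) \<le> 1"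
proof -
  show i: "integrable std_normal_distribution (\<lambda>z. \<bar>z\<bar>)"
    using std_normal_moments(1) by (rule integrable_abs)
  have "(\<integral>z. \<bar>z\<bar> \<partial>std_normal_distribution) \<le> (\<integral>z. (1 + z\<^sup>2) / 2 \<partial>std_normal_distribution)"
  proof (rule integral_mono[OF i])
    show "integrable std_normal_distribution (\<lambda>z. (1 + z\<^sup>2) / 2)"
      using std_normal_moments(3) by simp
    show "\<bar>z\<bar> \<le> (1 + z\<^sup>2) / 2" for z :: real
      using sum_squares_bound[of 1 "\<bar>z\<bar>"] by simp
  qed
  also have "\<dots> = 1"
    using std_normal_moments(3,4) std_normal.prob_space by simp
  finally show "(\<integral>z. \<bar>z\<bar> \<partial>std_normal_distribution) \<le> 1" .
qed

lemma integrable_call: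
  "integrable std_normal_distribution (\<lambda>z. max (x + v * z) 0)"
  by (rule Bochner_Integration.integrable_bound[of _ "\<lambda>z. \<bar>x\<bar> + \<bar>v\<bar> * \<bar>z\<bar>"])
     (use std_normal_abs_moment(1) in \<open>auto intro!: Bochner_Integration.integrable_add integrable_mult_right, 
        simp add: abs_mult[symmetric]\<close>)

lemma integrable_digital:
  "integrable std_normal_distribution (\<lambda>z. indicator {0<..} (x + v * z) :: real)"
  by (rule std_normal.integrable_const_bound[of _ 1]) auto

lemma bachelier_0: "bachelier 0 x = max x 0"
  unfolding bachelier_def using std_normal.prob_space by simp

lemma bachelier_delta_bounds: "0 \<le> bachelier_delta v x" "bachelier_delta v x \<le> 1"
proof -
  show "0 \<le> bachelier_delta v x"
    unfolding bachelier_delta_def by (rule integral_nonneg_AE) auto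
  have "bachelier_delta v x \<le> (\<integral>z. 1 \<partial>std_normal_distribution)"
    unfolding bachelier_delta_def by (intro integral_mono integrable_digital) (auto split: split_indicator)
  then show "bachelier_delta v x \<le> 1" using std_normal.prob_space by simp
qed

text \<open>The payoff is 1-Lipschitz, and a change of volatility displaces its argument by |v - v'|
  |z|, whose mean is at most |v - v'|. Comparison with the zero price at v = x = 0 also gives the
  growth bound of the price.\<close>

lemma bachelier_lipschitz:
  "\<bar>bachelier v x - bachelier v' x'\<bar> \<le> \<bar>x - x'\<bar> + \<bar>v - v'\<bar>"
proof -
  have "\<bar>bachelier v x - bachelier v' x'\<bar> =
    \<bar>\<integral>z. (max (x + v * z) 0 - max (x' + v' * z) 0) \<partial>std_normal_distribution\<bar>"
    unfolding bachelier_def by (subst Bochner_Integration.integral_diff) (auto intro: integrable_call)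
  also have "\<dots> \<le> (\<integral>z. \<bar>max (x + v * z) 0 - max (x' + v' * z) 0\<bar> \<partial>std_normal_distribution)"
    by (rule integral_abs_bound)
  also have "\<dots> \<le> (\<integral>z. \<bar>x - x'\<bar> + \<bar>v - v'\<bar> * \<bar>z\<bar> \<partial>std_normal_distribution)"
  proof (rule integral_mono)
    show "\<bar>max (x + v * z) 0 - max (x' + v' * z) 0\<bar> \<le> \<bar>x - x'\<bar> + \<bar>v - v'\<bar> * \<bar>z\<bar>" for z
    proof -
      have "\<bar>max (x + v * z) 0 - max (x' + v' * z) 0\<bar> \<le> \<bar>(x - x') + (v - v') * z\<bar>"
        by (auto simp: max_def algebra_simps abs_if)
      then show ?thesis by (simp add: abs_mult[symmetric])
    qed
  qed (auto intro!: integrable_call std_normal_abs_moment Bochner_Integration.integrable_diff)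
  also have "\<dots> = \<bar>x - x'\<bar> + \<bar>v - v'\<bar> * (\<integral>z. \<bar>z\<bar> \<partial>std_normal_distribution)"
    using std_normal_abs_moment(1) std_normal.prob_space by simp
  also have "\<dots> \<le> \<bar>x - x'\<bar> + \<bar>v - v'\<bar>"
    using std_normal_abs_moment(2) by (simp add: mult_left_le)
  finally show ?thesis .
qed

lemma continuous_bachelier:
  "continuous_on UNIV (\<lambda>p. bachelier (fst p) (snd p))"
proof -
  have "isCont (\<lambda>p. bachelier (fst p) (snd p)) p" for p
  proof -
    have "((\<lambda>q. \<bar>snd q - snd p\<bar> + \<bar>fst q - fst p\<bar>) \<longlongrightarrow> \<bar>snd p - snd p\<bar> + \<bar>fst p - fst p\<bar>) (at p)"
      by (intro tendsto_intros)
    then have lim: "((\<lambda>q. \<bar>snd q - snd p\<bar> + \<bar>fst q - fst p\<bar>) \<longlongrightarrow> 0) (at p)"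
      by simp
    have "((\<lambda>q. bachelier (fst q) (snd q) - bachelier (fst p) (snd p)) \<longlongrightarrow> 0) (at p)"
      by (rule Lim_null_comparison[OF always_eventually lim])
         (simp only: real_norm_def bachelier_lipschitz simp_thms)
    then show ?thesis unfolding isCont_def by (rule LIM_zero_cancel)
  qed
  then show ?thesis by (simp add: continuous_at_imp_continuous_on)
qed

lemma measurable_bachelier[measurable]:
  "(\<lambda>p. bachelier (fst p) (snd p)) \<in> borel_measurable (borel \<Otimes>\<^sub>M borel)"
  using borel_measurable_continuous_onI[OF continuous_bachelier] by (simp add: borel_prod)

text \<open>At v = 0 the delta is the indicator of x > 0, so it is not continuous in the pair;
  measurability comes from integrating a jointly measurable function over a parameter.\<close>

lemma measurable_bachelier_delta[measurable]:
  "(\<lambda>p. bachelier_delta (fst p) (snd p)) \<in> borel_measurable (borel \<Otimes>\<^sub>M borel)"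
  unfolding bachelier_delta_def
  by (rule std_normal.borel_measurable_lebesgue_integral) measurable

lemma bachelier_measurable1[measurable]: "bachelier v \<in> borel_measurable borel"
  using measurable_compose[OF measurable_Pair1'[of v borel borel] measurable_bachelier] by simp

lemma bachelier_delta_measurable1[measurable]: "bachelier_delta v \<in> borel_measurable borel"
  using measurable_compose[OF measurable_Pair1'[of v borel borel] measurable_bachelier_delta] by simp

lemma std_normal_density_le: "std_normal_density z \<le> 1 / 2"
proof -
  have "2 \<le> sqrt (2 * pi)"
    using pi_ge_two by (intro real_le_rsqrt) (simp add: power2_eq_square)
  then have "1 / sqrt (2 * pi) \<le> 1 / 2" by (intro divide_left_mono) auto
  moreover have "exp (- z\<^sup>2 / 2) \<le> 1" by simp
  ultimately show ?thesis
    unfolding std_normal_density_def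
    by (smt (verit) exp_ge_zero mult_left_le divide_nonneg_nonneg real_sqrt_ge_zero pi_ge_zero)
qed

text \<open>The event confines z to an interval of length 2 r / v, and the density is at most 1/2.
  The factors 1 / v in the estimates for price and delta all start here.\<close>

lemma std_normal_small_interval:
  assumes "0 < v" "0 \<le> r"
  shows "(\<integral>z. indicator {-r..r} (x + v * z) \<partial>std_normal_distribution) \<le> r / v"
proof -
  have eq: "indicator {-r..r} (x + v * z) = (indicator {(-x-r)/v..(r-x)/v} z :: real)" for z
    using assms(1) by (auto split: split_indicator simp: field_simps)
  have "(\<integral>z. indicator {-r..r} (x + v * z) \<partial>std_normal_distribution)
      = (\<integral>z. std_normal_density z * indicator {(-x-r)/v..(r-x)/v} z \<partial>lborel)"
    unfolding eq by (subst integral_density) auto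
  also have "\<dots> \<le> (\<integral>z. (1/2) * indicator {(-x-r)/v..(r-x)/v} z \<partial>lborel)"
  proof (rule integral_mono)
    show "integrable lborel (\<lambda>z. std_normal_density z * indicator {(-x-r)/v..(r-x)/v} z)"
      by (rule integrable_real_mult_indicator) auto
    show "integrable lborel (\<lambda>z. (1/2) * indicator {(-x-r)/v..(r-x)/v} z :: real)"
      by (intro integrable_mult_right integrable_real_indicator) (auto simp: emeasure_lborel_Icc_eq)
    show "std_normal_density z * indicator {(-x-r)/v..(r-x)/v} z \<le> (1/2) * indicator {(-x-r)/v..(r-x)/v} z" for z
      using std_normal_density_le[of z] by (auto split: split_indicator)
  qed
  also have "\<dots> = (1/2) * ((r-x)/v - (-x-r)/v)"
    using assms by (simp add: divide_right_mono)
  also have "\<dots> = r / v" by (simp add: diff_divide_distrib[symmetric])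
  finally show ?thesis .
qed

text \<open>A shift by y changes the exercise indicator only if x + v z lies within |y| of the
  kink.\<close>

lemma bachelier_delta_lipschitz:
  assumes "0 < v"
  shows "\<bar>bachelier_delta v (x + y) - bachelier_delta v x\<bar> \<le> \<bar>y\<bar> / v"
proof -
  have "\<bar>bachelier_delta v (x + y) - bachelier_delta v x\<bar> =
    \<bar>\<integral>z. (indicator {0<..} (x + y + v * z) - indicator {0<..} (x + v * z)) \<partial>std_normal_distribution\<bar>"
    unfolding bachelier_delta_def
    by (subst Bochner_Integration.integral_diff) (auto intro: integrable_digital)
  also have "\<dots> \<le> (\<integral>z. \<bar>indicator {0<..} (x + y + v * z) - indicator {0<..} (x + v * z)\<bar> \<partial>std_normal_distribution)"
    by (rule integral_abs_bound)
  also have "\<dots> \<le> (\<integral>z. indicator {-\<bar>y\<bar>..\<bar>y\<bar>} (x + v * z) \<partial>std_normal_distribution)"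
  proof (rule integral_mono)
    show "integrable std_normal_distribution (\<lambda>z. indicator {-\<bar>y\<bar>..\<bar>y\<bar>} (x + v * z) :: real)"
      by (rule std_normal.integrable_const_bound[of _ 1]) auto
    show "\<bar>indicator {0<..} (x + y + v * z) - indicator {0<..} (x + v * z)\<bar> 
        \<le> (indicator {-\<bar>y\<bar>..\<bar>y\<bar>} (x + v * z) :: real)" for z
      by (auto split: split_indicator)
  qed (auto intro!: integrable_digital Bochner_Integration.integrable_diff)
  also have "\<dots> \<le> \<bar>y\<bar> / v" using assms by (intro std_normal_small_interval) auto
  finally show ?thesis .
qed

text \<open>For the kinked payoff the first-order remainder is zero unless x + v z lies within |y|
  of 0, and there it is at most |y|. Together with the probability |y| / v of that event this gives
  a quadratic bound by averaging, without differentiating the density.\<close>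

lemma bachelier_taylor:
  assumes "0 < v"
  shows "\<bar>bachelier v (x + y) - bachelier v x - bachelier_delta v x * y\<bar> \<le> y\<^sup>2 / v"
proof -
  let ?f = "\<lambda>z. max (x + y + v * z) 0 - max (x + v * z) 0 - indicator {0<..} (x + v * z) * y"
  have int: "integrable std_normal_distribution ?f"
    by (intro Bochner_Integration.integrable_diff integrable_call integrable_mult_left integrable_digital)
  have "\<bar>bachelier v (x + y) - bachelier v x - bachelier_delta v x * y\<bar> =
    \<bar>\<integral>z. ?f z \<partial>std_normal_distribution\<bar>"
    unfolding bachelier_delta_def bachelier_def
    by (simp add: integrable_call integrable_digital)
  also have "\<dots> \<le> (\<integral>z. \<bar>?f z\<bar> \<partial>std_normal_distribution)"
    by (rule integral_abs_bound)
  also have "\<dots> \<le> (\<integral>z. \<bar>y\<bar> * indicator {-\<bar>y\<bar>..\<bar>y\<bar>} (x + v * z) \<partial>std_normal_distribution)"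
  proof (rule integral_mono)
    show "integrable std_normal_distribution (\<lambda>z. \<bar>y\<bar> * indicator {-\<bar>y\<bar>..\<bar>y\<bar>} (x + v * z) :: real)"
      by (intro integrable_mult_right std_normal.integrable_const_bound[of _ 1]) auto
    show "\<bar>?f z\<bar> \<le> (\<bar>y\<bar> * indicator {-\<bar>y\<bar>..\<bar>y\<bar>} (x + v * z) :: real)" for z
      by (auto split: split_indicator simp: max_def abs_if)
  qed (use int in auto)
  also have "\<dots> \<le> \<bar>y\<bar> * (\<bar>y\<bar> / v)" 
    by (subst integral_mult_right_zero, intro mult_left_mono std_normal_small_interval assms) auto
  also have "\<dots> = y\<^sup>2 / v" by (simp add: power2_eq_square)
  finally show ?thesis .
qed

text \<open>Multiplication of characteristic functions also covers a = 0 or b = 0, where one of the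
  two laws has no density.\<close>

lemma std_normal_convolution:
  "distr (std_normal_distribution \<Otimes>\<^sub>M std_normal_distribution) borel (\<lambda>(z, w). a * z + b * w)
    = distr std_normal_distribution borel (\<lambda>z. sqrt (a\<^sup>2 + b\<^sup>2) * z)" (is "?L = ?R")
proof (rule Levy_uniqueness)
  interpret pair_prob_space std_normal_distribution std_normal_distribution ..
  show "real_distribution ?L" by (rule real_distribution_distr) measurable
  show "real_distribution ?R" by (rule std_normal.real_distribution_distr) measurable
  show "char ?L = char ?R"
  proof
    fix u
    have "char ?L u = (CLINT p|std_normal_distribution \<Otimes>\<^sub>M std_normal_distribution. iexp (u * (a * fst p + b * snd p)))"
      unfolding char_def by (subst integral_distr) (auto simp: split_beta)
    also have "\<dots> = (CLINT z|std_normal_distribution. CLINT w|std_normal_distribution. iexp (u * (a * z + b * w)))"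
    proof -
      have "integrable (std_normal_distribution \<Otimes>\<^sub>M std_normal_distribution)
          (\<lambda>p. iexp (u * (a * fst p + b * snd p)))"
        by (rule integrable_iexp) auto
      from integral_fst'[OF this] show ?thesis by simp
    qed
    also have "\<dots> = (CLINT z|std_normal_distribution. iexp ((u * a) * z) * (CLINT w|std_normal_distribution. iexp ((u * b) * w)))"
    proof -
      have "iexp (u * (a * z + b * w)) = iexp ((u * a) * z) * iexp ((u * b) * w)" for z w
        unfolding exp_add[symmetric] by (simp add: distrib_left mult.assoc)
      then show ?thesis by (simp only: integral_mult_right_zero)
    qed
    also have "\<dots> = char std_normal_distribution (u * a) * char std_normal_distribution (u * b)"
      unfolding char_def by simp
    also have "\<dots> = char std_normal_distribution (u * sqrt (a\<^sup>2 + b\<^sup>2))"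
    proof -
      have "exp (- ((u * a)\<^sup>2) / 2) * exp (- ((u * b)\<^sup>2) / 2) = exp (- ((u * sqrt (a\<^sup>2 + b\<^sup>2))\<^sup>2) / 2)"
        unfolding exp_add[symmetric] by (simp add: power_mult_distrib field_simps)
      then show ?thesis
        unfolding char_std_normal_distribution by (simp only: of_real_mult[symmetric])
    qed
    also have "\<dots> = char ?R u"
      unfolding char_def by (subst integral_distr) (auto simp: mult.assoc)
    finally show "char ?L u = char ?R u" .
  qed
qed

lemma std_normal_iterated_integral:
  fixes f :: "real \<Rightarrow> real"
  assumes [measurable]: "f \<in> borel_measurable borel"
    and int: "integrable std_normal_distribution (\<lambda>z. f (sqrt (v\<^sup>2 + s\<^sup>2) * z))"
  shows "(\<integral>w. (\<integral>z. f (s * w + v * z) \<partial>std_normal_distribution) \<partial>std_normal_distribution)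
    = (\<integral>z. f (sqrt (v\<^sup>2 + s\<^sup>2) * z) \<partial>std_normal_distribution)"
proof -
  interpret pair_prob_space std_normal_distribution std_normal_distribution ..
  note conv = std_normal_convolution[of s v, unfolded add.commute[of "s\<^sup>2"]]
  have "integrable (distr std_normal_distribution borel (\<lambda>z. sqrt (v\<^sup>2 + s\<^sup>2) * z)) f"
    using int by (subst integrable_distr_eq) auto
  then have "integrable (std_normal_distribution \<Otimes>\<^sub>M std_normal_distribution) (\<lambda>p. f (s * fst p + v * snd p))"
    unfolding conv[symmetric] by (subst (asm) integrable_distr_eq) (auto simp: split_beta)
  then have "(\<integral>w. (\<integral>z. f (s * w + v * z) \<partial>std_normal_distribution) \<partial>std_normal_distribution)
     = (\<integral>p. f (s * fst p + v * snd p) \<partial>(std_normal_distribution \<Otimes>\<^sub>M std_normal_distribution))"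
    by (subst integral_fst'[symmetric]) auto
  also have "\<dots> = integral\<^sup>L (distr std_normal_distribution borel (\<lambda>z. sqrt (v\<^sup>2 + s\<^sup>2) * z)) f"
    unfolding conv[symmetric] by (subst integral_distr) (auto simp: split_beta)
  also have "\<dots> = (\<integral>z. f (sqrt (v\<^sup>2 + s\<^sup>2) * z) \<partial>std_normal_distribution)"
    by (subst integral_distr) auto
  finally show ?thesis .
qed

text \<open>Two independent Gaussian displacements merge into one whose variance is the sum. This is
  the martingale property of the price in analytic form.\<close>

lemma bachelier_semigroup:
  "(\<integral>w. bachelier v (x + s * w) \<partial>std_normal_distribution) = bachelier (sqrt (v\<^sup>2 + s\<^sup>2)) x"
  unfolding bachelier_def add.assoc
  by (rule std_normal_iterated_integral[of "\<lambda>y. max (x + y) 0"]) (auto intro: integrable_call)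

text \<open>Writes the delta at a larger volatility as an average of deltas at the smaller one, so
  that changes of volatility can be estimated through changes of the forward.\<close>

lemma bachelier_delta_semigroup:
  "(\<integral>w. bachelier_delta v (x + s * w) \<partial>std_normal_distribution) = bachelier_delta (sqrt (v\<^sup>2 + s\<^sup>2)) x"
  unfolding bachelier_delta_def add.assoc
  by (rule std_normal_iterated_integral[of "\<lambda>y. indicator {0<..} (x + y)"]) (auto intro: integrable_digital)


lemma bachelier_delta_eq_cdf:
  assumes "0 < v"
  shows "bachelier_delta v x = std_normal_cdf (x / v)"
proof -
  have "bachelier_delta v x = (\<integral>z. std_normal_density z * indicator {0<..} (x + v * z) \<partial>lborel)"
    unfolding bachelier_delta_def by (subst integral_density) auto
  \<comment> \<open>The reflection z to -z turns the upper tail of the exercise event into the lower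
    tail of the distribution function.\<close>
  also have "\<dots> = (\<integral>z. std_normal_density z * indicator {0<..} (x - v * z) \<partial>lborel)"
    by (subst lborel_integral_real_affine[where c="-1" and t=0]) (auto simp: std_normal_density_def)
  also have "\<dots> = std_normal_cdf (x / v)"
    unfolding std_normal_cdf_def set_lebesgue_integral_def
  proof (rule integral_cong_AE)
    \<comment> \<open>The open half-line from the payoff and the closed one in
      \<open>std_normal_cdf\<close> differ in this point only.\<close>
    have "AE z in lborel. z \<noteq> x / v" by (rule AE_lborel_singleton)
    then show "AE z in lborel. std_normal_density z * indicator {0<..} (x - v * z)
        = indicator {..x / v} z *\<^sub>R std_normal_density z"
      by eventually_elim (use assms in \<open>auto split: split_indicator simp: field_simps\<close>)
  qed auto
  finally show ?thesis .
qed

text \<open>\<open>- std_normal_density\<close> is an antiderivative of z times the density and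
  vanishes at infinity.\<close>

lemma integral_std_normal_tail:
  "(\<integral>z. std_normal_density z * (z * indicator {a<..} z) \<partial>lborel) = std_normal_density a"
proof -
  have int: "set_integrable lborel {a<..} (\<lambda>z. std_normal_density z * z)"
    unfolding set_integrable_def
    using integrable_real_mult_indicator[OF _ integrable_std_normal_moment[of 1], of "{a<..}"]
    by (simp add: mult.commute)
  have "(LBINT z=ereal a..\<infinity>. std_normal_density z * z) = 0 - (- std_normal_density a)"
  proof (rule interval_integral_FTC_integrable)
    fix z :: real
    have "((\<lambda>z. - std_normal_density z) has_real_derivative std_normal_density z * z) (at z)"
      unfolding std_normal_density_def by (auto intro!: derivative_eq_intros simp: field_simps)
    then show "((\<lambda>z. - std_normal_density z) has_vector_derivative std_normal_density z * z) (at z)"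
      by (simp add: has_real_derivative_iff_has_vector_derivative)
    show "isCont (\<lambda>z. std_normal_density z * z) z"
      unfolding std_normal_density_def by (intro continuous_intros) auto
  next
    show "set_integrable lborel (einterval (ereal a) \<infinity>) (\<lambda>z. std_normal_density z * z)"
      using int by (simp add: einterval_eq)
    have "isCont (\<lambda>z. - std_normal_density z) a"
      unfolding std_normal_density_def by (intro continuous_intros) auto
    then show "(((\<lambda>z. - std_normal_density z) \<circ> real_of_ereal) \<longlongrightarrow> - std_normal_density a) (at_right (ereal a))"
      unfolding ereal_tendsto_simps1 isCont_def by (auto simp: filterlim_at_split)
    have "((\<lambda>z. - std_normal_density z) \<longlongrightarrow> 0) at_top"
      unfolding std_normal_density_def by real_asymp
    then show "(((\<lambda>z. - std_normal_density z) \<circ> real_of_ereal) \<longlongrightarrow> 0) (at_left \<infinity>)"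
      unfolding ereal_tendsto_simps by (simp add: o_def)
  qed simp
  moreover have "(LBINT z=ereal a..\<infinity>. std_normal_density z * z) = (\<integral>z. std_normal_density z * (z * indicator {a<..} z) \<partial>lborel)"
    by (simp add: interval_integral_to_infinity_eq set_lebesgue_integral_def mult_ac)
  ultimately show ?thesis by simp
qed

text \<open>On the exercise event z > - x / v the payoff is x + v z: the part with x yields the
  delta, the part with z the Gaussian tail integral.\<close>

lemma bachelier_formula:
  assumes "0 < v"
  shows "bachelier v x = x * std_normal_cdf (x / v) + v * std_normal_density (x / v)"
proof -
  have eq: "max (x + v * z) 0 = x * indicator {0<..} (x + v * z) + v * (z * indicator {- x / v<..} z)" for z
    using assms by (auto split: split_indicator simp: field_simps max_def)
  have int: "integrable std_normal_distribution (\<lambda>z. z * indicator {- x / v<..} z)"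
    by (intro integrable_real_mult_indicator std_normal_moments) auto
  have "(\<integral>z. z * indicator {- x / v<..} z \<partial>std_normal_distribution) = std_normal_density (- x / v)"
    using integral_std_normal_tail[of "- x / v"] by (subst integral_density) auto
  also have "\<dots> = std_normal_density (x / v)" by (simp add: std_normal_density_def)
  finally show ?thesis
    unfolding bachelier_def eq bachelier_delta_eq_cdf[OF assms, symmetric]
    using int integrable_digital[of x v] by (simp add: bachelier_delta_def)
qed

text \<open>The distribution function is the delta at volatility 1 and inherits its Lipschitz
  bound.\<close>

lemma isCont_std_normal_cdf: "isCont std_normal_cdf y"
proof -
  have lip: "\<bar>std_normal_cdf z - std_normal_cdf y\<bar> \<le> \<bar>z - y\<bar>" for z
    using bachelier_delta_lipschitz[of 1 y "z - y"] by (simp add: bachelier_delta_eq_cdf)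
  have "((\<lambda>z. \<bar>z - y\<bar>) \<longlongrightarrow> \<bar>y - y\<bar>) (at y)" by (intro tendsto_intros)
  then have lim: "((\<lambda>z. \<bar>z - y\<bar>) \<longlongrightarrow> 0) (at y)" by simp
  have "((\<lambda>z. std_normal_cdf z - std_normal_cdf y) \<longlongrightarrow> 0) (at y)"
    by (rule Lim_null_comparison[OF always_eventually lim]) (simp only: real_norm_def lip simp_thms)
  then show ?thesis unfolding isCont_def by (rule LIM_zero_cancel)
qed

lemma measurable_std_normal_cdf[measurable]: "std_normal_cdf \<in> borel_measurable borel"
  by (intro borel_measurable_continuous_onI continuous_at_imp_continuous_on ballI isCont_std_normal_cdf)

lemma std_normal_cdf_bounds: "0 \<le> std_normal_cdf y" "std_normal_cdf y \<le> 1"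
  using bachelier_delta_bounds[of 1 y] by (simp_all add: bachelier_delta_eq_cdf)

subsection \<open>Gaussian variables independent of a sub-sigma-algebra\<close>

lemma (in prob_space) integrable_iexp_mult:
  assumes [measurable]: "G \<in> borel_measurable M" "Y \<in> borel_measurable M"
    and bd: "\<And>\<omega>. \<omega> \<in> space M \<Longrightarrow> norm (G \<omega>) \<le> 1"
  shows "integrable M (\<lambda>\<omega>. G \<omega> * iexp (u * Y \<omega>))"
  by (rule integrable_const_bound[of _ 1]) (auto simp: norm_mult bd)

text \<open>The law \<open>N(0, \<sigma>\<^sup>2)\<close> of \<open>Y\<close> and its independence of \<open>F\<close>, in one condition on characteristic
  functions, which also covers \<open>\<sigma> = 0\<close> and is closed under limits.\<close>

definition gauss_indep :: "'a measure \<Rightarrow> 'a measure \<Rightarrow> real \<Rightarrow> ('a \<Rightarrow> real) \<Rightarrow> bool" where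
  "gauss_indep M F \<sigma> Y \<longleftrightarrow> prob_space M \<and> subalgebra M F \<and> Y \<in> borel_measurable M \<and>
     (\<forall>A\<in>sets F. \<forall>u. (CLINT \<omega>|M. indicator A \<omega> * iexp (u * Y \<omega>)) =
        measure M A * exp (- ((u * \<sigma>)\<^sup>2) / 2))"

lemma char_scaled_normal:
  "(CLINT z|std_normal_distribution. iexp (u * (\<sigma> * z))) = exp (- ((u * \<sigma>)\<^sup>2) / 2)"
  using fun_cong[OF char_std_normal_distribution, of "u * \<sigma>"]
  by (simp add: char_def mult.assoc)

lemma gauss_indepD:
  assumes "gauss_indep M F \<sigma> Y"
  shows "prob_space M" "subalgebra M F" "Y \<in> borel_measurable M"
  using assms by (auto simp: gauss_indep_def)

text \<open>If A is not null, condition on it: under the uniform measure on A the characteristic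
  function of \<open>Y\<close> is that of the scaled normal law, and Levy uniqueness identifies the
  conditional law. If A is null, both sides are zero.\<close>

lemma gauss_indep_emeasure:
  assumes g: "gauss_indep M F \<sigma> Y" and A: "A \<in> sets F" and B[measurable]: "B \<in> sets borel"
  shows "emeasure M (A \<inter> (Y -` B \<inter> space M)) =
    emeasure M A * emeasure (distr std_normal_distribution borel (\<lambda>z. \<sigma> * z)) B"
proof -
  interpret prob_space M by (rule gauss_indepD[OF g])
  have sub: "subalgebra M F" and [measurable]: "Y \<in> borel_measurable M" using gauss_indepD[OF g] by auto
  have [measurable]: "A \<in> sets M" using A sub by (auto simp: subalgebra_def)
  show ?thesis
  proof (cases "prob A = 0")
    case True
    then have "A \<in> null_sets M" by (auto simp: emeasure_eq_measure)
    then have "A \<inter> (Y -` B \<inter> space M) \<in> null_sets M" by (rule null_set_Int2) measurable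
    then have "emeasure M (A \<inter> (Y -` B \<inter> space M)) = 0" by (rule null_setsD1)
    then show ?thesis using True by (simp add: emeasure_eq_measure)
  next
    case False
    then have pos: "0 < prob A" by (simp add: zero_less_measure_iff)
    let ?U = "uniform_measure M A"
    have "emeasure M A \<noteq> 0" "emeasure M A \<noteq> \<infinity>" using False by (auto simp: emeasure_eq_measure)
    then interpret U: prob_space ?U by (rule prob_space_uniform_measure)
    have U_dens: "?U = density M (\<lambda>x. ennreal (indicator A x / prob A))"
      unfolding uniform_measure_def
      by (intro density_cong) (auto simp: emeasure_eq_measure divide_ennreal[symmetric] pos split: split_indicator)
    have "distr ?U borel Y = distr std_normal_distribution borel (\<lambda>z. \<sigma> * z)"
    proof (rule Levy_uniqueness)
      show "real_distribution (distr ?U borel Y)" by (rule U.real_distribution_distr) simp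
      show "real_distribution (distr std_normal_distribution borel (\<lambda>z. \<sigma> * z))"
        by (rule std_normal.real_distribution_distr) measurable
      show "char (distr ?U borel Y) = char (distr std_normal_distribution borel (\<lambda>z. \<sigma> * z))"
      proof
        fix u
        have "char (distr ?U borel Y) u = (CLINT \<omega>|?U. iexp (u * Y \<omega>))"
          unfolding char_def by (subst integral_distr) auto
        also have "\<dots> = (CLINT \<omega>|M. (indicator A \<omega> / prob A) *\<^sub>R iexp (u * Y \<omega>))"
          unfolding U_dens by (subst integral_density) (use pos in auto)
        also have "\<dots> = (CLINT \<omega>|M. (1 / prob A) *\<^sub>R (indicator A \<omega> * iexp (u * Y \<omega>)))"
          by (intro Bochner_Integration.integral_cong) (auto split: split_indicator)
        also have "\<dots> = (1 / prob A) *\<^sub>R (CLINT \<omega>|M. indicator A \<omega> * iexp (u * Y \<omega>))"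
          by (rule integral_scaleR_right)
        also have "\<dots> = exp (- ((u * \<sigma>)\<^sup>2) / 2)"
          using g A pos by (simp add: gauss_indep_def scaleR_conv_of_real)
        also have "\<dots> = char (distr std_normal_distribution borel (\<lambda>z. \<sigma> * z)) u"
          unfolding char_scaled_normal[symmetric] char_def by (subst integral_distr) auto
        finally show "char (distr ?U borel Y) u = char (distr std_normal_distribution borel (\<lambda>z. \<sigma> * z)) u" .
      qed
    qed
    then have "emeasure (distr ?U borel Y) B = emeasure (distr std_normal_distribution borel (\<lambda>z. \<sigma> * z)) B"
      by simp
    also have "emeasure (distr ?U borel Y) B = emeasure M (A \<inter> (Y -` B \<inter> space M)) / emeasure M A"
      by (simp add: emeasure_distr)
    finally have "emeasure M A * emeasure (distr std_normal_distribution borel (\<lambda>z. \<sigma> * z)) B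
        = emeasure M A * (emeasure M (A \<inter> (Y -` B \<inter> space M)) / emeasure M A)" by simp
    also have "\<dots> = emeasure M (A \<inter> (Y -` B \<inter> space M)) * emeasure M A / emeasure M A"
      by (simp add: ennreal_times_divide mult.commute)
    also have "\<dots> = emeasure M (A \<inter> (Y -` B \<inter> space M))"
      using False by (intro mult_divide_eq_ennreal) (auto simp: emeasure_eq_measure)
    finally show ?thesis by simp
  qed
qed

text \<open>Independence as a product law on \<open>F\<close> times the line. The first factor is
  \<open>M\<close> restricted to \<open>F\<close>, because functions of \<omega> measurable for
  \<open>F\<close> are the ones that \<open>Y\<close> is independent of.\<close>

lemma gauss_indep_joint:
  assumes g: "gauss_indep M F \<sigma> Y"
  shows "restr_to_subalg M F \<Otimes>\<^sub>M distr std_normal_distribution borel (\<lambda>z. \<sigma> * z)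
    = distr M (F \<Otimes>\<^sub>M borel) (\<lambda>\<omega>. (\<omega>, Y \<omega>))"
proof (rule pair_measure_eqI)
  interpret prob_space M by (rule gauss_indepD[OF g])
  have sub: "subalgebra M F" and [measurable]: "Y \<in> borel_measurable M" using gauss_indepD[OF g] by auto
  interpret R: prob_space "restr_to_subalg M F"
    by (rule prob_space_restr_to_subalg[OF sub]) unfold_locales
  interpret D: prob_space "distr std_normal_distribution borel (\<lambda>z. \<sigma> * z)"
    by (rule std_normal.prob_space_distr) measurable
  show "sigma_finite_measure (restr_to_subalg M F)" by unfold_locales
  show "sigma_finite_measure (distr std_normal_distribution borel (\<lambda>z. \<sigma> * z))" by unfold_locales
  show "sets (restr_to_subalg M F \<Otimes>\<^sub>M distr std_normal_distribution borel (\<lambda>z. \<sigma> * z))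
     = sets (distr M (F \<Otimes>\<^sub>M borel) (\<lambda>\<omega>. (\<omega>, Y \<omega>)))"
    by (simp cong: sets_pair_measure_cong add: sets_restr_to_subalg[OF sub])
  fix A B assume "A \<in> sets (restr_to_subalg M F)" "B \<in> sets (distr std_normal_distribution borel (\<lambda>z. \<sigma> * z))"
  then have A: "A \<in> sets F" and B: "B \<in> sets borel" by (auto simp: sets_restr_to_subalg[OF sub])
  have [measurable]: "(\<lambda>\<omega>. \<omega>) \<in> measurable M F" using measurable_from_subalg[OF sub measurable_ident_sets[OF refl]] by simp
  have "A \<subseteq> space M" using A sub sets.sets_into_space by (fastforce simp: subalgebra_def)
  then have eq: "(\<lambda>\<omega>. (\<omega>, Y \<omega>)) -` (A \<times> B) \<inter> space M = A \<inter> (Y -` B \<inter> space M)" by auto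
  show "emeasure (restr_to_subalg M F) A * emeasure (distr std_normal_distribution borel (\<lambda>z. \<sigma> * z)) B
    = emeasure (distr M (F \<Otimes>\<^sub>M borel) (\<lambda>\<omega>. (\<omega>, Y \<omega>))) (A \<times> B)"
    using A B by (subst emeasure_distr) (auto simp: eq gauss_indep_emeasure[OF g A B] emeasure_restr_to_subalg[OF sub])
qed

text \<open>The freezing lemma: under the product law, Fubini integrates \<open>Y\<close> out while
  \<omega> stays fixed. The values lie in a Banach space because both complex exponentials and real
  payoffs are inserted.\<close>

lemma gauss_indep_integral:
  fixes h :: "'a \<Rightarrow> real \<Rightarrow> 'b::{banach, second_countable_topology}"
  assumes g: "gauss_indep M F \<sigma> Y"
    and h: "(\<lambda>(\<omega>, y). h \<omega> y) \<in> borel_measurable (F \<Otimes>\<^sub>M borel)"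
    and int: "integrable M (\<lambda>\<omega>. h \<omega> (Y \<omega>))"
  shows "integrable M (\<lambda>\<omega>. \<integral>z. h \<omega> (\<sigma> * z) \<partial>std_normal_distribution)" (is ?i)
    and "(\<integral>\<omega>. (\<integral>z. h \<omega> (\<sigma> * z) \<partial>std_normal_distribution) \<partial>M) = (\<integral>\<omega>. h \<omega> (Y \<omega>) \<partial>M)" (is ?e)
    and "(\<lambda>\<omega>. \<integral>z. h \<omega> (\<sigma> * z) \<partial>std_normal_distribution) \<in> borel_measurable F" (is ?m)
proof -
  interpret prob_space M by (rule gauss_indepD[OF g])
  have sub: "subalgebra M F" and [measurable]: "Y \<in> borel_measurable M" using gauss_indepD[OF g] by auto
  interpret R: prob_space "restr_to_subalg M F"
    by (rule prob_space_restr_to_subalg[OF sub]) unfold_locales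
  let ?D = "distr std_normal_distribution borel (\<lambda>z. \<sigma> * z)"
  interpret D: prob_space ?D
    by (rule std_normal.prob_space_distr) measurable
  interpret P: pair_sigma_finite "restr_to_subalg M F" ?D ..
  note [measurable_cong] = sets_restr_to_subalg[OF sub]
  have id[measurable]: "(\<lambda>\<omega>. \<omega>) \<in> measurable M F" using measurable_from_subalg[OF sub measurable_ident_sets[OF refl]] by simp
  have h': "(\<lambda>p. h (fst p) (snd p)) \<in> borel_measurable (F \<Otimes>\<^sub>M borel)" using h by (simp add: split_beta)
  have [measurable]: "h \<omega> \<in> borel_measurable borel" if "\<omega> \<in> space F" for \<omega>
    using measurable_compose[OF measurable_Pair1'[OF that] h] by simp
  have i1: "integrable (distr M (F \<Otimes>\<^sub>M borel) (\<lambda>\<omega>. (\<omega>, Y \<omega>))) (\<lambda>p. h (fst p) (snd p))"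
    using int h' by (subst integrable_distr_eq) auto
  then have i2: "integrable (restr_to_subalg M F \<Otimes>\<^sub>M ?D) (\<lambda>p. h (fst p) (snd p))"
    unfolding gauss_indep_joint[OF g] .
  have inner: "(\<integral>y. h \<omega> y \<partial>?D) = (\<integral>z. h \<omega> (\<sigma> * z) \<partial>std_normal_distribution)" if "\<omega> \<in> space F" for \<omega>
    using that by (subst integral_distr) auto
  have sp: "space (restr_to_subalg M F) = space F" "space M = space F"
    using sub by (auto simp: space_restr_to_subalg subalgebra_def)
  have "(\<lambda>(\<omega>, y). h \<omega> y) \<in> borel_measurable (F \<Otimes>\<^sub>M ?D)" 
    using h by (simp cong: measurable_cong_sets sets_pair_measure_cong)
  then have "(\<lambda>\<omega>. \<integral>y. h \<omega> y \<partial>?D) \<in> borel_measurable F"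
    by (rule D.borel_measurable_lebesgue_integral)
  then show m: ?m
    by (subst measurable_cong[OF inner[symmetric]]) auto
  have "integrable (restr_to_subalg M F) (\<lambda>\<omega>. \<integral>y. h \<omega> y \<partial>?D)"
    using P.integrable_fst'[OF i2] by simp
  then have "integrable (restr_to_subalg M F) (\<lambda>\<omega>. \<integral>z. h \<omega> (\<sigma> * z) \<partial>std_normal_distribution)"
    by (subst Bochner_Integration.integrable_cong[OF refl inner[symmetric]]) (auto simp: sp)
  then show ?i by (rule integrable_from_subalg[OF sub])
  have "(\<integral>\<omega>. (\<integral>z. h \<omega> (\<sigma> * z) \<partial>std_normal_distribution) \<partial>M)
      = (\<integral>\<omega>. (\<integral>z. h \<omega> (\<sigma> * z) \<partial>std_normal_distribution) \<partial>restr_to_subalg M F)"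
    by (rule integral_subalgebra2[OF sub m, symmetric])
  also have "\<dots> = (\<integral>\<omega>. (\<integral>y. h \<omega> y \<partial>?D) \<partial>restr_to_subalg M F)"
    by (intro Bochner_Integration.integral_cong refl inner[symmetric]) (simp add: sp)
  also have "\<dots> = (\<integral>p. h (fst p) (snd p) \<partial>(restr_to_subalg M F \<Otimes>\<^sub>M ?D))"
    using P.integral_fst'[OF i2] by simp
  also have "\<dots> = (\<integral>\<omega>. h \<omega> (Y \<omega>) \<partial>M)"
    unfolding gauss_indep_joint[OF g] using h' by (subst integral_distr) auto
  finally show ?e .
qed

text \<open>The indicator of a test set in \<open>F\<close> can be absorbed into h, so the freezing
  lemma verifies the defining property of the conditional expectation.\<close>

lemma gauss_indep_cond_exp:
  fixes h :: "'a \<Rightarrow> real \<Rightarrow> real"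
  assumes g: "gauss_indep M F \<sigma> Y"
    and h[measurable]: "(\<lambda>(\<omega>, y). h \<omega> y) \<in> borel_measurable (F \<Otimes>\<^sub>M borel)"
    and int: "integrable M (\<lambda>\<omega>. h \<omega> (Y \<omega>))"
  shows "AE \<omega> in M. real_cond_exp M F (\<lambda>\<omega>. h \<omega> (Y \<omega>)) \<omega> = (\<integral>z. h \<omega> (\<sigma> * z) \<partial>std_normal_distribution)"
proof -
  interpret prob_space M by (rule gauss_indepD[OF g])
  have sub: "subalgebra M F" and [measurable]: "Y \<in> borel_measurable M" using gauss_indepD[OF g] by auto
  interpret finite_measure_subalgebra M F using sub by unfold_locales
  show ?thesis
  proof (rule real_cond_exp_charact)
    fix A assume A[measurable]: "A \<in> sets F"
    then have AM[measurable]: "A \<in> sets M" using sub by (auto simp: subalgebra_def)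
    have "integrable M (\<lambda>\<omega>. indicator A \<omega> *\<^sub>R h \<omega> (Y \<omega>))"
      by (rule integrable_mult_indicator[OF AM int])
    then have "(\<integral>\<omega>. (\<integral>z. indicator A \<omega> *\<^sub>R h \<omega> (\<sigma> * z) \<partial>std_normal_distribution) \<partial>M) = (\<integral>\<omega>. indicator A \<omega> *\<^sub>R h \<omega> (Y \<omega>) \<partial>M)"
      by (intro gauss_indep_integral(2)[OF g]) (auto simp: split_beta)
    then show "(\<integral>\<omega>\<in>A. h \<omega> (Y \<omega>) \<partial>M) = (\<integral>\<omega>\<in>A. (\<integral>z. h \<omega> (\<sigma> * z) \<partial>std_normal_distribution) \<partial>M)"
      by (simp add: set_lebesgue_integral_def)
  qed (use int gauss_indep_integral[OF g h int] in auto)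
qed

text \<open>\<open>Z\<close> is integrated out first, with \<open>Y\<close> frozen by the larger
  algebra \<open>G\<close>; what remains is the condition on \<open>Y\<close> relative to
  \<open>F\<close>. This adds successive increments one at a time.\<close>

lemma gauss_indep_add:
  assumes g1: "gauss_indep M F \<sigma> Y" and g2: "gauss_indep M G \<tau> Z"
    and FG: "sets F \<subseteq> sets G" and Y: "Y \<in> borel_measurable G"
  shows "gauss_indep M F (sqrt (\<sigma>\<^sup>2 + \<tau>\<^sup>2)) (\<lambda>\<omega>. Y \<omega> + Z \<omega>)"
proof -
  interpret prob_space M by (rule gauss_indepD[OF g1])
  note [measurable] = gauss_indepD(3)[OF g1] gauss_indepD(3)[OF g2] Y
  show ?thesis unfolding gauss_indep_def
  proof (intro conjI ballI allI)
    fix A u assume A: "A \<in> sets F"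
    then have [measurable]: "A \<in> sets G" "A \<in> sets M"
      using FG gauss_indepD(2)[OF g1] by (auto simp: subalgebra_def)
    let ?h = "\<lambda>\<omega> y. (indicator A \<omega> * iexp (u * Y \<omega>)) * iexp (u * y)"
    have "(CLINT \<omega>|M. indicator A \<omega> * iexp (u * (Y \<omega> + Z \<omega>))) = (CLINT \<omega>|M. ?h \<omega> (Z \<omega>))"
      by (intro Bochner_Integration.integral_cong refl) (simp add: distrib_left exp_add)
    also have "\<dots> = (CLINT \<omega>|M. (CLINT z|std_normal_distribution. ?h \<omega> (\<tau> * z)))"
    proof (rule gauss_indep_integral(2)[OF g2, symmetric])
      show "integrable M (\<lambda>\<omega>. ?h \<omega> (Z \<omega>))"
        by (rule integrable_const_bound[of _ 1]) (auto simp: norm_mult split: split_indicator)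
    qed measurable
    also have "\<dots> = (CLINT \<omega>|M. (indicator A \<omega> * iexp (u * Y \<omega>)) * exp (- ((u * \<tau>)\<^sup>2) / 2))"
      by (simp only: integral_mult_right_zero char_scaled_normal)
    also have "\<dots> = (CLINT \<omega>|M. indicator A \<omega> * iexp (u * Y \<omega>)) * exp (- ((u * \<tau>)\<^sup>2) / 2)"
      by (rule integral_mult_left_zero)
    also have "(CLINT \<omega>|M. indicator A \<omega> * iexp (u * Y \<omega>)) = measure M A * exp (- ((u * \<sigma>)\<^sup>2) / 2)"
      using g1 A unfolding gauss_indep_def by blast
    also have "complex_of_real (measure M A * exp (- ((u * \<sigma>)\<^sup>2) / 2)) * complex_of_real (exp (- ((u * \<tau>)\<^sup>2) / 2))
        = complex_of_real (measure M A * (exp (- ((u * \<sigma>)\<^sup>2) / 2) * exp (- ((u * \<tau>)\<^sup>2) / 2)))"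
      by simp
    also have "exp (- ((u * \<sigma>)\<^sup>2) / 2) * exp (- ((u * \<tau>)\<^sup>2) / 2) = exp (- ((u * sqrt (\<sigma>\<^sup>2 + \<tau>\<^sup>2))\<^sup>2) / 2)"
      unfolding exp_add[symmetric] by (simp add: power_mult_distrib distrib_left add_divide_distrib)
    finally show "(CLINT \<omega>|M. indicator A \<omega> * iexp (u * (Y \<omega> + Z \<omega>))) =
       measure M A * exp (- ((u * sqrt (\<sigma>\<^sup>2 + \<tau>\<^sup>2))\<^sup>2) / 2)" by simp
  qed (use gauss_indepD[OF g1] in auto)
qed

lemma gauss_indep_zero:
  assumes "prob_space M" "subalgebra M F"
  shows "gauss_indep M F 0 (\<lambda>\<omega>. 0)"
proof -
  interpret prob_space M by fact
  have "(CLINT \<omega>|M. indicator A \<omega>) = complex_of_real (prob A)" if "A \<in> sets F" for A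
    using that assms(2) integral_complex_of_real[of M "indicator A"]
    by (simp add: subalgebra_def subset_eq of_real_indicator)
  then show ?thesis using assms by (auto simp: gauss_indep_def)
qed

lemma norm_iexp_diff_le: "norm (iexp a - iexp b) \<le> \<bar>a - b\<bar>"
proof -
  have "iexp a - iexp b = iexp b * (iexp (a - b) - 1)"
    by (simp add: right_diff_distrib exp_diff algebra_simps)
  then have "norm (iexp a - iexp b) = norm (iexp (a - b) - 1)" by (simp add: norm_mult)
  also have "\<dots> \<le> \<bar>a - b\<bar>" using iexp_approx1[of "a - b" 0] by simp
  finally show ?thesis .
qed

lemma (in prob_space) abs_expectation_le_L2:
  fixes f :: "'a \<Rightarrow> real"
  assumes [measurable]: "f \<in> borel_measurable M" and int: "integrable M (\<lambda>x. (f x)\<^sup>2)"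
  shows "integrable M f" "(expectation (\<lambda>x. \<bar>f x\<bar>))\<^sup>2 \<le> expectation (\<lambda>x. (f x)\<^sup>2)"
proof -
  show i: "integrable M f"
  proof (rule Bochner_Integration.integrable_bound[of _ "\<lambda>x. 1 + (f x)\<^sup>2"])
    have "\<bar>y\<bar> \<le> 1 + y\<^sup>2" for y :: real
      using sum_squares_bound[of 1 "\<bar>y\<bar>"] by simp
    then show "AE x in M. norm (f x) \<le> norm (1 + (f x)\<^sup>2)" by simp
  qed (use int in auto)
  show "(expectation (\<lambda>x. \<bar>f x\<bar>))\<^sup>2 \<le> expectation (\<lambda>x. (f x)\<^sup>2)"
    using jensens_inequality[where X="\<lambda>x. \<bar>f x\<bar>" and I=UNIV and q=power2] i int by (auto simp: convex_power2)
qed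

text \<open>Since |iexp a - iexp b| \<le> |a - b|, the defining expectations for \<open>Y k\<close>
  and \<open>Z\<close> differ by at most |u| times the L^2 distance, so the identity passes to the
  limit. The variances may tend to 0.\<close>

lemma gauss_indep_limit:
  assumes g: "\<And>k. gauss_indep M F (\<sigma> k) (Y k)"
    and Z[measurable]: "Z \<in> borel_measurable M"
    and lim: "(\<lambda>k. \<integral>\<^sup>+\<omega>. ennreal ((Y k \<omega> - Z \<omega>)\<^sup>2) \<partial>M) \<longlonglongrightarrow> 0"
    and \<sigma>: "(\<lambda>k. (\<sigma> k)\<^sup>2) \<longlonglongrightarrow> \<tau>\<^sup>2"
  shows "gauss_indep M F \<tau> Z"
proof -
  interpret prob_space M by (rule gauss_indepD[OF g])
  note [measurable] = gauss_indepD(3)[OF g]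
  show ?thesis unfolding gauss_indep_def
  proof (intro conjI ballI allI)
    fix A u assume A: "A \<in> sets F"
    then have [measurable]: "A \<in> sets M"
      using gauss_indepD(2)[OF g] by (auto simp: subalgebra_def)
    let ?I = "\<lambda>Y. (CLINT \<omega>|M. indicator A \<omega> * iexp (u * Y \<omega>))"
    have "(\<lambda>k. complex_of_real (measure M A * exp (- ((u * \<sigma> k)\<^sup>2) / 2))) \<longlonglongrightarrow> measure M A * exp (- ((u * \<tau>)\<^sup>2) / 2)"
      unfolding power_mult_distrib by (intro tendsto_intros \<sigma>) auto
    then have l1: "(\<lambda>k. ?I (Y k)) \<longlonglongrightarrow> measure M A * exp (- ((u * \<tau>)\<^sup>2) / 2)"
      using g A by (simp add: gauss_indep_def)
    have bd: "ennreal ((norm (?I (Y k) - ?I Z))\<^sup>2) \<le> ennreal (u\<^sup>2) * (\<integral>\<^sup>+\<omega>. ennreal ((Y k \<omega> - Z \<omega>)\<^sup>2) \<partial>M)" for k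
    proof (cases "integrable M (\<lambda>\<omega>. (Y k \<omega> - Z \<omega>)\<^sup>2)")
      case True
      note L2 = abs_expectation_le_L2[OF _ True]
      have i: "integrable M (\<lambda>\<omega>. indicator A \<omega> * iexp (u * V \<omega>))" if [measurable]: "V \<in> borel_measurable M" for V
        by (rule integrable_iexp_mult) (auto split: split_indicator)
      have "norm (?I (Y k) - ?I Z) = norm (CLINT \<omega>|M. indicator A \<omega> * (iexp (u * Y k \<omega>) - iexp (u * Z \<omega>)))"
        unfolding right_diff_distrib by (subst Bochner_Integration.integral_diff[OF i i]) auto
      also have "\<dots> \<le> (\<integral>\<omega>. norm (indicator A \<omega> * (iexp (u * Y k \<omega>) - iexp (u * Z \<omega>))) \<partial>M)"
        by (rule integral_norm_bound)
      also have "\<dots> \<le> (\<integral>\<omega>. \<bar>u\<bar> * \<bar>Y k \<omega> - Z \<omega>\<bar> \<partial>M)"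
      proof (rule integral_mono)
        show "integrable M (\<lambda>\<omega>. \<bar>u\<bar> * \<bar>Y k \<omega> - Z \<omega>\<bar>)" using L2 by auto
        show "integrable M (\<lambda>\<omega>. norm (indicator A \<omega> * (iexp (u * Y k \<omega>) - iexp (u * Z \<omega>))))"
          using i[of "Y k"] i[of Z] by (intro integrable_norm) (simp add: right_diff_distrib)
        show "norm (indicator A \<omega> * (iexp (u * Y k \<omega>) - iexp (u * Z \<omega>))) \<le> \<bar>u\<bar> * \<bar>Y k \<omega> - Z \<omega>\<bar>" for \<omega>
          using norm_iexp_diff_le[of "u * Y k \<omega>" "u * Z \<omega>"]
          by (auto simp: norm_mult right_diff_distrib[symmetric] abs_mult split: split_indicator)
      qed
      finally have "norm (?I (Y k) - ?I Z) \<le> \<bar>u\<bar> * (\<integral>\<omega>. \<bar>Y k \<omega> - Z \<omega>\<bar> \<partial>M)" by simp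
      then have "(norm (?I (Y k) - ?I Z))\<^sup>2 \<le> (\<bar>u\<bar> * (\<integral>\<omega>. \<bar>Y k \<omega> - Z \<omega>\<bar> \<partial>M))\<^sup>2"
        by (rule power_mono) simp
      also have "\<dots> \<le> u\<^sup>2 * (\<integral>\<omega>. (Y k \<omega> - Z \<omega>)\<^sup>2 \<partial>M)"
        unfolding power_mult_distrib power2_abs by (intro mult_left_mono L2) auto
      finally have "ennreal ((norm (?I (Y k) - ?I Z))\<^sup>2) \<le> ennreal (u\<^sup>2 * (\<integral>\<omega>. (Y k \<omega> - Z \<omega>)\<^sup>2 \<partial>M))"
        by (rule ennreal_leI)
      then show ?thesis
        using True by (simp add: ennreal_mult nn_integral_eq_integral)
    next
      case False
      then have inf: "(\<integral>\<^sup>+\<omega>. ennreal ((Y k \<omega> - Z \<omega>)\<^sup>2) \<partial>M) = \<infinity>"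
        by (auto simp: integrable_iff_bounded less_top[symmetric])
      \<comment> \<open>The right-hand side is infinite, except for u = 0, where it is zero times
        infinity, hence zero, and the two expectations coincide.\<close>
      show ?thesis
      proof (cases "u = 0")
        case True
        then show ?thesis by simp
      next
        case False
        then show ?thesis unfolding inf by (simp add: ennreal_mult_eq_top_iff)
      qed
    qed
    have "(\<lambda>k. ennreal (u\<^sup>2) * (\<integral>\<^sup>+\<omega>. ennreal ((Y k \<omega> - Z \<omega>)\<^sup>2) \<partial>M)) \<longlonglongrightarrow> ennreal (u\<^sup>2) * 0"
      by (intro ennreal_tendsto_cmult lim) auto
    then have lim2: "(\<lambda>k. ennreal (u\<^sup>2) * (\<integral>\<^sup>+\<omega>. ennreal ((Y k \<omega> - Z \<omega>)\<^sup>2) \<partial>M)) \<longlonglongrightarrow> ennreal 0"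
      by simp
    have "(\<lambda>k. ennreal ((norm (?I (Y k) - ?I Z))\<^sup>2)) \<longlonglongrightarrow> ennreal 0"
      by (rule tendsto_sandwich[OF always_eventually always_eventually tendsto_const lim2])
         (simp_all only: bd zero_le ennreal_0 simp_thms)
    then have "(\<lambda>k. (norm (?I (Y k) - ?I Z))\<^sup>2) \<longlonglongrightarrow> 0"
      by (subst (asm) tendsto_ennreal_iff) (simp_all only: eventually_True zero_le_power2 order_refl simp_thms)
    then have "(\<lambda>k. norm (?I (Y k) - ?I Z)) \<longlonglongrightarrow> 0"
      using tendsto_real_sqrt[of "\<lambda>k. (norm (?I (Y k) - ?I Z))\<^sup>2" 0 sequentially] by simp
    then have "(\<lambda>k. ?I (Y k)) \<longlonglongrightarrow> ?I Z"
      by (subst (asm) tendsto_norm_zero_iff) (rule LIM_zero_cancel)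
    with l1 show "?I Z = measure M A * exp (- ((u * \<tau>)\<^sup>2) / 2)"
      using LIMSEQ_unique by blast
  qed (use gauss_indepD[OF g] in auto)
qed

lemma borel_measurable_vec_nth[measurable]: "(\<lambda>x. x $ i) \<in> borel_measurable (borel :: (real^'n) measure)"
  by (intro borel_measurable_continuous_onI continuous_intros)

text \<open>Links independence of set systems, the form used for Brownian increments, to
  independence of variables, the form of the product rule for expectations.\<close>

lemma (in prob_space) indep_varI_set:
  assumes X: "X \<in> measurable M S" and Y: "Y \<in> measurable M T"
    and "indep_set {X -` A \<inter> space M |A. A \<in> sets S} {Y -` A \<inter> space M |A. A \<in> sets T}"
  shows "indep_var S X T Y"
  unfolding indep_var_def indep_vars_def2
proof
  show "\<forall>i\<in>UNIV. (case i of True \<Rightarrow> X | False \<Rightarrow> Y) \<in> measurable M (case i of True \<Rightarrow> S | False \<Rightarrow> T)"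
    using X Y by (auto split: bool.split)
  show "indep_sets (\<lambda>i. {(case i of True \<Rightarrow> X | False \<Rightarrow> Y) -` A \<inter> space M |A.
      A \<in> sets (case i of True \<Rightarrow> S | False \<Rightarrow> T)}) UNIV"
    using assms(3) unfolding indep_set_def
    by (rule indep_sets_mono_sets) (auto split: bool.splits)
qed

text \<open>The case A = \<open>space M\<close> of the product formula.\<close>

lemma gauss_indep_distr:
  assumes g: "gauss_indep M F \<sigma> Y"
  shows "distr M borel Y = distr std_normal_distribution borel (\<lambda>z. \<sigma> * z)"
proof (rule measure_eqI)
  interpret prob_space M by (rule gauss_indepD[OF g])
  have [measurable]: "Y \<in> borel_measurable M" using gauss_indepD[OF g] by auto
  have sp: "space M \<in> sets F" using gauss_indepD(2)[OF g] sets.top[of F] by (simp add: subalgebra_def)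
  fix B assume "B \<in> sets (distr M borel Y)"
  then have B[measurable]: "B \<in> sets borel" by simp
  show "emeasure (distr M borel Y) B = emeasure (distr std_normal_distribution borel (\<lambda>z. \<sigma> * z)) B"
    using gauss_indep_emeasure[OF g sp B] emeasure_space_1
    by (simp add: emeasure_distr Int_absorb1 sets.sets_into_space)
qed simp

lemma gauss_indep_has_integral:
  fixes f :: "real \<Rightarrow> real"
  assumes g: "gauss_indep M F \<sigma> Y" and [measurable]: "f \<in> borel_measurable borel"
    and int: "integrable std_normal_distribution (\<lambda>z. f (\<sigma> * z))"
  shows "integrable M (\<lambda>\<omega>. f (Y \<omega>))"
    and "(\<integral>\<omega>. f (Y \<omega>) \<partial>M) = (\<integral>z. f (\<sigma> * z) \<partial>std_normal_distribution)"
proof -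
  have [measurable]: "Y \<in> borel_measurable M" using gauss_indepD[OF g] by auto
  have "integrable (distr M borel Y) f"
    unfolding gauss_indep_distr[OF g] using int by (subst integrable_distr_eq) auto
  then show "integrable M (\<lambda>\<omega>. f (Y \<omega>))" by (subst (asm) integrable_distr_eq) auto
  have "(\<integral>\<omega>. f (Y \<omega>) \<partial>M) = integral\<^sup>L (distr M borel Y) f" by (subst integral_distr) auto
  also have "\<dots> = (\<integral>z. f (\<sigma> * z) \<partial>std_normal_distribution)"
    unfolding gauss_indep_distr[OF g] by (subst integral_distr) auto
  finally show "(\<integral>\<omega>. f (Y \<omega>) \<partial>M) = (\<integral>z. f (\<sigma> * z) \<partial>std_normal_distribution)" .
qed

lemma gauss_indep_moments:
  assumes g: "gauss_indep M F \<sigma> Y"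
  shows "integrable M Y" "(\<integral>\<omega>. Y \<omega> \<partial>M) = 0"
    "integrable M (\<lambda>\<omega>. (Y \<omega>)\<^sup>2)" "(\<integral>\<omega>. (Y \<omega>)\<^sup>2 \<partial>M) = \<sigma>\<^sup>2"
    "integrable M (\<lambda>\<omega>. (Y \<omega>) ^ 4)" "(\<integral>\<omega>. (Y \<omega>) ^ 4 \<partial>M) = 3 * \<sigma> ^ 4"
  by (simp_all add: gauss_indep_has_integral[OF g, of "\<lambda>y. y"] gauss_indep_has_integral[OF g, of "\<lambda>y. y\<^sup>2"]
    gauss_indep_has_integral[OF g, of "\<lambda>y. y ^ 4"] std_normal_moments power_mult_distrib)

lemma gauss_indep_indep_var:
  assumes g: "gauss_indep M F \<sigma> Y" and G: "G \<in> borel_measurable F"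
  shows "prob_space.indep_var M borel G borel Y"
proof -
  interpret prob_space M by (rule gauss_indepD[OF g])
  have sub: "subalgebra M F" and [measurable]: "Y \<in> borel_measurable M" using gauss_indepD[OF g] by auto
  have [measurable]: "G \<in> borel_measurable M" by (rule measurable_from_subalg[OF sub G])
  have sp: "space F = space M" using sub by (simp add: subalgebra_def)
  show ?thesis
  proof (rule indep_varI_set)
    have "prob (a \<inter> b) = prob a * prob b"
      if a: "a \<in> {G -` A \<inter> space M |A. A \<in> sets borel}" and b: "b \<in> {Y -` A \<inter> space M |A. A \<in> sets borel}" for a b
    proof -
      from b obtain B where B: "b = Y -` B \<inter> space M" "B \<in> sets borel" by auto
      from a have aF: "a \<in> sets F" using G by (auto simp: measurable_def sp)
      have "emeasure M (a \<inter> b) = emeasure M a * emeasure (distr M borel Y) B"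
        unfolding B(1) gauss_indep_distr[OF g] by (rule gauss_indep_emeasure[OF g aF B(2)])
      also have "emeasure (distr M borel Y) B = emeasure M b"
        using B by (simp add: emeasure_distr)
      finally show ?thesis by (simp add: emeasure_eq_measure ennreal_mult[symmetric])
    qed
    then show "indep_set {G -` A \<inter> space M |A. A \<in> sets borel} {Y -` A \<inter> space M |A. A \<in> sets borel}"
      unfolding indep_sets2_eq by (auto intro: measurable_sets)
  qed auto
qed

text \<open>Used with f the identity, where it makes increments orthogonal to the past, and with f
  the square, where it leads to the isometry.\<close>

lemma gauss_indep_mult:
  fixes f :: "real \<Rightarrow> real"
  assumes g: "gauss_indep M F \<sigma> Y" and G: "G \<in> borel_measurable F" "integrable M G"
    and [measurable]: "f \<in> borel_measurable borel"
    and int: "integrable std_normal_distribution (\<lambda>z. f (\<sigma> * z))"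
  shows "integrable M (\<lambda>\<omega>. G \<omega> * f (Y \<omega>))"
    and "(\<integral>\<omega>. G \<omega> * f (Y \<omega>) \<partial>M) = (\<integral>\<omega>. G \<omega> \<partial>M) * (\<integral>z. f (\<sigma> * z) \<partial>std_normal_distribution)"
proof -
  interpret prob_space M by (rule gauss_indepD[OF g])
  have iv: "indep_var borel G borel (\<lambda>\<omega>. f (Y \<omega>))"
    using indep_var_compose[OF gauss_indep_indep_var[OF g G(1)], of "\<lambda>x. x" borel f borel] by (simp add: comp_def)
  note h = gauss_indep_has_integral[OF g _ int]
  show "integrable M (\<lambda>\<omega>. G \<omega> * f (Y \<omega>))"
    using indep_var_integrable[OF iv G(2) h(1)] by simp
  show "(\<integral>\<omega>. G \<omega> * f (Y \<omega>) \<partial>M) = (\<integral>\<omega>. G \<omega> \<partial>M) * (\<integral>z. f (\<sigma> * z) \<partial>std_normal_distribution)"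
    using indep_var_lebesgue_integral[OF iv G(2) h(1)] h(2) by simp
qed

lemma gauss_indep_mult_moments:
  assumes g: "gauss_indep M F \<sigma> Y" and G: "G \<in> borel_measurable F" "integrable M G"
  shows "integrable M (\<lambda>\<omega>. G \<omega> * Y \<omega>)" "(\<integral>\<omega>. G \<omega> * Y \<omega> \<partial>M) = 0"
    "integrable M (\<lambda>\<omega>. G \<omega> * (Y \<omega>)\<^sup>2)" "(\<integral>\<omega>. G \<omega> * (Y \<omega>)\<^sup>2 \<partial>M) = \<sigma>\<^sup>2 * (\<integral>\<omega>. G \<omega> \<partial>M)"
  by (simp_all add: gauss_indep_mult[OF g G, of "\<lambda>y. y"] gauss_indep_mult[OF g G, of "\<lambda>y. y\<^sup>2"]
    std_normal_moments power_mult_distrib)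

section \<open>Brownian increments relative to a filtration\<close>

text \<open>The filtration is not tied to \<open>W\<close>: in the application it is generated by
  the Brownian motion under the original measure, while \<open>W\<close> is the shifted process,
  which is Brownian under the martingale measure.\<close>

locale bm_filtered = prob_space M for M :: "'a measure" +
  fixes Fil :: "real \<Rightarrow> 'a measure" and Tb :: real and W :: "real \<Rightarrow> 'a \<Rightarrow> real^'n"
  assumes subalg: "\<And>t. t \<in> {0..Tb} \<Longrightarrow> subalgebra M (Fil t)"
    and fil_mono: "\<And>s t. 0 \<le> s \<Longrightarrow> s \<le> t \<Longrightarrow> t \<le> Tb \<Longrightarrow> sets (Fil s) \<subseteq> sets (Fil t)"
    and bm: "brownian_motion M Fil Tb W"
begin

lemma space_fil: "t \<in> {0..Tb} \<Longrightarrow> space (Fil t) = space M"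
  using subalg[of t] by (simp add: subalgebra_def)

lemma fil_measurable_mono:
  "f \<in> measurable (Fil s) N \<Longrightarrow> 0 \<le> s \<Longrightarrow> s \<le> t \<Longrightarrow> t \<le> Tb \<Longrightarrow> f \<in> measurable (Fil t) N"
  using fil_mono[of s t] space_fil[of s] space_fil[of t] by (auto simp: measurable_def)

lemma fil_measurable: "f \<in> measurable (Fil s) N \<Longrightarrow> s \<in> {0..Tb} \<Longrightarrow> f \<in> measurable M N"
  using subalg[of s] measurable_from_subalg by blast

lemma W_fil: "t \<in> {0..Tb} \<Longrightarrow> W t \<in> borel_measurable (Fil t)"
  and W_meas: "t \<in> {0..Tb} \<Longrightarrow> W t \<in> borel_measurable M"
  using bm by (auto simp: brownian_motion_def)

lemma W_fil_le: "0 \<le> s \<Longrightarrow> s \<le> t \<Longrightarrow> t \<le> Tb \<Longrightarrow> W s \<in> borel_measurable (Fil t)"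
  using fil_measurable_mono[OF W_fil[of s], of t] by auto

text \<open>The coordinates of the increment are independent with variance t - s, so their
  characteristic functions multiply and the variances of c_i times them add up to |c|^2 (t - s). The
  case s = t is separate because the definition of Brownian motion speaks of s < t.\<close>

lemma increment_gauss_indep:
  assumes st: "0 \<le> s" "s \<le> t" "t \<le> Tb"
  shows "gauss_indep M (Fil s) (norm c * sqrt (t - s)) (\<lambda>\<omega>. c \<bullet> (W t \<omega> - W s \<omega>))"
proof (cases "s = t")
  case True
  then show ?thesis using gauss_indep_zero[OF prob_space_axioms subalg[of s]] st by simp
next
  case False
  with st have lt: "s < t" by simp
  have sub: "subalgebra M (Fil s)" using st by (intro subalg) auto
  have [measurable]: "W t \<in> borel_measurable M" "W s \<in> borel_measurable M" using st by (auto intro!: W_meas)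
  let ?D = "\<lambda>\<omega>. W t \<omega> - W s \<omega>"
  have [measurable]: "(\<lambda>\<omega>. W t \<omega> $ i) \<in> borel_measurable M" "(\<lambda>\<omega>. W s \<omega> $ i) \<in> borel_measurable M" for i
    by (rule measurable_compose[OF _ borel_measurable_vec_nth], fact)+
  from bm lt st have ind: "indep_set (sets (Fil s)) {?D -` A \<inter> space M | A. A \<in> sets borel}"
    and comp: "indep_vars (\<lambda>_. borel) (\<lambda>i \<omega>. ?D \<omega> $ i) UNIV"
    and dis: "\<And>i. distributed M lborel (\<lambda>\<omega>. ?D \<omega> $ i) (normal_density 0 (sqrt (t - s)))"
    by (auto simp: brownian_motion_def)
  have char1: "(CLINT \<omega>|M. iexp (u * ?D \<omega> $ i)) = exp (- ((u * sqrt (t - s))\<^sup>2) / 2)" for u i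
  proof -
    have "distributed M lborel (\<lambda>\<omega>. (?D \<omega> $ i - 0) / sqrt (t - s)) std_normal_density"
      using dis[of i] lt by (subst normal_standard_normal_convert[symmetric]) auto
    then have d: "distr M lborel (\<lambda>\<omega>. ?D \<omega> $ i / sqrt (t - s)) = std_normal_distribution"
      by (simp add: distributed_distr_eq_density)
    have "(CLINT \<omega>|M. iexp (u * ?D \<omega> $ i)) = (CLINT \<omega>|M. iexp (u * (sqrt (t - s) * (?D \<omega> $ i / sqrt (t - s)))))"
      using lt by simp
    also have "\<dots> = (CLINT z|distr M lborel (\<lambda>\<omega>. ?D \<omega> $ i / sqrt (t - s)). iexp (u * (sqrt (t - s) * z)))"
      by (subst integral_distr) simp_all
    also have "\<dots> = exp (- ((u * sqrt (t - s))\<^sup>2) / 2)"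
      unfolding d by (rule char_scaled_normal)
    finally show ?thesis .
  qed
  have char_c: "(CLINT \<omega>|M. iexp (u * (c \<bullet> ?D \<omega>))) = exp (- ((u * (norm c * sqrt (t - s)))\<^sup>2) / 2)" for u
  proof -
    have iv: "indep_vars (\<lambda>_. borel) (\<lambda>i \<omega>. c $ i * ?D \<omega> $ i) UNIV"
      using indep_vars_compose2[OF comp, of "\<lambda>i x. c $ i * x" "\<lambda>_. borel"] by simp
    have "(CLINT \<omega>|M. iexp (u * (c \<bullet> ?D \<omega>))) = char (distr M borel (\<lambda>\<omega>. \<Sum>i\<in>UNIV. c $ i * ?D \<omega> $ i)) u"
      unfolding char_def inner_vec_def by (subst integral_distr) auto
    also have "\<dots> = (\<Prod>i\<in>UNIV. char (distr M borel (\<lambda>\<omega>. c $ i * ?D \<omega> $ i)) u)"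
      by (rule char_distr_sum[OF iv])
    also have "\<dots> = (\<Prod>i\<in>UNIV. complex_of_real (exp (- ((u * c $ i * sqrt (t - s))\<^sup>2) / 2)))"
    proof (rule prod.cong[OF refl])
      fix i
      have "char (distr M borel (\<lambda>\<omega>. c $ i * ?D \<omega> $ i)) u = (CLINT \<omega>|M. iexp ((u * c $ i) * ?D \<omega> $ i))"
        unfolding char_def by (subst integral_distr) (auto simp: mult.assoc)
      then show "char (distr M borel (\<lambda>\<omega>. c $ i * ?D \<omega> $ i)) u = complex_of_real (exp (- ((u * c $ i * sqrt (t - s))\<^sup>2) / 2))"
        unfolding char1 .
    qed
    also have "\<dots> = complex_of_real (exp (\<Sum>i\<in>UNIV. - ((u * c $ i * sqrt (t - s))\<^sup>2) / 2))"
      by (simp add: exp_sum)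
    also have "(\<Sum>i\<in>UNIV. - ((u * c $ i * sqrt (t - s))\<^sup>2) / 2) = - ((u * (norm c * sqrt (t - s)))\<^sup>2) / 2"
      by (simp add: sum_negf sum_divide_distrib[symmetric] norm_vec_def L2_set_def power_mult_distrib sum_nonneg
          sum_distrib_left[symmetric] sum_distrib_right[symmetric])
    finally show ?thesis .
  qed
  show ?thesis unfolding gauss_indep_def
  proof (intro conjI ballI allI)
    fix A u assume A: "A \<in> sets (Fil s)"
    then have [measurable]: "A \<in> sets M" using sub by (auto simp: subalgebra_def)
    \<comment> \<open>The indicator generates sets of \<open>Fil s\<close> only and the exponential
      generates preimages under the increment only, so both inherit the independence of the two
      systems.\<close>
    have iv: "indep_var borel (indicator A :: 'a \<Rightarrow> complex) borel (\<lambda>\<omega>. iexp (u * (c \<bullet> ?D \<omega>)))"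
    proof (rule indep_varI_set)
      have sub1: "{indicator A -` B \<inter> space M |B :: complex set. B \<in> sets borel} \<subseteq> sets (Fil s)"
      proof safe
        fix B :: "complex set" assume "B \<in> sets borel"
        moreover have "(indicator A :: 'a \<Rightarrow> complex) \<in> borel_measurable (Fil s)" using A by measurable
        ultimately have "indicator A -` B \<inter> space (Fil s) \<in> sets (Fil s)" by (rule measurable_sets[rotated])
        then show "indicator A -` B \<inter> space M \<in> sets (Fil s)" using sub by (simp add: subalgebra_def)
      qed
      have sub2: "{(\<lambda>\<omega>. iexp (u * (c \<bullet> ?D \<omega>))) -` B \<inter> space M |B. B \<in> sets borel}
          \<subseteq> {?D -` A \<inter> space M | A. A \<in> sets borel}"
      proof safe
        fix B :: "complex set" assume B: "B \<in> sets borel"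
        have "(\<lambda>x. iexp (u * (c \<bullet> x))) -` B \<inter> space borel \<in> sets borel"
          by (rule measurable_sets[OF _ B]) measurable
        moreover have "(\<lambda>\<omega>. iexp (u * (c \<bullet> ?D \<omega>))) -` B = ?D -` ((\<lambda>x. iexp (u * (c \<bullet> x))) -` B)"
          by auto
        ultimately show "\<exists>A. (\<lambda>\<omega>. iexp (u * (c \<bullet> ?D \<omega>))) -` B \<inter> space M = ?D -` A \<inter> space M \<and> A \<in> sets borel"
          by auto
      qed
      show "indep_set {indicator A -` B \<inter> space M |B :: complex set. B \<in> sets borel}
         {(\<lambda>\<omega>. iexp (u * (c \<bullet> ?D \<omega>))) -` B \<inter> space M |B. B \<in> sets borel}"
        unfolding indep_set_def
      proof (rule indep_sets_mono_sets[OF ind[unfolded indep_set_def]])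
        fix i show "(case i of True \<Rightarrow> {indicator A -` B \<inter> space M |B :: complex set. B \<in> sets borel}
            | False \<Rightarrow> {(\<lambda>\<omega>. iexp (u * (c \<bullet> ?D \<omega>))) -` B \<inter> space M |B. B \<in> sets borel})
          \<subseteq> (case i of True \<Rightarrow> sets (Fil s) | False \<Rightarrow> {?D -` A \<inter> space M | A. A \<in> sets borel})"
          using sub1 sub2 by (cases i) simp_all
      qed
    qed measurable
    have "(CLINT \<omega>|M. indicator A \<omega> * iexp (u * (c \<bullet> ?D \<omega>)))
      = (CLINT \<omega>|M. indicator A \<omega>) * (CLINT \<omega>|M. iexp (u * (c \<bullet> ?D \<omega>)))"
      by (rule indep_var_lebesgue_integral[OF iv])
         (auto intro!: integrable_const_bound[of _ 1] split: split_indicator)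
    moreover have "(CLINT \<omega>|M. indicator A \<omega>) = complex_of_real (prob A)"
      using integral_complex_of_real[of M "indicator A"] by (simp add: of_real_indicator)
    ultimately show "(CLINT \<omega>|M. indicator A \<omega> * iexp (u * (c \<bullet> ?D \<omega>)))
       = prob A * exp (- ((u * (norm c * sqrt (t - s)))\<^sup>2) / 2)"
      unfolding char_c by simp
  qed (use sub prob_space_axioms in auto)
qed

definition bdd_meas :: "real \<Rightarrow> ('a \<Rightarrow> real^'n) \<Rightarrow> bool" where
  "bdd_meas s \<xi> \<longleftrightarrow> \<xi> \<in> borel_measurable (Fil s) \<and> (\<exists>B. \<forall>\<omega>\<in>space M. norm (\<xi> \<omega>) \<le> B)"

lemma bdd_meas_mono: "bdd_meas s \<xi> \<Longrightarrow> 0 \<le> s \<Longrightarrow> s \<le> t \<Longrightarrow> t \<le> Tb \<Longrightarrow> bdd_meas t \<xi>"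
  unfolding bdd_meas_def using fil_measurable_mono by blast

lemma bdd_meas_component:
  assumes "bdd_meas s \<xi>" "s \<in> {0..Tb}"
  shows "(\<lambda>\<omega>. \<xi> \<omega> $ i) \<in> borel_measurable (Fil s)" 
    and "integrable M G \<Longrightarrow> integrable M (\<lambda>\<omega>. G \<omega> * \<xi> \<omega> $ i)"
proof -
  have m: "\<xi> \<in> borel_measurable (Fil s)" using assms by (auto simp: bdd_meas_def)
  show c: "(\<lambda>\<omega>. \<xi> \<omega> $ i) \<in> borel_measurable (Fil s)" using m by measurable
  have [measurable]: "(\<lambda>\<omega>. \<xi> \<omega> $ i) \<in> borel_measurable M" by (rule fil_measurable[OF c assms(2)])
  obtain B where B: "\<And>\<omega>. \<omega> \<in> space M \<Longrightarrow> norm (\<xi> \<omega>) \<le> B" using assms by (auto simp: bdd_meas_def)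
  assume G: "integrable M G"
  then have [measurable]: "G \<in> borel_measurable M" by auto
  show "integrable M (\<lambda>\<omega>. G \<omega> * \<xi> \<omega> $ i)"
  proof (rule Bochner_Integration.integrable_bound[of _ "\<lambda>\<omega>. B * G \<omega>"])
    show "AE \<omega> in M. norm (G \<omega> * \<xi> \<omega> $ i) \<le> norm (B * G \<omega>)"
    proof (rule AE_I2)
      fix \<omega> assume "\<omega> \<in> space M"
      then have "\<bar>\<xi> \<omega> $ i\<bar> \<le> \<bar>B\<bar>" using B component_le_norm_cart[of "\<xi> \<omega>" i] by fastforce
      then show "norm (G \<omega> * \<xi> \<omega> $ i) \<le> norm (B * G \<omega>)"
        by (simp add: abs_mult mult.commute[of "\<bar>G \<omega>\<bar>"] mult_right_mono)
    qed
  qed (use G in auto)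
qed

text \<open>\<open>gauss_indep\<close> describes scalar projections of the increment; mixed second
  moments come from polarisation, a product of two coordinates being a quarter of the difference of
  the squared projections on e_i + e_j and e_i - e_j.\<close>

lemma increment_component:
  assumes "0 \<le> s" "s \<le> t" "t \<le> Tb" "G \<in> borel_measurable (Fil s)" "integrable M G"
  shows "integrable M (\<lambda>\<omega>. G \<omega> * (W t \<omega> - W s \<omega>) $ i)"
    and "(\<integral>\<omega>. G \<omega> * (W t \<omega> - W s \<omega>) $ i \<partial>M) = 0"
    and "integrable M (\<lambda>\<omega>. G \<omega> * ((W t \<omega> - W s \<omega>) $ i * (W t \<omega> - W s \<omega>) $ j))"
    and "(\<integral>\<omega>. G \<omega> * ((W t \<omega> - W s \<omega>) $ i * (W t \<omega> - W s \<omega>) $ j) \<partial>M)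
      = (if i = j then (t - s) * (\<integral>\<omega>. G \<omega> \<partial>M) else 0)"
proof -
  let ?D = "\<lambda>\<omega>. W t \<omega> - W s \<omega>"
  note g = increment_gauss_indep[OF assms(1-3)]
  note gm = gauss_indep_mult_moments[OF g assms(4,5)]
  have ax: "axis i 1 \<bullet> ?D \<omega> = ?D \<omega> $ i" for i \<omega> by (simp add: inner_axis' inner_real_def)
  show "integrable M (\<lambda>\<omega>. G \<omega> * (W t \<omega> - W s \<omega>) $ i)" "(\<integral>\<omega>. G \<omega> * (W t \<omega> - W s \<omega>) $ i \<partial>M) = 0"
    using gm(1,2)[of "axis i 1"] unfolding ax by auto
  let ?p = "axis i 1 + axis j 1 :: real^'n" and ?m = "axis i 1 - axis j 1 :: real^'n"
  have pol: "G \<omega> * (?D \<omega> $ i * ?D \<omega> $ j) = (G \<omega> * (?p \<bullet> ?D \<omega>)\<^sup>2 - G \<omega> * (?m \<bullet> ?D \<omega>)\<^sup>2) / 4" for \<omega>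
    unfolding inner_add_left inner_diff_left ax by (simp add: power2_eq_square algebra_simps)
  show "integrable M (\<lambda>\<omega>. G \<omega> * (?D \<omega> $ i * ?D \<omega> $ j))"
    unfolding pol by (intro integrable_divide Bochner_Integration.integrable_diff gm)
  have "(\<integral>\<omega>. G \<omega> * (?D \<omega> $ i * ?D \<omega> $ j) \<partial>M) = 
     ((norm ?p)\<^sup>2 - (norm ?m)\<^sup>2) / 4 * ((t - s) * (\<integral>\<omega>. G \<omega> \<partial>M))"
  proof -
    have "(\<integral>\<omega>. G \<omega> * (?D \<omega> $ i * ?D \<omega> $ j) \<partial>M) = 
       ((\<integral>\<omega>. G \<omega> * (?p \<bullet> ?D \<omega>)\<^sup>2 \<partial>M) - (\<integral>\<omega>. G \<omega> * (?m \<bullet> ?D \<omega>)\<^sup>2 \<partial>M)) / 4"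
      unfolding pol by (subst integral_divide_zero, subst Bochner_Integration.integral_diff[OF gm(3) gm(3)]) (rule refl)
    also have "\<dots> = ((norm ?p)\<^sup>2 - (norm ?m)\<^sup>2) / 4 * ((t - s) * (\<integral>\<omega>. G \<omega> \<partial>M))"
      unfolding gm(4) using assms by (simp add: power_mult_distrib field_simps)
    finally show ?thesis .
  qed
  also have "((norm ?p)\<^sup>2 - (norm ?m)\<^sup>2) / 4 = (if i = j then 1 else 0)"
    unfolding power2_norm_eq_inner by (simp add: inner_axis_axis algebra_simps)
  finally show "(\<integral>\<omega>. G \<omega> * (?D \<omega> $ i * ?D \<omega> $ j) \<partial>M)
      = (if i = j then (t - s) * (\<integral>\<omega>. G \<omega> \<partial>M) else 0)" by auto
qed

text \<open>A random direction \<xi> is expanded in coordinates, and each bounded coordinate is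
  absorbed into the past factor G.\<close>

lemma increment_orthogonal:
  assumes "0 \<le> s" "s \<le> t" "t \<le> Tb" "G \<in> borel_measurable (Fil s)" "integrable M G" "bdd_meas s \<xi>"
  shows "integrable M (\<lambda>\<omega>. G \<omega> * (\<xi> \<omega> \<bullet> (W t \<omega> - W s \<omega>)))"
    and "(\<integral>\<omega>. G \<omega> * (\<xi> \<omega> \<bullet> (W t \<omega> - W s \<omega>)) \<partial>M) = 0"
proof -
  have eq: "G \<omega> * (\<xi> \<omega> \<bullet> (W t \<omega> - W s \<omega>)) = (\<Sum>i\<in>UNIV. (G \<omega> * \<xi> \<omega> $ i) * (W t \<omega> - W s \<omega>) $ i)" for \<omega>
    by (simp add: inner_vec_def sum_distrib_left mult.assoc)
  have s: "s \<in> {0..Tb}" using assms by auto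
  note c = bdd_meas_component[OF assms(6) s]
  have m: "(\<lambda>\<omega>. G \<omega> * \<xi> \<omega> $ i) \<in> borel_measurable (Fil s)" for i
    using assms(4) c(1)[of i] by measurable
  note i = increment_component[OF assms(1-3) m c(2)[OF assms(5)]]
  show "integrable M (\<lambda>\<omega>. G \<omega> * (\<xi> \<omega> \<bullet> (W t \<omega> - W s \<omega>)))" 
    "(\<integral>\<omega>. G \<omega> * (\<xi> \<omega> \<bullet> (W t \<omega> - W s \<omega>)) \<partial>M) = 0"
    unfolding eq using i by auto
qed

text \<open>In the double sum over coordinates the off-diagonal terms have mean zero, and the
  diagonal ones add up to the inner product of \<xi> and \<zeta>.\<close>

lemma increment_isometry:
  assumes st: "0 \<le> s" "s \<le> t" "t \<le> Tb" and b: "bdd_meas s \<xi>" "bdd_meas s \<zeta>"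
  shows "integrable M (\<lambda>\<omega>. (\<xi> \<omega> \<bullet> (W t \<omega> - W s \<omega>)) * (\<zeta> \<omega> \<bullet> (W t \<omega> - W s \<omega>)))"
    and "(\<integral>\<omega>. (\<xi> \<omega> \<bullet> (W t \<omega> - W s \<omega>)) * (\<zeta> \<omega> \<bullet> (W t \<omega> - W s \<omega>)) \<partial>M) = (t - s) * (\<integral>\<omega>. \<xi> \<omega> \<bullet> \<zeta> \<omega> \<partial>M)"
proof -
  have s: "s \<in> {0..Tb}" using st by auto
  let ?D = "\<lambda>\<omega>. W t \<omega> - W s \<omega>"
  have eq: "(\<xi> \<omega> \<bullet> ?D \<omega>) * (\<zeta> \<omega> \<bullet> ?D \<omega>) 
    = (\<Sum>i\<in>UNIV. \<Sum>j\<in>UNIV. (\<xi> \<omega> $ i * \<zeta> \<omega> $ j) * (?D \<omega> $ i * ?D \<omega> $ j))" for \<omega>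
    by (simp add: inner_vec_def sum_product mult_ac)
  note c1 = bdd_meas_component[OF b(1) s] and c2 = bdd_meas_component[OF b(2) s]
  have m: "(\<lambda>\<omega>. \<xi> \<omega> $ i * \<zeta> \<omega> $ j) \<in> borel_measurable (Fil s)" for i j
    using c1(1)[of i] c2(1)[of j] by measurable
  have i1: "integrable M (\<lambda>\<omega>. \<xi> \<omega> $ i)" for i using c1(2)[of "\<lambda>_. 1" i] by simp
  note i2 = c2(2)[OF i1]
  note i = increment_component[OF st m i2]
  show "integrable M (\<lambda>\<omega>. (\<xi> \<omega> \<bullet> ?D \<omega>) * (\<zeta> \<omega> \<bullet> ?D \<omega>))"
    unfolding eq using i(3) by auto
  have "(\<integral>\<omega>. (\<xi> \<omega> \<bullet> ?D \<omega>) * (\<zeta> \<omega> \<bullet> ?D \<omega>) \<partial>M) = (\<Sum>i\<in>UNIV. \<Sum>j\<in>UNIV. if i = j then (t - s) * (\<integral>\<omega>. \<xi> \<omega> $ i * \<zeta> \<omega> $ j \<partial>M) else 0)"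
    unfolding eq using i(3,4) by simp
  also have "\<dots> = (t - s) * (\<Sum>i\<in>UNIV. (\<integral>\<omega>. \<xi> \<omega> $ i * \<zeta> \<omega> $ i \<partial>M))"
    by (simp add: sum_distrib_left)
  also have "(\<Sum>i\<in>UNIV. (\<integral>\<omega>. \<xi> \<omega> $ i * \<zeta> \<omega> $ i \<partial>M)) = (\<integral>\<omega>. \<xi> \<omega> \<bullet> \<zeta> \<omega> \<partial>M)"
    unfolding inner_vec_def using i2 by simp
  finally show "(\<integral>\<omega>. (\<xi> \<omega> \<bullet> ?D \<omega>) * (\<zeta> \<omega> \<bullet> ?D \<omega>) \<partial>M) = (t - s) * (\<integral>\<omega>. \<xi> \<omega> \<bullet> \<zeta> \<omega> \<partial>M)" .
qed

end

subsection \<open>The Ito isometry\<close>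

lemma integrable_mult_L2:
  fixes f g :: "'a \<Rightarrow> real"
  assumes [measurable]: "f \<in> borel_measurable M" "g \<in> borel_measurable M"
    and "integrable M (\<lambda>x. (f x)\<^sup>2)" "integrable M (\<lambda>x. (g x)\<^sup>2)"
  shows "integrable M (\<lambda>x. f x * g x)"
proof (rule Bochner_Integration.integrable_bound[of _ "\<lambda>x. (f x)\<^sup>2 + (g x)\<^sup>2"])
  have "\<bar>a * b\<bar> \<le> a\<^sup>2 + b\<^sup>2" for a b :: real
    using sum_squares_bound[of "\<bar>a\<bar>" "\<bar>b\<bar>"] mult_nonneg_nonneg[of "\<bar>a\<bar>" "\<bar>b\<bar>"]
    unfolding abs_mult power2_abs by linarith
  then show "AE x in M. norm (f x * g x) \<le> norm ((f x)\<^sup>2 + (g x)\<^sup>2)" by simp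
qed (use assms in auto)

lemma integrable_add_L2:
  fixes f g :: "'a \<Rightarrow> real"
  assumes "f \<in> borel_measurable M" "g \<in> borel_measurable M"
    and "integrable M (\<lambda>x. (f x)\<^sup>2)" "integrable M (\<lambda>x. (g x)\<^sup>2)"
  shows "integrable M (\<lambda>x. (f x + g x)\<^sup>2)"
  unfolding power2_sum using integrable_mult_L2[OF assms] assms(3,4) by (simp add: mult.assoc)

context bm_filtered
begin

definition stoch :: "real \<Rightarrow> real \<Rightarrow> ('a \<Rightarrow> real^'n) \<Rightarrow> 'a \<Rightarrow> real" where
  "stoch a b \<xi> \<omega> = \<xi> \<omega> \<bullet> (W b \<omega> - W a \<omega>)"

definition stoch_term :: "real \<Rightarrow> real \<Rightarrow> real \<Rightarrow> ('a \<Rightarrow> real^'n) \<Rightarrow> bool" where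
  "stoch_term U a b \<xi> \<longleftrightarrow> 0 \<le> a \<and> a \<le> b \<and> b \<le> U \<and> U \<le> Tb \<and> bdd_meas a \<xi>"

lemma stoch_split: "stoch a b \<xi> \<omega> = stoch a c \<xi> \<omega> + stoch c b \<xi> \<omega>"
  by (simp add: stoch_def inner_diff_right)

lemma stoch_fil:
  assumes "stoch_term U a b \<xi>" "b \<le> t" "t \<le> Tb"
  shows "stoch a b \<xi> \<in> borel_measurable (Fil t)"
proof -
  have [measurable]: "\<xi> \<in> borel_measurable (Fil t)" "W a \<in> borel_measurable (Fil t)" "W b \<in> borel_measurable (Fil t)"
    using assms bdd_meas_mono[of a \<xi> t] W_fil_le[of a t] W_fil_le[of b t]
    by (auto simp: stoch_term_def bdd_meas_def)
  show ?thesis unfolding stoch_def[abs_def] by measurable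
qed

lemma stoch_meas: "stoch_term U a b \<xi> \<Longrightarrow> stoch a b \<xi> \<in> borel_measurable M"
  using fil_measurable[OF stoch_fil[of U a b \<xi> b]] by (auto simp: stoch_term_def)

lemma stoch_L2: "stoch_term U a b \<xi> \<Longrightarrow> integrable M (\<lambda>\<omega>. (stoch a b \<xi> \<omega>)\<^sup>2)"
  unfolding stoch_def power2_eq_square stoch_term_def by (intro increment_isometry) auto

lemma stoch_mult_integrable:
  "stoch_term U a b \<xi> \<Longrightarrow> stoch_term U c d \<zeta> \<Longrightarrow> integrable M (\<lambda>\<omega>. stoch a b \<xi> \<omega> * stoch c d \<zeta> \<omega>)"
  by (rule integrable_mult_L2) (auto intro: stoch_meas stoch_L2)

lemma stoch_orthogonal:
  assumes t: "stoch_term U a b \<xi>" and G: "G \<in> borel_measurable (Fil a)" "integrable M (\<lambda>\<omega>. (G \<omega>)\<^sup>2)"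
  shows "(\<integral>\<omega>. G \<omega> * stoch a b \<xi> \<omega> \<partial>M) = 0"
proof -
  have "G \<in> borel_measurable M" using fil_measurable[OF G(1)] t by (auto simp: stoch_term_def)
  then have "integrable M G" using abs_expectation_le_L2(1) G(2) by blast
  then show ?thesis
    unfolding stoch_def using t G(1) by (intro increment_orthogonal) (auto simp: stoch_term_def)
qed

text \<open>Both cells are cut at c and at m = min b d. Pieces over disjoint times are orthogonal,
  the later one being tested against a variable of its past, so the common piece from c to m alone
  contributes.\<close>

lemma stoch_pair_aux:
  assumes t1: "stoch_term U a b \<xi>" and t2: "stoch_term U c d \<zeta>" and "a \<le> c"
  shows "(\<integral>\<omega>. stoch a b \<xi> \<omega> * stoch c d \<zeta> \<omega> \<partial>M)
     = measure lborel ({a<..b} \<inter> {c<..d}) * (\<integral>\<omega>. \<xi> \<omega> \<bullet> \<zeta> \<omega> \<partial>M)"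
proof (cases "b \<le> c")
  case True
  then have "{a<..b} \<inter> {c<..d} = {}" by auto
  moreover have "(\<integral>\<omega>. stoch a b \<xi> \<omega> * stoch c d \<zeta> \<omega> \<partial>M) = 0"
    using t2 by (intro stoch_orthogonal[OF t2] stoch_fil[OF t1] stoch_L2[OF t1] True) (auto simp: stoch_term_def)
  ultimately show ?thesis by (simp only: measure_empty mult_zero_left)
next
  case False
  define m where "m = min b d"
  have o: "0 \<le> a" "a \<le> c" "c \<le> m" "m \<le> b" "m \<le> d" "b \<le> U" "d \<le> U" "U \<le> Tb" "0 \<le> c"
    using t1 t2 False assms(3) by (auto simp: stoch_term_def m_def)
  have S1: "stoch_term U a c \<xi>" and S2: "stoch_term U c m \<xi>" and S3: "stoch_term U m b \<xi>"
    and R2: "stoch_term U c m \<zeta>" and R3: "stoch_term U m d \<zeta>"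
    using t1 t2 o bdd_meas_mono[of a \<xi> c] bdd_meas_mono[of a \<xi> m] bdd_meas_mono[of c \<zeta> m]
    by (auto simp: stoch_term_def)
  have o1: "m \<le> m" "c \<le> m" "c \<le> c" "m \<le> Tb" "c \<le> Tb" using o by auto
  have z1: "(\<integral>\<omega>. stoch a c \<xi> \<omega> * stoch c m \<zeta> \<omega> \<partial>M) = 0"
    by (intro stoch_orthogonal[OF R2] stoch_fil[OF S1] stoch_L2[OF S1] o1)
  have z2: "(\<integral>\<omega>. stoch a c \<xi> \<omega> * stoch m d \<zeta> \<omega> \<partial>M) = 0"
    by (intro stoch_orthogonal[OF R3] stoch_fil[OF S1] stoch_L2[OF S1] o1)
  have z3: "(\<integral>\<omega>. stoch c m \<xi> \<omega> * stoch m d \<zeta> \<omega> \<partial>M) = 0"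
    by (intro stoch_orthogonal[OF R3] stoch_fil[OF S2] stoch_L2[OF S2] o1)
  have z4: "(\<integral>\<omega>. stoch m b \<xi> \<omega> * stoch c m \<zeta> \<omega> \<partial>M) = 0"
    unfolding mult.commute[of "stoch m b \<xi> _"]
    by (intro stoch_orthogonal[OF S3] stoch_fil[OF R2] stoch_L2[OF R2] o1)
  \<comment> \<open>As m = min b d, one of the two remainders beyond m is an empty interval.\<close>
  have z5: "stoch m b \<xi> \<omega> * stoch m d \<zeta> \<omega> = 0" for \<omega>
    by (auto simp: stoch_def m_def min_def)
  have d: "(\<integral>\<omega>. stoch c m \<xi> \<omega> * stoch c m \<zeta> \<omega> \<partial>M) = (m - c) * (\<integral>\<omega>. \<xi> \<omega> \<bullet> \<zeta> \<omega> \<partial>M)"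
    unfolding stoch_def using S2 R2 by (intro increment_isometry) (auto simp: stoch_term_def)
  note i = stoch_mult_integrable[OF S1 R2] stoch_mult_integrable[OF S1 R3] stoch_mult_integrable[OF S2 R2]
    stoch_mult_integrable[OF S2 R3] stoch_mult_integrable[OF S3 R2]
  have "stoch a b \<xi> \<omega> * stoch c d \<zeta> \<omega> = stoch a c \<xi> \<omega> * stoch c m \<zeta> \<omega> + stoch a c \<xi> \<omega> * stoch m d \<zeta> \<omega>
     + stoch c m \<xi> \<omega> * stoch c m \<zeta> \<omega> + stoch c m \<xi> \<omega> * stoch m d \<zeta> \<omega> + stoch m b \<xi> \<omega> * stoch c m \<zeta> \<omega>" for \<omega>
    unfolding stoch_split[of a b \<xi> \<omega> c] stoch_split[of c b \<xi> \<omega> m] stoch_split[of c d \<zeta> \<omega> m]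
    using z5[of \<omega>] by (simp add: algebra_simps)
  then have "(\<integral>\<omega>. stoch a b \<xi> \<omega> * stoch c d \<zeta> \<omega> \<partial>M) = (m - c) * (\<integral>\<omega>. \<xi> \<omega> \<bullet> \<zeta> \<omega> \<partial>M)"
    using i z1 z2 z3 z4 d by simp
  moreover have "{a<..b} \<inter> {c<..d} = {c<..m}" using o by (auto simp: m_def)
  ultimately show ?thesis using o by simp
qed

lemma stoch_pair:
  assumes t1: "stoch_term U a b \<xi>" and t2: "stoch_term U c d \<zeta>"
  shows "(\<integral>\<omega>. stoch a b \<xi> \<omega> * stoch c d \<zeta> \<omega> \<partial>M)
     = measure lborel ({a<..b} \<inter> {c<..d}) * (\<integral>\<omega>. \<xi> \<omega> \<bullet> \<zeta> \<omega> \<partial>M)"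
proof (cases "a \<le> c")
  case True
  then show ?thesis by (rule stoch_pair_aux[OF t1 t2])
next
  case False
  then show ?thesis
    using stoch_pair_aux[OF t2 t1] by (simp add: mult.commute[of "stoch a b \<xi> _"] inner_commute Int_commute)
qed

abbreviation time_prod :: "real \<Rightarrow> (real \<times> 'a) measure" where
  "time_prod U \<equiv> restrict_space lborel {0..U} \<Otimes>\<^sub>M M"

lemma finite_time: "finite_measure (restrict_space lborel {0..U::real})"
  by (rule finite_measureI) (auto simp: emeasure_restrict_space space_restrict_space emeasure_lborel_Icc_eq)

lemma pair_time: "pair_sigma_finite (restrict_space lborel {0..U::real}) M"
proof -
  interpret finite_measure "restrict_space lborel {0..U}" by (rule finite_time)
  show ?thesis ..
qed

lemma integral_time_prod_rect:
  assumes g: "g \<in> borel_measurable M" and B: "\<And>\<omega>. \<omega> \<in> space M \<Longrightarrow> \<bar>g \<omega>\<bar> \<le> B" and "0 \<le> a" "b \<le> U"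
  shows "integrable (time_prod U) (\<lambda>p. indicator {a<..b} (fst p) * g (snd p))"
    and "(\<integral>p. indicator {a<..b} (fst p) * g (snd p) \<partial>time_prod U) = measure lborel {a<..b} * (\<integral>\<omega>. g \<omega> \<partial>M)"
proof -
  interpret T: finite_measure "restrict_space lborel {0..U}" by (rule finite_time)
  interpret P: pair_sigma_finite "restrict_space lborel {0..U}" M by (rule pair_time)
  interpret finite_measure "time_prod U" by (rule finite_measure_pair_measure) unfold_locales
  note [measurable] = g
  have [measurable]: "{a<..b} \<in> sets (restrict_space lborel {0..U})"
    using assms(3,4) by (auto simp: sets_restrict_space_iff)
  show i: "integrable (time_prod U) (\<lambda>p. indicator {a<..b} (fst p) * g (snd p))"
    using B order_trans[OF abs_ge_zero B] by (intro integrable_const_bound[of _ "\<bar>B\<bar>"])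
      (force simp: space_pair_measure split: split_indicator intro!: AE_I2)+
  have "(\<integral>p. indicator {a<..b} (fst p) * g (snd p) \<partial>time_prod U)
      = (\<integral>t. (\<integral>\<omega>. indicator {a<..b} t * g \<omega> \<partial>M) \<partial>restrict_space lborel {0..U})"
    using P.integral_fst'[OF i] by simp
  also have "\<dots> = (\<integral>t. indicator {a<..b} t * (\<integral>\<omega>. g \<omega> \<partial>M) \<partial>restrict_space lborel {0..U})"
    by simp
  also have "\<dots> = measure (restrict_space lborel {0..U}) {a<..b} * (\<integral>\<omega>. g \<omega> \<partial>M)"
    using assms(3,4) by (auto simp: space_restrict_space Int_absorb2 subset_eq)
  also have "measure (restrict_space lborel {0..U}) {a<..b} = measure lborel {a<..b}"
    using assms(3,4) by (subst measure_restrict_space) auto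
  finally show "(\<integral>p. indicator {a<..b} (fst p) * g (snd p) \<partial>time_prod U) = measure lborel {a<..b} * (\<integral>\<omega>. g \<omega> \<partial>M)" .
qed

text \<open>The cells may overlap, as they do in a difference of two simple integrals. Expanding
  both squares into pairs takes the place of a common refinement.\<close>

lemma stoch_isometry:
  fixes a b :: "'j \<Rightarrow> real" and \<xi> :: "'j \<Rightarrow> 'a \<Rightarrow> real^'n"
  assumes J: "finite J" and t: "\<And>j. j \<in> J \<Longrightarrow> stoch_term U (a j) (b j) (\<xi> j)"
  shows "integrable M (\<lambda>\<omega>. (\<Sum>j\<in>J. stoch (a j) (b j) (\<xi> j) \<omega>)\<^sup>2)"
    and "(\<integral>\<^sup>+\<omega>. ennreal ((\<Sum>j\<in>J. stoch (a j) (b j) (\<xi> j) \<omega>)\<^sup>2) \<partial>M)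
      = (\<integral>\<^sup>+p. ennreal ((norm (\<Sum>j\<in>J. indicator {a j<..b j} (fst p) *\<^sub>R \<xi> j (snd p)))\<^sup>2) \<partial>time_prod U)"
proof -
  let ?S = "\<lambda>j. stoch (a j) (b j) (\<xi> j)"
  let ?X = "\<lambda>p. (\<Sum>j\<in>J. indicator {a j<..b j} (fst p) *\<^sub>R \<xi> j (snd p))"
  let ?c = "\<lambda>i j. measure lborel ({a i<..b i} \<inter> {a j<..b j}) * (\<integral>\<omega>. \<xi> i \<omega> \<bullet> \<xi> j \<omega> \<partial>M)"
  have lhs_eq: "(\<Sum>j\<in>J. ?S j \<omega>)\<^sup>2 = (\<Sum>i\<in>J. \<Sum>j\<in>J. ?S i \<omega> * ?S j \<omega>)" for \<omega>
    by (simp add: power2_eq_square sum_product)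
  have ilhs: "integrable M (\<lambda>\<omega>. ?S i \<omega> * ?S j \<omega>)" if "i \<in> J" "j \<in> J" for i j
    by (rule stoch_mult_integrable[OF t[OF that(1)] t[OF that(2)]])
  show i1: "integrable M (\<lambda>\<omega>. (\<Sum>j\<in>J. ?S j \<omega>)\<^sup>2)"
    unfolding lhs_eq by (intro Bochner_Integration.integrable_sum ilhs)
  have lhs: "(\<integral>\<omega>. (\<Sum>j\<in>J. ?S j \<omega>)\<^sup>2 \<partial>M) = (\<Sum>i\<in>J. \<Sum>j\<in>J. ?c i j)"
    unfolding lhs_eq using ilhs stoch_pair[OF t t] by simp
  have rect: "integrable (time_prod U) (\<lambda>p. indicator ({a i<..b i} \<inter> {a j<..b j}) (fst p) * (\<xi> i (snd p) \<bullet> \<xi> j (snd p)))"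
    "(\<integral>p. indicator ({a i<..b i} \<inter> {a j<..b j}) (fst p) * (\<xi> i (snd p) \<bullet> \<xi> j (snd p)) \<partial>time_prod U) = ?c i j"
    if ij: "i \<in> J" "j \<in> J" for i j
  proof -
    note ti = t[OF ij(1), unfolded stoch_term_def] and tj = t[OF ij(2), unfolded stoch_term_def]
    obtain Bi Bj where B: "\<forall>\<omega>\<in>space M. norm (\<xi> i \<omega>) \<le> Bi" "\<forall>\<omega>\<in>space M. norm (\<xi> j \<omega>) \<le> Bj"
      using ti tj by (auto simp: bdd_meas_def)
    have [measurable]: "\<xi> i \<in> borel_measurable M" "\<xi> j \<in> borel_measurable M"
      using ti tj by (auto simp: bdd_meas_def intro!: fil_measurable)
    have eq: "{a i<..b i} \<inter> {a j<..b j} = {max (a i) (a j)<..min (b i) (b j)}" by auto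
    have bd: "\<bar>\<xi> i \<omega> \<bullet> \<xi> j \<omega>\<bar> \<le> Bi * Bj" if "\<omega> \<in> space M" for \<omega>
      using B that Cauchy_Schwarz_ineq2[of "\<xi> i \<omega>" "\<xi> j \<omega>"]
      by (meson mult_mono norm_ge_zero order_trans)
    show "integrable (time_prod U) (\<lambda>p. indicator ({a i<..b i} \<inter> {a j<..b j}) (fst p) * (\<xi> i (snd p) \<bullet> \<xi> j (snd p)))"
      "(\<integral>p. indicator ({a i<..b i} \<inter> {a j<..b j}) (fst p) * (\<xi> i (snd p) \<bullet> \<xi> j (snd p)) \<partial>time_prod U) = ?c i j"
      unfolding eq using ti tj bd by (intro integral_time_prod_rect[of "\<lambda>\<omega>. \<xi> i \<omega> \<bullet> \<xi> j \<omega>"]; auto)+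
  qed
  have rhs_eq: "(norm (?X p))\<^sup>2 = (\<Sum>i\<in>J. \<Sum>j\<in>J. indicator ({a i<..b i} \<inter> {a j<..b j}) (fst p) * (\<xi> i (snd p) \<bullet> \<xi> j (snd p)))" for p
    unfolding power2_norm_eq_inner inner_sum_left unfolding inner_sum_right
    by (intro sum.cong refl) (simp add: indicator_inter_arith del: Int_greaterThanAtMost)
  have i2: "integrable (time_prod U) (\<lambda>p. (norm (?X p))\<^sup>2)"
    unfolding rhs_eq by (intro Bochner_Integration.integrable_sum rect)
  have rhs: "(\<integral>p. (norm (?X p))\<^sup>2 \<partial>time_prod U) = (\<Sum>i\<in>J. \<Sum>j\<in>J. ?c i j)"
    unfolding rhs_eq using rect by simp
  show "(\<integral>\<^sup>+\<omega>. ennreal ((\<Sum>j\<in>J. ?S j \<omega>)\<^sup>2) \<partial>M) = (\<integral>\<^sup>+p. ennreal ((norm (?X p))\<^sup>2) \<partial>time_prod U)"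
    using i1 i2 lhs rhs by (simp add: nn_integral_eq_integral)
qed

lemma simple_adapted_term:
  assumes "simple_adapted Fil U N \<tau> \<xi>" "U \<le> Tb" "i < N"
  shows "0 \<le> \<tau> i" "\<tau> i \<le> \<tau> (Suc i)" "\<tau> (Suc i) \<le> U" "bdd_meas (\<tau> i) (\<xi> i)"
proof -
  show o: "0 \<le> \<tau> i" "\<tau> i \<le> \<tau> (Suc i)" "\<tau> (Suc i) \<le> U"
    using assms(1,3) unfolding simple_adapted_def by blast+
  have "\<tau> i \<in> {0..Tb}" using o assms(2) by auto
  then show "bdd_meas (\<tau> i) (\<xi> i)"
    using assms(1,3) unfolding simple_adapted_def bdd_meas_def by (metis space_fil)
qed

text \<open>Stopping at t removes the cells that start at or after t and cuts the others at t; for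
  the integrand this is multiplication by the indicator of {..t}.\<close>

lemma simple_integral_stoch:
  assumes s: "simple_adapted Fil U N \<tau> \<xi>" and U: "U \<le> Tb"
  shows "simple_integral_wrt W N \<tau> \<xi> t \<omega> = (\<Sum>i\<in>{i. i < N \<and> \<tau> i < t}. stoch (\<tau> i) (min t (\<tau> (Suc i))) (\<xi> i) \<omega>)"
    and "i < N \<Longrightarrow> \<tau> i < t \<Longrightarrow> stoch_term U (\<tau> i) (min t (\<tau> (Suc i))) (\<xi> i)"
    and "(\<Sum>i\<in>{i. i < N \<and> \<tau> i < t}. indicator {\<tau> i<..min t (\<tau> (Suc i))} u *\<^sub>R \<xi> i \<omega>) 
      = indicator {..t} u *\<^sub>R simple_proc N \<tau> \<xi> u \<omega>"
proof -
  note st = simple_adapted_term[OF s U]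
  show "simple_integral_wrt W N \<tau> \<xi> t \<omega> = (\<Sum>i\<in>{i. i < N \<and> \<tau> i < t}. stoch (\<tau> i) (min t (\<tau> (Suc i))) (\<xi> i) \<omega>)"
    unfolding simple_integral_wrt_def stoch_def
  proof (rule sum.mono_neutral_cong_right)
    show "\<forall>i\<in>{..<N} - {i. i < N \<and> \<tau> i < t}. \<xi> i \<omega> \<bullet> (W (min t (\<tau> (Suc i))) \<omega> - W (min t (\<tau> i)) \<omega>) = 0"
    proof
      fix i assume i: "i \<in> {..<N} - {i. i < N \<and> \<tau> i < t}"
      then have "min t (\<tau> (Suc i)) = t" "min t (\<tau> i) = t" using st(2)[of i] by auto
      then show "\<xi> i \<omega> \<bullet> (W (min t (\<tau> (Suc i))) \<omega> - W (min t (\<tau> i)) \<omega>) = 0" by simp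
    qed
  qed auto
  show "i < N \<Longrightarrow> \<tau> i < t \<Longrightarrow> stoch_term U (\<tau> i) (min t (\<tau> (Suc i))) (\<xi> i)"
    using st[of i] U by (auto simp: stoch_term_def)
  show "(\<Sum>i\<in>{i. i < N \<and> \<tau> i < t}. indicator {\<tau> i<..min t (\<tau> (Suc i))} u *\<^sub>R \<xi> i \<omega>) 
      = indicator {..t} u *\<^sub>R simple_proc N \<tau> \<xi> u \<omega>"
    unfolding simple_proc_def scaleR_sum_right
    by (rule sum.mono_neutral_cong_left) (auto split: split_indicator)
qed

text \<open>The difference is a single sum over the disjoint union of the two index sets, with the
  second family of values negated, so the isometry for overlapping cells applies.\<close>

lemma simple_isometry:
  assumes s1: "simple_adapted Fil U N \<tau> \<xi>" and s2: "simple_adapted Fil U N' \<tau>' \<xi>'" and U: "U \<le> Tb"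
  shows "(\<integral>\<^sup>+\<omega>. ennreal ((simple_integral_wrt W N \<tau> \<xi> t \<omega> - simple_integral_wrt W N' \<tau>' \<xi>' t \<omega>)\<^sup>2) \<partial>M)
   = (\<integral>\<^sup>+(u, \<omega>). ennreal ((norm (indicator {..t} u *\<^sub>R (simple_proc N \<tau> \<xi> u \<omega> - simple_proc N' \<tau>' \<xi>' u \<omega>)))\<^sup>2) \<partial>time_prod U)"
proof -
  let ?A = "{i. i < N \<and> \<tau> i < t}" and ?B = "{i. i < N' \<and> \<tau>' i < t}"
  note r1 = simple_integral_stoch[OF s1 U] and r2 = simple_integral_stoch[OF s2 U]
  define a where "a = case_sum \<tau> \<tau>'"
  define b where "b = case_sum (\<lambda>i. min t (\<tau> (Suc i))) (\<lambda>i. min t (\<tau>' (Suc i)))"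
  define \<zeta> where "\<zeta> = case_sum \<xi> (\<lambda>i \<omega>. - \<xi>' i \<omega>)"
  have neg: "stoch_term U p q (\<lambda>\<omega>. - x \<omega>)" if "stoch_term U p q x" for p q x
    using that by (auto simp: stoch_term_def bdd_meas_def)
  have t: "stoch_term U (a j) (b j) (\<zeta> j)" if "j \<in> ?A <+> ?B" for j
    using that r1(2) neg[OF r2(2)] by (auto simp: a_def b_def \<zeta>_def)
  have e1: "(\<Sum>j\<in>?A <+> ?B. stoch (a j) (b j) (\<zeta> j) \<omega>) 
     = simple_integral_wrt W N \<tau> \<xi> t \<omega> - simple_integral_wrt W N' \<tau>' \<xi>' t \<omega>" for \<omega>
    unfolding r1(1) r2(1) by (subst sum.Plus) (auto simp: a_def b_def \<zeta>_def stoch_def sum_negf)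
  have e2: "(\<Sum>j\<in>?A <+> ?B. indicator {a j<..b j} u *\<^sub>R \<zeta> j \<omega>) 
     = indicator {..t} u *\<^sub>R (simple_proc N \<tau> \<xi> u \<omega> - simple_proc N' \<tau>' \<xi>' u \<omega>)" for u \<omega>
    unfolding scaleR_diff_right r1(3)[symmetric] r2(3)[symmetric]
    by (subst sum.Plus) (auto simp: a_def b_def \<zeta>_def sum_negf)
  show ?thesis
    using stoch_isometry(2)[of "?A <+> ?B" U a b \<zeta>] t unfolding e1 e2 by (simp add: case_prod_beta')
qed

lemma simple_isometry_le:
  assumes "simple_adapted Fil U N \<tau> \<xi>" "simple_adapted Fil U N' \<tau>' \<xi>'" "U \<le> Tb"
  shows "(\<integral>\<^sup>+\<omega>. ennreal ((simple_integral_wrt W N \<tau> \<xi> t \<omega> - simple_integral_wrt W N' \<tau>' \<xi>' t \<omega>)\<^sup>2) \<partial>M)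
   \<le> (\<integral>\<^sup>+(u, \<omega>). ennreal ((norm (simple_proc N \<tau> \<xi> u \<omega> - simple_proc N' \<tau>' \<xi>' u \<omega>))\<^sup>2) \<partial>time_prod U)"
  unfolding simple_isometry[OF assms] by (intro nn_integral_mono) (auto split: split_indicator)

text \<open>At the horizon the stopping indicator is 1 everywhere, so nothing is lost; this equality
  recovers an integrand from the terminal value of its integral.\<close>

lemma simple_isometry_eq:
  assumes "simple_adapted Fil U N \<tau> \<xi>" "simple_adapted Fil U N' \<tau>' \<xi>'" "U \<le> Tb"
  shows "(\<integral>\<^sup>+\<omega>. ennreal ((simple_integral_wrt W N \<tau> \<xi> U \<omega> - simple_integral_wrt W N' \<tau>' \<xi>' U \<omega>)\<^sup>2) \<partial>M)
   = (\<integral>\<^sup>+(u, \<omega>). ennreal ((norm (simple_proc N \<tau> \<xi> u \<omega> - simple_proc N' \<tau>' \<xi>' u \<omega>))\<^sup>2) \<partial>time_prod U)"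
  unfolding simple_isometry[OF assms]
  by (intro nn_integral_cong) (auto split: split_indicator simp: space_pair_measure space_restrict_space)

lemma simple_integral_props:
  assumes s: "simple_adapted Fil U N \<tau> \<xi>" and U: "U \<le> Tb"
  shows "t \<in> {0..U} \<Longrightarrow> simple_integral_wrt W N \<tau> \<xi> t \<in> borel_measurable (Fil t)"
    and "simple_integral_wrt W N \<tau> \<xi> t \<in> borel_measurable M"
    and "integrable M (\<lambda>\<omega>. (simple_integral_wrt W N \<tau> \<xi> t \<omega>)\<^sup>2)"
    and "(\<integral>\<omega>. simple_integral_wrt W N \<tau> \<xi> t \<omega> \<partial>M) = 0"
proof -
  note r = simple_integral_stoch[OF s U]
  have eq: "simple_integral_wrt W N \<tau> \<xi> t = (\<lambda>\<omega>. \<Sum>i\<in>{i. i < N \<and> \<tau> i < t}. stoch (\<tau> i) (min t (\<tau> (Suc i))) (\<xi> i) \<omega>)"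
    using r(1) by auto
  show "simple_integral_wrt W N \<tau> \<xi> t \<in> borel_measurable (Fil t)" if "t \<in> {0..U}"
    unfolding eq using that U by (intro borel_measurable_sum stoch_fil[OF r(2)]) auto
  show "simple_integral_wrt W N \<tau> \<xi> t \<in> borel_measurable M"
    unfolding eq by (intro borel_measurable_sum stoch_meas[OF r(2)]) auto
  show "integrable M (\<lambda>\<omega>. (simple_integral_wrt W N \<tau> \<xi> t \<omega>)\<^sup>2)"
    unfolding eq by (rule stoch_isometry(1)) (auto intro: r(2))
  have "integrable M (stoch a b x)" "(\<integral>\<omega>. stoch a b x \<omega> \<partial>M) = 0" if "stoch_term U a b x" for a b x
    using abs_expectation_le_L2(1)[OF stoch_meas stoch_L2] stoch_orthogonal[of U a b x "\<lambda>_. 1"] that by auto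
  then show "(\<integral>\<omega>. simple_integral_wrt W N \<tau> \<xi> t \<omega> \<partial>M) = 0"
    unfolding eq using r(2) by (subst Bochner_Integration.integral_sum) auto
qed

lemma simple_proc_measurable:
  fixes \<xi> :: "nat \<Rightarrow> 'a \<Rightarrow> real^'n"
  assumes s: "simple_adapted Fil U N \<tau> \<xi>" and U: "U \<le> Tb"
  shows "(\<lambda>(t, \<omega>). simple_proc N \<tau> \<xi> t \<omega>) \<in> borel_measurable (time_prod U)"
proof -
  have [measurable]: "\<xi> i \<in> borel_measurable M" if "i < N" for i
    using simple_adapted_term[OF s U that] U by (auto simp: bdd_meas_def intro!: fil_measurable)
  have [measurable]: "{a<..b} \<inter> {0..U} \<in> sets (restrict_space lborel {0..U})" for a b
    by (auto simp: sets_restrict_space_iff)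
  have "(\<lambda>p. indicator ({\<tau> i<..\<tau> (Suc i)} \<inter> {0..U}) (fst p) *\<^sub>R \<xi> i (snd p)) \<in> borel_measurable (time_prod U)"
    if "i < N" for i using that by measurable
  then have m: "(\<lambda>p. \<Sum>i<N. indicator ({\<tau> i<..\<tau> (Suc i)} \<inter> {0..U}) (fst p) *\<^sub>R \<xi> i (snd p)) \<in> borel_measurable (time_prod U)"
    by (intro borel_measurable_sum) auto
  have "(\<lambda>(t, \<omega>). simple_proc N \<tau> \<xi> t \<omega>) \<in> borel_measurable (time_prod U) \<longleftrightarrow> 
     (\<lambda>p. \<Sum>i<N. indicator ({\<tau> i<..\<tau> (Suc i)} \<inter> {0..U}) (fst p) *\<^sub>R \<xi> i (snd p)) \<in> borel_measurable (time_prod U)"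
    by (rule measurable_cong)
       (auto simp: simple_proc_def space_pair_measure space_restrict_space split: split_indicator intro!: sum.cong)
  then show ?thesis using m by simp
qed

end

subsection \<open>Deterministic integrands\<close>

text \<open>Stated for extended nonnegative integrals, so that it can be applied before
  integrability is known; the factors come from (a + b)^2 \<le> 2 a^2 + 2 b^2.\<close>

lemma nn_L2_triangle:
  fixes f g h :: "'a \<Rightarrow> 'b::{second_countable_topology, real_normed_vector}"
  assumes [measurable]: "(\<lambda>x. f x - g x) \<in> borel_measurable M" "(\<lambda>x. g x - h x) \<in> borel_measurable M"
  shows "(\<integral>\<^sup>+x. ennreal ((norm (f x - h x))\<^sup>2) \<partial>M) \<le>
    2 * (\<integral>\<^sup>+x. ennreal ((norm (f x - g x))\<^sup>2) \<partial>M) + 2 * (\<integral>\<^sup>+x. ennreal ((norm (g x - h x))\<^sup>2) \<partial>M)"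
proof -
  have "ennreal ((norm (f x - h x))\<^sup>2) \<le> 2 * ennreal ((norm (f x - g x))\<^sup>2) + 2 * ennreal ((norm (g x - h x))\<^sup>2)" for x
  proof -
    have "norm (f x - h x) \<le> norm (f x - g x) + norm (g x - h x)"
      using norm_triangle_ineq[of "f x - g x" "g x - h x"] by simp
    then have "(norm (f x - h x))\<^sup>2 \<le> (norm (f x - g x) + norm (g x - h x))\<^sup>2"
      by (rule power_mono) simp
    also have "\<dots> \<le> 2 * (norm (f x - g x))\<^sup>2 + 2 * (norm (g x - h x))\<^sup>2"
      using sum_squares_bound[of "norm (f x - g x)" "norm (g x - h x)"] by (simp add: power2_sum)
    finally have "ennreal ((norm (f x - h x))\<^sup>2) \<le> ennreal (2 * (norm (f x - g x))\<^sup>2 + 2 * (norm (g x - h x))\<^sup>2)"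
      by (rule ennreal_leI)
    then show ?thesis by (simp add: ennreal_mult)
  qed
  then have "(\<integral>\<^sup>+x. ennreal ((norm (f x - h x))\<^sup>2) \<partial>M) \<le>
    (\<integral>\<^sup>+x. 2 * ennreal ((norm (f x - g x))\<^sup>2) + 2 * ennreal ((norm (g x - h x))\<^sup>2) \<partial>M)"
    by (rule nn_integral_mono)
  also have "\<dots> = 2 * (\<integral>\<^sup>+x. ennreal ((norm (f x - g x))\<^sup>2) \<partial>M) + 2 * (\<integral>\<^sup>+x. ennreal ((norm (g x - h x))\<^sup>2) \<partial>M)"
    by (subst nn_integral_add) (auto simp: nn_integral_cmult)
  finally show ?thesis .
qed

lemma nn_L2_triangle_real:
  fixes f g h :: "'a \<Rightarrow> real"
  assumes "(\<lambda>x. f x - g x) \<in> borel_measurable M" "(\<lambda>x. g x - h x) \<in> borel_measurable M"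
  shows "(\<integral>\<^sup>+x. ennreal ((f x - h x)\<^sup>2) \<partial>M) \<le>
    2 * (\<integral>\<^sup>+x. ennreal ((f x - g x)\<^sup>2) \<partial>M) + 2 * (\<integral>\<^sup>+x. ennreal ((g x - h x)\<^sup>2) \<partial>M)"
  using nn_L2_triangle[OF assms] by simp

lemma ennreal_tendsto_0_triangle:
  fixes A B C :: "nat \<Rightarrow> ennreal"
  assumes "\<And>k. A k \<le> 2 * B k + 2 * C k" "B \<longlonglongrightarrow> 0" "C \<longlonglongrightarrow> 0"
  shows "A \<longlonglongrightarrow> 0"
proof -
  have "(\<lambda>k. 2 * B k + 2 * C k) \<longlonglongrightarrow> 2 * 0 + 2 * 0"
    using assms(2,3) by (intro tendsto_add ennreal_tendsto_cmult) auto
  then have l: "(\<lambda>k. 2 * B k + 2 * C k) \<longlonglongrightarrow> 0" by simp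
  show ?thesis
    by (rule tendsto_sandwich[OF always_eventually always_eventually tendsto_const l])
       (use assms(1) in simp_all)
qed

text \<open>The difference of the squares is at most |f - g|^2 + 2 |g| |f - g|, and Cauchy-Schwarz
  controls the second term. It carries the variances of step integrals to the limit.\<close>

lemma L2_norm_tendsto:
  fixes f :: "nat \<Rightarrow> 'a \<Rightarrow> 'b::{second_countable_topology, real_normed_vector}"
  assumes [measurable]: "\<And>k. f k \<in> borel_measurable M" "g \<in> borel_measurable M"
    and f2: "\<And>k. (\<integral>\<^sup>+x. ennreal ((norm (f k x))\<^sup>2) \<partial>M) < \<infinity>"
    and g2: "(\<integral>\<^sup>+x. ennreal ((norm (g x))\<^sup>2) \<partial>M) < \<infinity>"
    and lim: "(\<lambda>k. \<integral>\<^sup>+x. ennreal ((norm (f k x - g x))\<^sup>2) \<partial>M) \<longlonglongrightarrow> 0"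
  shows "(\<lambda>k. \<integral>x. (norm (f k x))\<^sup>2 \<partial>M) \<longlonglongrightarrow> (\<integral>x. (norm (g x))\<^sup>2 \<partial>M)"
proof -
  have i: "integrable M (\<lambda>x. (norm (h x))\<^sup>2)" if "h \<in> borel_measurable M" "(\<integral>\<^sup>+x. ennreal ((norm (h x))\<^sup>2) \<partial>M) < \<infinity>"
    for h :: "'a \<Rightarrow> 'b" using that by (subst integrable_iff_bounded) auto
  have d2: "(\<integral>\<^sup>+x. ennreal ((norm (f k x - g x))\<^sup>2) \<partial>M) < \<infinity>" for k
  proof -
    have "(\<integral>\<^sup>+x. ennreal ((norm (f k x - g x))\<^sup>2) \<partial>M) \<le>
      2 * (\<integral>\<^sup>+x. ennreal ((norm (f k x - 0))\<^sup>2) \<partial>M) + 2 * (\<integral>\<^sup>+x. ennreal ((norm (0 - g x))\<^sup>2) \<partial>M)"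
      by (rule nn_L2_triangle) auto
    also have "\<dots> < \<infinity>" using f2[of k] g2 by (simp add: ennreal_mult_less_top)
    finally show ?thesis .
  qed
  note if2 = i[OF assms(1) f2] and ig2 = i[OF assms(2) g2]
  have id2: "integrable M (\<lambda>x. (norm (f k x - g x))\<^sup>2)" for k
    by (rule i[OF _ d2]) measurable
  let ?a = "\<integral>x. (norm (g x))\<^sup>2 \<partial>M" and ?e = "\<lambda>k. \<integral>x. (norm (f k x - g x))\<^sup>2 \<partial>M"
  have e0: "?e \<longlonglongrightarrow> 0"
  proof -
    have "(\<lambda>k. ennreal (?e k)) \<longlonglongrightarrow> ennreal 0"
      using lim id2 by (simp add: nn_integral_eq_integral)
    then show ?thesis by (subst (asm) tendsto_ennreal_iff) auto
  qed
  have bound: "\<bar>(\<integral>x. (norm (f k x))\<^sup>2 \<partial>M) - ?a\<bar> \<le> ?e k + 2 * sqrt (?a * ?e k)" for k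
  proof -
    have ip: "integrable M (\<lambda>x. norm (g x) * norm (f k x - g x))"
      by (rule integrable_mult_L2) (use ig2 id2[of k] in auto)
    have cs: "(\<integral>x. norm (g x) * norm (f k x - g x) \<partial>M) \<le> sqrt (?a * ?e k)"
    proof (rule real_le_rsqrt)
      have "(\<integral>\<^sup>+x. ennreal (norm (g x)) * ennreal (norm (f k x - g x)) \<partial>M)\<^sup>2
        \<le> (\<integral>\<^sup>+x. (ennreal (norm (g x)))\<^sup>2 \<partial>M) * (\<integral>\<^sup>+x. (ennreal (norm (f k x - g x)))\<^sup>2 \<partial>M)"
        by (rule Cauchy_Schwarz_nn_integral) auto
      then have "ennreal ((\<integral>x. norm (g x) * norm (f k x - g x) \<partial>M)\<^sup>2) \<le> ennreal (?a * ?e k)"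
        using ip ig2 id2[of k]
        by (simp add: ennreal_mult[symmetric] ennreal_power nn_integral_eq_integral)
      then show "(\<integral>x. norm (g x) * norm (f k x - g x) \<partial>M)\<^sup>2 \<le> ?a * ?e k"
        by (subst (asm) ennreal_le_iff) auto
    qed
    have pt: "\<bar>(norm (f k x))\<^sup>2 - (norm (g x))\<^sup>2\<bar> \<le> (norm (f k x - g x))\<^sup>2 + 2 * (norm (g x) * norm (f k x - g x))" for x
    proof -
      have t: "\<bar>norm (f k x) - norm (g x)\<bar> \<le> norm (f k x - g x)" by (rule norm_triangle_ineq3)
      have "(norm (f k x))\<^sup>2 - (norm (g x))\<^sup>2 = (norm (f k x) - norm (g x)) * ((norm (f k x) - norm (g x)) + 2 * norm (g x))"
        by (simp add: power2_eq_square algebra_simps)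
      then have "\<bar>(norm (f k x))\<^sup>2 - (norm (g x))\<^sup>2\<bar> \<le> norm (f k x - g x) * (norm (f k x - g x) + 2 * norm (g x))"
        using t by (simp only: abs_mult) (intro mult_mono order_trans[OF abs_triangle_ineq] add_mono, auto)
      then show ?thesis by (simp add: power2_eq_square algebra_simps)
    qed
    have "\<bar>(\<integral>x. (norm (f k x))\<^sup>2 \<partial>M) - ?a\<bar> = \<bar>\<integral>x. (norm (f k x))\<^sup>2 - (norm (g x))\<^sup>2 \<partial>M\<bar>"
      using if2[of k] ig2 by simp
    also have "\<dots> \<le> (\<integral>x. \<bar>(norm (f k x))\<^sup>2 - (norm (g x))\<^sup>2\<bar> \<partial>M)" by (rule integral_abs_bound)
    also have "\<dots> \<le> (\<integral>x. (norm (f k x - g x))\<^sup>2 + 2 * (norm (g x) * norm (f k x - g x)) \<partial>M)"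
      using if2[of k] ig2 id2[of k] ip pt by (intro integral_mono) auto
    also have "\<dots> = ?e k + 2 * (\<integral>x. norm (g x) * norm (f k x - g x) \<partial>M)"
      using id2[of k] ip by simp
    also have "\<dots> \<le> ?e k + 2 * sqrt (?a * ?e k)" using cs by simp
    finally show ?thesis .
  qed
  have "(\<lambda>k. ?e k + 2 * sqrt (?a * ?e k)) \<longlonglongrightarrow> 0 + 2 * sqrt (?a * 0)"
    by (intro tendsto_intros e0)
  then have l: "(\<lambda>k. ?e k + 2 * sqrt (?a * ?e k)) \<longlonglongrightarrow> 0" by simp
  have "(\<lambda>k. (\<integral>x. (norm (f k x))\<^sup>2 \<partial>M) - ?a) \<longlonglongrightarrow> 0"
    by (rule Lim_null_comparison[OF always_eventually l]) (simp only: real_norm_def bound simp_thms)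
  then show ?thesis by (rule LIM_zero_cancel)
qed

context bm_filtered
begin

lemma bdd_meas_const: "bdd_meas s (\<lambda>\<omega>. c)"
  by (auto simp: bdd_meas_def)

text \<open>Measurability of the partial sum at the right end is carried through the induction,
  because the next increment is independent of exactly that algebra.\<close>

lemma deterministic_sum_gauss_indep:
  assumes "0 \<le> s" "s \<le> Tb" and c: "\<And>i. i < n \<Longrightarrow> s \<le> c i \<and> c i \<le> c (Suc i) \<and> c (Suc i) \<le> Tb"
  shows "gauss_indep M (Fil s) (sqrt (\<Sum>i<n. (norm (\<eta> i))\<^sup>2 * (c (Suc i) - c i)))
      (\<lambda>\<omega>. \<Sum>i<n. \<eta> i \<bullet> (W (c (Suc i)) \<omega> - W (c i) \<omega>)) \<and>
    (\<lambda>\<omega>. \<Sum>i<n. \<eta> i \<bullet> (W (c (Suc i)) \<omega> - W (c i) \<omega>)) \<in> borel_measurable (Fil (c n))"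
  using c
proof (induction n)
  case 0
  then show ?case using gauss_indep_zero[OF prob_space_axioms subalg[of s]] assms(1,2) by simp
next
  case (Suc n)
  let ?Y = "\<lambda>\<omega>. \<Sum>i<n. \<eta> i \<bullet> (W (c (Suc i)) \<omega> - W (c i) \<omega>)"
  let ?v = "\<Sum>i<n. (norm (\<eta> i))\<^sup>2 * (c (Suc i) - c i)"
  have o: "s \<le> c n" "c n \<le> c (Suc n)" "c (Suc n) \<le> Tb" using Suc.prems[of n] by auto
  have IH: "gauss_indep M (Fil s) (sqrt ?v) ?Y" "?Y \<in> borel_measurable (Fil (c n))"
    using Suc.IH Suc.prems by auto
  have v: "0 \<le> ?v" by (intro sum_nonneg mult_nonneg_nonneg) (use Suc.prems in auto)
  have "gauss_indep M (Fil s) (sqrt ((sqrt ?v)\<^sup>2 + (norm (\<eta> n) * sqrt (c (Suc n) - c n))\<^sup>2))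
      (\<lambda>\<omega>. ?Y \<omega> + \<eta> n \<bullet> (W (c (Suc n)) \<omega> - W (c n) \<omega>))"
    using o assms IH(2)
    by (intro gauss_indep_add[OF IH(1) increment_gauss_indep] fil_mono) auto
  moreover have "(sqrt ?v)\<^sup>2 + (norm (\<eta> n) * sqrt (c (Suc n) - c n))\<^sup>2 = (\<Sum>i<Suc n. (norm (\<eta> i))\<^sup>2 * (c (Suc i) - c i))"
    using v o by (simp add: power_mult_distrib)
  moreover have "(\<lambda>\<omega>. ?Y \<omega> + \<eta> n \<bullet> (W (c (Suc n)) \<omega> - W (c n) \<omega>)) \<in> borel_measurable (Fil (c (Suc n)))"
  proof -
    have [measurable]: "?Y \<in> borel_measurable (Fil (c (Suc n)))"
      using fil_measurable_mono[OF IH(2), of "c (Suc n)"] o assms by auto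
    have [measurable]: "W (c n) \<in> borel_measurable (Fil (c (Suc n)))" "W (c (Suc n)) \<in> borel_measurable (Fil (c (Suc n)))"
      using o assms by (auto intro!: W_fil_le)
    show ?thesis by measurable
  qed
  ultimately show ?case by simp
qed

text \<open>Clamping all partition points to the interval from s to t turns an increment of the
  integral into a sum over cells inside that interval, however s and t lie relative to the
  partition.\<close>

lemma simple_increment_clamp:
  assumes "s \<le> t"
  shows "simple_integral_wrt W N \<tau> \<xi> t \<omega> - simple_integral_wrt W N \<tau> \<xi> s \<omega>
    = (\<Sum>i<N. \<xi> i \<omega> \<bullet> (W (max s (min t (\<tau> (Suc i)))) \<omega> - W (max s (min t (\<tau> i))) \<omega>))"
proof -
  have w: "W (min t x) \<omega> - W (min s x) \<omega> = W (max s (min t x)) \<omega> - W s \<omega>" for x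
    using assms by (auto simp: min_def max_def)
  show ?thesis
    unfolding simple_integral_wrt_def sum_subtractf[symmetric] inner_diff_right[symmetric]
  proof (intro sum.cong refl arg_cong2[where f="(\<bullet>)"])
    fix i
    have "W (min t (\<tau> (Suc i))) \<omega> - W (min t (\<tau> i)) \<omega> - (W (min s (\<tau> (Suc i))) \<omega> - W (min s (\<tau> i)) \<omega>)
      = (W (min t (\<tau> (Suc i))) \<omega> - W (min s (\<tau> (Suc i))) \<omega>) - (W (min t (\<tau> i)) \<omega> - W (min s (\<tau> i)) \<omega>)"
      by simp
    then show "W (min t (\<tau> (Suc i))) \<omega> - W (min t (\<tau> i)) \<omega> - (W (min s (\<tau> (Suc i))) \<omega> - W (min s (\<tau> i)) \<omega>)
      = W (max s (min t (\<tau> (Suc i)))) \<omega> - W (max s (min t (\<tau> i))) \<omega>"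
      unfolding w by simp
  qed
qed

text \<open>The variance is written as an L^2 norm on the product of time and probability space, the
  form in which it converges when the kernel is approximated.\<close>

lemma deterministic_simple_gauss_indep:
  assumes s: "simple_adapted Fil U N \<tau> (\<lambda>i \<omega>. \<eta> i)" and U: "U \<le> Tb" and st: "0 \<le> s" "s \<le> t" "t \<le> U"
  shows "gauss_indep M (Fil s)
     (sqrt (\<integral>p. (norm (indicator {s<..t} (fst p) *\<^sub>R simple_proc N \<tau> (\<lambda>i \<omega>. \<eta> i) (fst p) (snd p)))\<^sup>2 \<partial>time_prod U))
     (\<lambda>\<omega>. simple_integral_wrt W N \<tau> (\<lambda>i \<omega>. \<eta> i) t \<omega> - simple_integral_wrt W N \<tau> (\<lambda>i \<omega>. \<eta> i) s \<omega>)"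
    and "(\<integral>\<^sup>+p. ennreal ((norm (indicator {s<..t} (fst p) *\<^sub>R simple_proc N \<tau> (\<lambda>i \<omega>. \<eta> i) (fst p) (snd p)))\<^sup>2) \<partial>time_prod U) < \<infinity>"
proof -
  define c where "c i = max s (min t (\<tau> i))" for i
  note o = simple_adapted_term(1-3)[OF s U]
  have c: "s \<le> c i \<and> c i \<le> c (Suc i) \<and> c (Suc i) \<le> Tb" if "i < N" for i
    using o[OF that] U st by (auto simp: c_def min_def max_def)
  have tm: "stoch_term U (c i) (c (Suc i)) (\<lambda>\<omega>. \<eta> i)" if "i < N" for i
    using o[OF that] U st by (auto simp: c_def stoch_term_def bdd_meas_const)
  let ?D = "\<lambda>\<omega>. simple_integral_wrt W N \<tau> (\<lambda>i \<omega>. \<eta> i) t \<omega> - simple_integral_wrt W N \<tau> (\<lambda>i \<omega>. \<eta> i) s \<omega>"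
  have eq: "?D \<omega> = (\<Sum>i<N. \<eta> i \<bullet> (W (c (Suc i)) \<omega> - W (c i) \<omega>))" for \<omega>
    unfolding simple_increment_clamp[OF st(2)] c_def ..
  define v where "v = (\<Sum>i<N. (norm (\<eta> i))\<^sup>2 * (c (Suc i) - c i))"
  have g: "gauss_indep M (Fil s) (sqrt v) ?D"
    unfolding eq v_def using deterministic_sum_gauss_indep[of s N c \<eta>] c st U by auto
  have v0: "0 \<le> v" unfolding v_def by (intro sum_nonneg mult_nonneg_nonneg) (use c in auto)
  have ind: "indicator {c i<..c (Suc i)} u = (indicator {s<..t} u * indicator {\<tau> i<..\<tau> (Suc i)} u :: real)" if "i < N" for i u
    using o[OF that] st by (auto simp: c_def split: split_indicator)
  have pr: "(\<Sum>i<N. indicator {c i<..c (Suc i)} u *\<^sub>R \<eta> i) = indicator {s<..t} u *\<^sub>R simple_proc N \<tau> (\<lambda>i \<omega>. \<eta> i) u \<omega>" for u \<omega>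
    unfolding simple_proc_def scaleR_sum_right by (intro sum.cong refl) (simp add: ind)
  have iso: "(\<integral>\<^sup>+\<omega>. ennreal ((?D \<omega>)\<^sup>2) \<partial>M)
      = (\<integral>\<^sup>+p. ennreal ((norm (indicator {s<..t} (fst p) *\<^sub>R simple_proc N \<tau> (\<lambda>i \<omega>. \<eta> i) (fst p) (snd p)))\<^sup>2) \<partial>time_prod U)"
    using stoch_isometry(2)[of "{..<N}" U c "\<lambda>i. c (Suc i)" "\<lambda>i \<omega>. \<eta> i"] tm
    unfolding eq stoch_def pr[symmetric] by simp
  have "(\<integral>\<^sup>+\<omega>. ennreal ((?D \<omega>)\<^sup>2) \<partial>M) = ennreal v"
    using gauss_indep_moments(3,4)[OF g] v0 by (simp add: nn_integral_eq_integral)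
  with iso have nn: "(\<integral>\<^sup>+p. ennreal ((norm (indicator {s<..t} (fst p) *\<^sub>R simple_proc N \<tau> (\<lambda>i \<omega>. \<eta> i) (fst p) (snd p)))\<^sup>2) \<partial>time_prod U) = ennreal v"
    by simp
  then show "(\<integral>\<^sup>+p. ennreal ((norm (indicator {s<..t} (fst p) *\<^sub>R simple_proc N \<tau> (\<lambda>i \<omega>. \<eta> i) (fst p) (snd p)))\<^sup>2) \<partial>time_prod U) < \<infinity>"
    by simp
  have [measurable]: "{s<..t} \<in> sets (restrict_space lborel {0..U})"
    using st by (auto simp: sets_restrict_space_iff)
  have [measurable]: "(\<lambda>p. simple_proc N \<tau> (\<lambda>i \<omega>. \<eta> i) (fst p) (snd p)) \<in> borel_measurable (time_prod U)"
    using simple_proc_measurable[OF s U] by (simp add: case_prod_beta')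
  have "(\<integral>p. (norm (indicator {s<..t} (fst p) *\<^sub>R simple_proc N \<tau> (\<lambda>i \<omega>. \<eta> i) (fst p) (snd p)))\<^sup>2 \<partial>time_prod U) = v"
    using v0 nn by (subst integral_eq_nn_integral) auto
  with g show "gauss_indep M (Fil s)
     (sqrt (\<integral>p. (norm (indicator {s<..t} (fst p) *\<^sub>R simple_proc N \<tau> (\<lambda>i \<omega>. \<eta> i) (fst p) (snd p)))\<^sup>2 \<partial>time_prod U)) ?D"
    by simp
qed

text \<open>Replace the values of the approximating simple processes by their expectations and use Jensen's
  inequality.\<close>

lemma deterministic_approximation:
  assumes ito: "has_ito_integral M Fil W U (\<lambda>t \<omega>. k t) X" and U: "U \<le> Tb"
    and k: "k \<in> borel_measurable (restrict_space lborel {0..U})"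
  obtains N \<tau> \<eta> where "\<And>n::nat. simple_adapted Fil U (N n) (\<tau> n) (\<lambda>i \<omega>. \<eta> n i)"
    and "(\<lambda>n. \<integral>\<^sup>+(t, \<omega>). ennreal ((norm (simple_proc (N n) (\<tau> n) (\<lambda>i \<omega>. \<eta> n i) t \<omega> - k t))\<^sup>2) \<partial>time_prod U) \<longlonglongrightarrow> 0"
    and "\<And>t. t \<in> {0..U} \<Longrightarrow>
      (\<lambda>n. \<integral>\<^sup>+\<omega>. ennreal ((simple_integral_wrt W (N n) (\<tau> n) (\<lambda>i \<omega>. \<eta> n i) t \<omega> - X t \<omega>)\<^sup>2) \<partial>M) \<longlonglongrightarrow> 0"
proof -
  from ito obtain N \<tau> \<xi> where s: "\<And>n::nat. simple_adapted Fil U (N n) (\<tau> n) (\<xi> n)"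
    and lk: "(\<lambda>n. \<integral>\<^sup>+(t, \<omega>). ennreal ((norm (simple_proc (N n) (\<tau> n) (\<xi> n) t \<omega> - k t))\<^sup>2) \<partial>time_prod U) \<longlonglongrightarrow> 0"
    and lX: "\<And>t. t \<in> {0..U} \<Longrightarrow>
      (\<lambda>n. \<integral>\<^sup>+\<omega>. ennreal ((simple_integral_wrt W (N n) (\<tau> n) (\<xi> n) t \<omega> - X t \<omega>)\<^sup>2) \<partial>M) \<longlonglongrightarrow> 0"
    and Xm: "\<And>t. t \<in> {0..U} \<Longrightarrow> X t \<in> borel_measurable (Fil t)"
    unfolding has_ito_integral_def by blast
  define \<eta> where "\<eta> n i = (\<integral>\<omega>. \<xi> n i \<omega> \<partial>M)" for n i
  have s': "simple_adapted Fil U (N n) (\<tau> n) (\<lambda>i \<omega>. \<eta> n i)" for n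
    using s[of n] by (auto simp: simple_adapted_def)
  note [measurable] = k
  have pm: "(\<lambda>p. simple_proc (N n) (\<tau> n) (\<xi> n) (fst p) (snd p)) \<in> borel_measurable (time_prod U)"
    "(\<lambda>p. simple_proc (N n) (\<tau> n) (\<lambda>i \<omega>. \<eta> n i) (fst p) (snd p)) \<in> borel_measurable (time_prod U)" for n
    using simple_proc_measurable[OF s[of n] U] simple_proc_measurable[OF s'[of n] U] by (simp_all add: case_prod_beta')
  note [measurable] = pm
  let ?E = "\<lambda>n. \<integral>\<^sup>+(t, \<omega>). ennreal ((norm (simple_proc (N n) (\<tau> n) (\<xi> n) t \<omega> - k t))\<^sup>2) \<partial>time_prod U"
  let ?E' = "\<lambda>n. \<integral>\<^sup>+(t, \<omega>). ennreal ((norm (simple_proc (N n) (\<tau> n) (\<lambda>i \<omega>. \<eta> n i) t \<omega> - k t))\<^sup>2) \<partial>time_prod U"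
  have jensen: "?E' n \<le> ?E n" for n
  proof -
    have bm: "bdd_meas (\<tau> n i) (\<xi> n i)" "\<xi> n i \<in> borel_measurable M" if "i < N n" for i
      using simple_adapted_term[OF s[of n] U that] U by (auto simp: bdd_meas_def intro!: fil_measurable)
    have int: "integrable M (\<xi> n i)" if "i < N n" for i
      using bm[OF that] by (auto simp: bdd_meas_def intro!: integrable_const_bound)
    \<comment> \<open>For fixed t the target \<open>k t\<close> is a constant, so the averaged
      process misses it by the mean of the original error.\<close>
    have pt: "ennreal ((norm (simple_proc (N n) (\<tau> n) (\<lambda>i \<omega>. \<eta> n i) t \<omega>' - k t))\<^sup>2)
      \<le> (\<integral>\<^sup>+\<omega>. ennreal ((norm (simple_proc (N n) (\<tau> n) (\<xi> n) t \<omega> - k t))\<^sup>2) \<partial>M)" for t \<omega>'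
    proof -
      let ?f = "\<lambda>\<omega>. simple_proc (N n) (\<tau> n) (\<xi> n) t \<omega> - k t"
      have ii: "integrable M (\<lambda>\<omega>. indicator {\<tau> n i<..\<tau> n (Suc i)} t *\<^sub>R \<xi> n i \<omega>)" if "i \<in> {..<N n}" for i
        using that by (intro integrable_scaleR_right int) auto
      have ip: "integrable M (\<lambda>\<omega>. simple_proc (N n) (\<tau> n) (\<xi> n) t \<omega>)"
        unfolding simple_proc_def by (intro Bochner_Integration.integrable_sum ii)
      have intf: "integrable M ?f" by (intro Bochner_Integration.integrable_diff ip) simp
      have [measurable]: "?f \<in> borel_measurable M" using intf by auto
      have E: "simple_proc (N n) (\<tau> n) (\<lambda>i \<omega>. \<eta> n i) t \<omega>' - k t = (\<integral>\<omega>. ?f \<omega> \<partial>M)"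
      proof -
        have "(\<integral>\<omega>. simple_proc (N n) (\<tau> n) (\<xi> n) t \<omega> \<partial>M) = simple_proc (N n) (\<tau> n) (\<lambda>i \<omega>. \<eta> n i) t \<omega>'"
          unfolding simple_proc_def \<eta>_def
          by (subst Bochner_Integration.integral_sum[OF ii]) (auto simp only: integral_scaleR_right)
        then show ?thesis by (subst Bochner_Integration.integral_diff[OF ip]) (simp_all add: prob_space)
      qed
      show ?thesis
      proof (cases "(\<integral>\<^sup>+\<omega>. ennreal ((norm (?f \<omega>))\<^sup>2) \<partial>M) < \<infinity>")
        case True
        then have i2: "integrable M (\<lambda>\<omega>. (norm (?f \<omega>))\<^sup>2)" by (subst integrable_iff_bounded) auto
        have "(norm (\<integral>\<omega>. ?f \<omega> \<partial>M))\<^sup>2 \<le> (\<integral>\<omega>. \<bar>norm (?f \<omega>)\<bar> \<partial>M)\<^sup>2"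
          using integral_norm_bound[of M ?f] by (intro power_mono) auto
        also have "\<dots> \<le> (\<integral>\<omega>. (norm (?f \<omega>))\<^sup>2 \<partial>M)" by (rule abs_expectation_le_L2(2)[OF _ i2]) measurable
        finally have "ennreal ((norm (\<integral>\<omega>. ?f \<omega> \<partial>M))\<^sup>2) \<le> ennreal (\<integral>\<omega>. (norm (?f \<omega>))\<^sup>2 \<partial>M)" by (rule ennreal_leI)
        then show ?thesis unfolding E using i2 by (simp add: nn_integral_eq_integral)
      qed (auto simp: less_top[symmetric])
    qed
    have "?E' n = (\<integral>\<^sup>+t. (\<integral>\<^sup>+\<omega>. ennreal ((norm (simple_proc (N n) (\<tau> n) (\<lambda>i \<omega>. \<eta> n i) t \<omega> - k t))\<^sup>2) \<partial>M) \<partial>restrict_space lborel {0..U})"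
      by (subst nn_integral_fst[symmetric]) (auto simp: case_prod_beta')
    also have "\<dots> \<le> (\<integral>\<^sup>+t. (\<integral>\<^sup>+\<omega>'. (\<integral>\<^sup>+\<omega>. ennreal ((norm (simple_proc (N n) (\<tau> n) (\<xi> n) t \<omega> - k t))\<^sup>2) \<partial>M) \<partial>M) \<partial>restrict_space lborel {0..U})"
      by (intro nn_integral_mono pt)
    also have "\<dots> = (\<integral>\<^sup>+t. (\<integral>\<^sup>+\<omega>. ennreal ((norm (simple_proc (N n) (\<tau> n) (\<xi> n) t \<omega> - k t))\<^sup>2) \<partial>M) \<partial>restrict_space lborel {0..U})"
      by (simp add: emeasure_space_1)
    also have "\<dots> = ?E n"
      by (subst nn_integral_fst[symmetric]) (auto simp: case_prod_beta')
    finally show ?thesis .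
  qed
  have lk': "?E' \<longlonglongrightarrow> 0"
    by (rule tendsto_sandwich[OF always_eventually always_eventually tendsto_const lk]) (simp_all add: jensen)
  \<comment> \<open>Both simple processes approximate \<open>k\<close>, so they approach each other;
    by the isometry their integrals do the same, and the averaged ones still tend to
    \<open>X\<close>.\<close>
  let ?D = "\<lambda>n. \<integral>\<^sup>+(t, \<omega>). ennreal ((norm (simple_proc (N n) (\<tau> n) (\<lambda>i \<omega>. \<eta> n i) t \<omega> - simple_proc (N n) (\<tau> n) (\<xi> n) t \<omega>))\<^sup>2) \<partial>time_prod U"
  have "?D n \<le> 2 * ?E' n + 2 * ?E n" for n
    unfolding case_prod_beta' 
    using nn_L2_triangle[of "\<lambda>p. simple_proc (N n) (\<tau> n) (\<lambda>i \<omega>. \<eta> n i) (fst p) (snd p)" "\<lambda>p. k (fst p)" "time_prod U"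
        "\<lambda>p. simple_proc (N n) (\<tau> n) (\<xi> n) (fst p) (snd p)"]
    by (simp add: norm_minus_commute[of "k _"])
  then have lD: "?D \<longlonglongrightarrow> 0" by (rule ennreal_tendsto_0_triangle[OF _ lk' lk])
  have "(\<lambda>n. \<integral>\<^sup>+\<omega>. ennreal ((simple_integral_wrt W (N n) (\<tau> n) (\<lambda>i \<omega>. \<eta> n i) t \<omega> - X t \<omega>)\<^sup>2) \<partial>M) \<longlonglongrightarrow> 0"
    if t: "t \<in> {0..U}" for t
  proof (rule ennreal_tendsto_0_triangle[OF _ _ lX[OF t]])
    have [measurable]: "X t \<in> borel_measurable M" using Xm[OF t] t U by (auto intro!: fil_measurable)
    have [measurable]: "simple_integral_wrt W (N n) (\<tau> n) (\<xi> n) t \<in> borel_measurable M"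
      "simple_integral_wrt W (N n) (\<tau> n) (\<lambda>i \<omega>. \<eta> n i) t \<in> borel_measurable M" for n
      using simple_integral_props(2)[OF s U] simple_integral_props(2)[OF s' U] by auto
    show "(\<integral>\<^sup>+\<omega>. ennreal ((simple_integral_wrt W (N n) (\<tau> n) (\<lambda>i \<omega>. \<eta> n i) t \<omega> - X t \<omega>)\<^sup>2) \<partial>M) \<le>
      2 * (\<integral>\<^sup>+\<omega>. ennreal ((simple_integral_wrt W (N n) (\<tau> n) (\<lambda>i \<omega>. \<eta> n i) t \<omega> - simple_integral_wrt W (N n) (\<tau> n) (\<xi> n) t \<omega>)\<^sup>2) \<partial>M)
      + 2 * (\<integral>\<^sup>+\<omega>. ennreal ((simple_integral_wrt W (N n) (\<tau> n) (\<xi> n) t \<omega> - X t \<omega>)\<^sup>2) \<partial>M)" for n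
      by (rule nn_L2_triangle_real) measurable
    show "(\<lambda>n. \<integral>\<^sup>+\<omega>. ennreal ((simple_integral_wrt W (N n) (\<tau> n) (\<lambda>i \<omega>. \<eta> n i) t \<omega> - simple_integral_wrt W (N n) (\<tau> n) (\<xi> n) t \<omega>)\<^sup>2) \<partial>M) \<longlonglongrightarrow> 0"
      by (rule tendsto_sandwich[OF always_eventually always_eventually tendsto_const lD])
         (use simple_isometry_le[OF s' s U] in simp_all)
  qed
  with s' lk' show ?thesis by (rule that)
qed

lemma time_prod_deterministic:
  assumes f: "f \<in> borel_measurable (restrict_space lborel {0..U})"
  shows "(\<integral>\<^sup>+p. f (fst p) \<partial>time_prod U) = (\<integral>\<^sup>+t. f t \<partial>restrict_space lborel {0..U})"
proof -
  note [measurable] = f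
  have "(\<integral>\<^sup>+p. f (fst p) \<partial>time_prod U) = (\<integral>\<^sup>+t. (\<integral>\<^sup>+\<omega>. f t \<partial>M) \<partial>restrict_space lborel {0..U})"
    by (subst nn_integral_fst[symmetric]) auto
  then show ?thesis by (simp add: emeasure_space_1)
qed

lemma deterministic_integral_gauss_indep:
  assumes ito: "has_ito_integral M Fil W U (\<lambda>t \<omega>. k t) X" and U: "U \<le> Tb"
    and k: "k \<in> borel_measurable (restrict_space lborel {0..U})"
    and st: "0 \<le> s" "s \<le> t" "t \<le> U"
  shows "gauss_indep M (Fil s) (sqrt (LBINT u:{s..t}. (norm (k u))\<^sup>2)) (\<lambda>\<omega>. X t \<omega> - X s \<omega>)"
proof -
  from deterministic_approximation[OF ito U k] obtain N \<tau> \<eta> where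
    s: "\<And>n::nat. simple_adapted Fil U (N n) (\<tau> n) (\<lambda>i \<omega>. \<eta> n i)"
    and lk: "(\<lambda>n. \<integral>\<^sup>+(t, \<omega>). ennreal ((norm (simple_proc (N n) (\<tau> n) (\<lambda>i \<omega>. \<eta> n i) t \<omega> - k t))\<^sup>2) \<partial>time_prod U) \<longlonglongrightarrow> 0"
    and lX: "\<And>t. t \<in> {0..U} \<Longrightarrow>
      (\<lambda>n. \<integral>\<^sup>+\<omega>. ennreal ((simple_integral_wrt W (N n) (\<tau> n) (\<lambda>i \<omega>. \<eta> n i) t \<omega> - X t \<omega>)\<^sup>2) \<partial>M) \<longlonglongrightarrow> 0"
    by blast
  have sU: "s \<in> {0..U}" and tU: "t \<in> {0..U}" using st by auto
  have X[measurable]: "X s \<in> borel_measurable M" "X t \<in> borel_measurable M"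
    using ito sU tU U by (auto simp: has_ito_integral_def intro!: fil_measurable)
  note [measurable] = k
  let ?S = "\<lambda>n. simple_integral_wrt W (N n) (\<tau> n) (\<lambda>i \<omega>. \<eta> n i)"
  let ?f = "\<lambda>n p. indicator {s<..t} (fst p) *\<^sub>R simple_proc (N n) (\<tau> n) (\<lambda>i \<omega>. \<eta> n i) (fst p) (snd p)"
  let ?g = "\<lambda>p::real \<times> 'a. indicator {s<..t} (fst p) *\<^sub>R k (fst p)"
  have Sm[measurable]: "?S n u \<in> borel_measurable M" for n u by (rule simple_integral_props(2)[OF s U])
  have [measurable]: "{s<..t} \<in> sets (restrict_space lborel {0..U})"
    using st by (auto simp: sets_restrict_space_iff)
  have pm[measurable]: "(\<lambda>p. simple_proc (N n) (\<tau> n) (\<lambda>i \<omega>. \<eta> n i) (fst p) (snd p)) \<in> borel_measurable (time_prod U)" for n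
    using simple_proc_measurable[OF s U] by (simp add: case_prod_beta')
  have k2: "(\<integral>\<^sup>+p. ennreal ((norm (k (fst p)))\<^sup>2) \<partial>time_prod U) < \<infinity>"
    using ito by (simp add: has_ito_integral_def case_prod_beta')
  have g2: "(\<integral>\<^sup>+p. ennreal ((norm (?g p))\<^sup>2) \<partial>time_prod U) < \<infinity>"
    by (rule le_less_trans[OF nn_integral_mono k2]) (auto split: split_indicator)
  have lf: "(\<lambda>n. \<integral>\<^sup>+p. ennreal ((norm (?f n p - ?g p))\<^sup>2) \<partial>time_prod U) \<longlonglongrightarrow> 0"
  proof (rule tendsto_sandwich[OF always_eventually always_eventually tendsto_const lk]; intro allI)
    show "(\<integral>\<^sup>+p. ennreal ((norm (?f n p - ?g p))\<^sup>2) \<partial>time_prod U) \<le>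
      (\<integral>\<^sup>+(t, \<omega>). ennreal ((norm (simple_proc (N n) (\<tau> n) (\<lambda>i \<omega>. \<eta> n i) t \<omega> - k t))\<^sup>2) \<partial>time_prod U)" for n
      by (intro nn_integral_mono) (auto simp: case_prod_beta' split: split_indicator)
  qed simp
  have lv: "(\<lambda>n. \<integral>p. (norm (?f n p))\<^sup>2 \<partial>time_prod U) \<longlonglongrightarrow> (\<integral>p. (norm (?g p))\<^sup>2 \<partial>time_prod U)"
    by (rule L2_norm_tendsto[OF _ _ deterministic_simple_gauss_indep(2)[OF s U st] g2 lf]) measurable
  have v: "(\<integral>p. (norm (?g p))\<^sup>2 \<partial>time_prod U) = (LBINT u:{s..t}. (norm (k u))\<^sup>2)"
  proof -
    have "(\<integral>p. (norm (?g p))\<^sup>2 \<partial>time_prod U) = enn2real (\<integral>\<^sup>+p. ennreal ((norm (?g p))\<^sup>2) \<partial>time_prod U)"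
      by (rule integral_eq_nn_integral) auto
    also have "(\<integral>\<^sup>+p. ennreal ((norm (?g p))\<^sup>2) \<partial>time_prod U)
        = (\<integral>\<^sup>+u. ennreal ((norm (indicator {s<..t} u *\<^sub>R k u))\<^sup>2) \<partial>restrict_space lborel {0..U})"
      by (rule time_prod_deterministic) measurable
    also have "\<dots> = (\<integral>\<^sup>+u. ennreal ((norm (indicator {s<..t} u *\<^sub>R k u))\<^sup>2) * indicator {0..U} u \<partial>lborel)"
      by (subst nn_integral_restrict_space) auto
    also have "\<dots> = (\<integral>\<^sup>+u. ennreal (indicator {s..t} u *\<^sub>R (norm (k u))\<^sup>2) \<partial>lborel)"
    proof (rule nn_integral_cong_AE)
      \<comment> \<open>Simple cells are open on the left, whereas the variance is an integral over
        the closed interval.\<close>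
      have "AE u in lborel. u \<noteq> s" by (rule AE_lborel_singleton)
      then show "AE u in lborel. ennreal ((norm (indicator {s<..t} u *\<^sub>R k u))\<^sup>2) * indicator {0..U} u 
          = ennreal (indicator {s..t} u *\<^sub>R (norm (k u))\<^sup>2)"
        by eventually_elim (use st in \<open>auto split: split_indicator\<close>)
    qed
    also have "enn2real \<dots> = (LBINT u:{s..t}. (norm (k u))\<^sup>2)"
      unfolding set_lebesgue_integral_def
    proof (rule integral_eq_nn_integral[symmetric])
      \<comment> \<open>Measurability of \<open>k\<close> is known on the interval from 0 to U only,
        so it is extended by zero.\<close>
      have "(\<lambda>u. indicator {0..U} u *\<^sub>R k u) \<in> borel_measurable lborel"
        using k by (subst (asm) borel_measurable_restrict_space_iff) auto
      then have "(\<lambda>u. indicator {s..t} u *\<^sub>R (norm (indicator {0..U} u *\<^sub>R k u))\<^sup>2) \<in> borel_measurable lborel"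
        by measurable
      also have "(\<lambda>u. indicator {s..t} u *\<^sub>R (norm (indicator {0..U} u *\<^sub>R k u))\<^sup>2) = (\<lambda>u. indicator {s..t} u *\<^sub>R (norm (k u))\<^sup>2)"
        using st by (auto split: split_indicator)
      finally show "(\<lambda>u. indicator {s..t} u *\<^sub>R (norm (k u))\<^sup>2) \<in> borel_measurable lborel" .
    qed auto
    finally show ?thesis .
  qed
  show ?thesis
  proof (rule gauss_indep_limit[OF deterministic_simple_gauss_indep(1)[OF s U st]])
    show "(\<lambda>n. \<integral>\<^sup>+\<omega>. ennreal (((?S n t \<omega> - ?S n s \<omega>) - (X t \<omega> - X s \<omega>))\<^sup>2) \<partial>M) \<longlonglongrightarrow> 0"
    proof (rule ennreal_tendsto_0_triangle[OF _ lX[OF tU] lX[OF sU]])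
      fix n
      have "(\<integral>\<^sup>+\<omega>. ennreal (((?S n t \<omega> - X t \<omega>) - (?S n s \<omega> - X s \<omega>))\<^sup>2) \<partial>M) \<le>
        2 * (\<integral>\<^sup>+\<omega>. ennreal (((?S n t \<omega> - X t \<omega>) - 0)\<^sup>2) \<partial>M) + 2 * (\<integral>\<^sup>+\<omega>. ennreal ((0 - (?S n s \<omega> - X s \<omega>))\<^sup>2) \<partial>M)"
        by (rule nn_L2_triangle_real) measurable
      then show "(\<integral>\<^sup>+\<omega>. ennreal (((?S n t \<omega> - ?S n s \<omega>) - (X t \<omega> - X s \<omega>))\<^sup>2) \<partial>M) \<le>
        2 * (\<integral>\<^sup>+\<omega>. ennreal ((?S n t \<omega> - X t \<omega>)\<^sup>2) \<partial>M) + 2 * (\<integral>\<^sup>+\<omega>. ennreal ((?S n s \<omega> - X s \<omega>)\<^sup>2) \<partial>M)"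
        by (simp add: algebra_simps power2_commute)
    qed
    show "(\<lambda>n. (sqrt (\<integral>p. (norm (?f n p))\<^sup>2 \<partial>time_prod U))\<^sup>2) \<longlonglongrightarrow> (sqrt (LBINT u:{s..t}. (norm (k u))\<^sup>2))\<^sup>2"
      using lv unfolding v[symmetric] by (subst (1 2) real_sqrt_pow2) auto
  qed measurable
qed

end

subsection \<open>The delta hedge\<close>

text \<open>By the semigroup identity the delta at the larger volatility averages deltas at
  \<open>v\<close> over displacements s z, so the change of volatility costs |s| E|z| / v \<le> |s|
  / v by the Lipschitz bound.\<close>

lemma bachelier_delta_step:
  assumes "0 < v"
  shows "\<bar>bachelier_delta v (x + y) - bachelier_delta (sqrt (v\<^sup>2 + s\<^sup>2)) x\<bar> \<le> (\<bar>y\<bar> + \<bar>s\<bar>) / v"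
proof -
  have i: "integrable std_normal_distribution (\<lambda>z. bachelier_delta v (x + s * z))"
    using bachelier_delta_bounds by (intro std_normal.integrable_const_bound[of _ 1]) auto
  have "\<bar>bachelier_delta (sqrt (v\<^sup>2 + s\<^sup>2)) x - bachelier_delta v x\<bar>
      = \<bar>\<integral>z. bachelier_delta v (x + s * z) - bachelier_delta v x \<partial>std_normal_distribution\<bar>"
    unfolding bachelier_delta_semigroup[symmetric] using i std_normal.prob_space by simp
  also have "\<dots> \<le> (\<integral>z. \<bar>bachelier_delta v (x + s * z) - bachelier_delta v x\<bar> \<partial>std_normal_distribution)"
    by (rule integral_abs_bound)
  also have "\<dots> \<le> (\<integral>z. \<bar>s\<bar> / v * \<bar>z\<bar> \<partial>std_normal_distribution)"
  proof (rule integral_mono)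
    show "\<bar>bachelier_delta v (x + s * z) - bachelier_delta v x\<bar> \<le> \<bar>s\<bar> / v * \<bar>z\<bar>" for z
      using bachelier_delta_lipschitz[OF assms, of x "s * z"] by (simp add: abs_mult)
  qed (use i std_normal_abs_moment(1) in auto)
  also have "\<dots> = \<bar>s\<bar> / v * (\<integral>z. \<bar>z\<bar> \<partial>std_normal_distribution)" by (rule integral_mult_right_zero)
  also have "\<dots> \<le> \<bar>s\<bar> / v * 1"
    using assms by (intro mult_left_mono std_normal_abs_moment(2)) simp
  finally have "\<bar>bachelier_delta (sqrt (v\<^sup>2 + s\<^sup>2)) x - bachelier_delta v x\<bar> \<le> \<bar>s\<bar> / v" by simp
  with bachelier_delta_lipschitz[OF assms, of x y] show ?thesis
    by (simp add: add_divide_distrib)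
qed

text \<open>The hedging error over one step: s is the standard deviation of the increment, v the
  volatility after it, w the volatility before it. The Taylor estimate is available at volatility v,
  so price and delta at w are first compared with those at v.\<close>

lemma bachelier_step:
  fixes v s x y :: real
  assumes "0 < v"
  defines "w \<equiv> sqrt (v\<^sup>2 + s\<^sup>2)"
  shows "\<bar>bachelier v (x + y) - bachelier w x - bachelier_delta w x * y\<bar> \<le> 2 * (y\<^sup>2 + s\<^sup>2) / v"
proof -
  define R where "R y = bachelier v (x + y) - bachelier v x - bachelier_delta v x * y" for y
  have ib: "integrable std_normal_distribution (\<lambda>z. bachelier v (x + s * z))"
  proof (rule Bochner_Integration.integrable_bound)
    show "integrable std_normal_distribution (\<lambda>z. \<bar>bachelier v x\<bar> + \<bar>s\<bar> * \<bar>z\<bar>)"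
      using std_normal_abs_moment(1) by (intro Bochner_Integration.integrable_add integrable_mult_right) auto
    have "\<bar>bachelier v (x + s * z)\<bar> \<le> \<bar>bachelier v x\<bar> + \<bar>s\<bar> * \<bar>z\<bar>" for z
      using bachelier_lipschitz[of v "x + s * z" v x] by (simp add: abs_mult)
    then show "AE z in std_normal_distribution. norm (bachelier v (x + s * z)) \<le> norm (\<bar>bachelier v x\<bar> + \<bar>s\<bar> * \<bar>z\<bar>)"
      by simp
  qed simp
  have iR: "integrable std_normal_distribution (\<lambda>z. R (s * z))"
    unfolding R_def using ib std_normal_moments(1) by (intro Bochner_Integration.integrable_diff integrable_mult_right) auto
  \<comment> \<open>The linear term has mean zero, so the mean Taylor remainder over a Gaussian
    increment is exactly the price of the additional volatility.\<close>
  have "(\<integral>z. R (s * z) \<partial>std_normal_distribution) = (\<integral>z. bachelier v (x + s * z) \<partial>std_normal_distribution) - bachelier v x"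
  proof -
    have "(\<integral>z. R (s * z) \<partial>std_normal_distribution) = (\<integral>z. (bachelier v (x + s * z) - bachelier v x) - (bachelier_delta v x * s) * z \<partial>std_normal_distribution)"
      unfolding R_def by (simp add: mult.assoc)
    also have "\<dots> = (\<integral>z. bachelier v (x + s * z) - bachelier v x \<partial>std_normal_distribution) - (bachelier_delta v x * s) * 0"
      using ib std_normal_moments(1,2) by (subst Bochner_Integration.integral_diff) (simp_all del: Bochner_Integration.integral_diff)
    also have "\<dots> = (\<integral>z. bachelier v (x + s * z) \<partial>std_normal_distribution) - bachelier v x"
      using ib std_normal.prob_space by simp
    finally show ?thesis .
  qed
  then have ER: "(\<integral>z. R (s * z) \<partial>std_normal_distribution) = bachelier w x - bachelier v x"
    unfolding bachelier_semigroup w_def .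
  have "\<bar>bachelier w x - bachelier v x\<bar> \<le> (\<integral>z. \<bar>R (s * z)\<bar> \<partial>std_normal_distribution)"
    unfolding ER[symmetric] by (rule integral_abs_bound)
  also have "\<dots> \<le> (\<integral>z. s\<^sup>2 / v * z\<^sup>2 \<partial>std_normal_distribution)"
  proof (rule integral_mono)
    show "\<bar>R (s * z)\<bar> \<le> s\<^sup>2 / v * z\<^sup>2" for z
      unfolding R_def using bachelier_taylor[OF assms(1), of x "s * z"] by (simp add: power_mult_distrib)
  qed (use iR std_normal_moments(3) in auto)
  also have "\<dots> = s\<^sup>2 / v" using std_normal_moments(4) by simp
  finally have b1: "\<bar>bachelier w x - bachelier v x\<bar> \<le> s\<^sup>2 / v" .
  have b2: "\<bar>R y\<bar> \<le> y\<^sup>2 / v" unfolding R_def by (rule bachelier_taylor[OF assms(1)])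
  have "\<bar>bachelier_delta v x - bachelier_delta w x\<bar> \<le> \<bar>s\<bar> / v"
    unfolding w_def using bachelier_delta_step[OF assms(1), of x 0 s] by simp
  then have "\<bar>(bachelier_delta v x - bachelier_delta w x) * y\<bar> \<le> \<bar>s\<bar> / v * \<bar>y\<bar>"
    unfolding abs_mult by (rule mult_right_mono) simp
  also have "\<dots> \<le> (y\<^sup>2 + s\<^sup>2) / v"
  proof -
    have "\<bar>s\<bar> * \<bar>y\<bar> \<le> y\<^sup>2 + s\<^sup>2"
      using sum_squares_bound[of "\<bar>s\<bar>" "\<bar>y\<bar>"] mult_nonneg_nonneg[of "\<bar>s\<bar>" "\<bar>y\<bar>"]
      unfolding power2_abs by linarith
    then show ?thesis using assms(1) by (simp add: divide_right_mono)
  qed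
  finally have b3: "\<bar>(bachelier_delta v x - bachelier_delta w x) * y\<bar> \<le> (y\<^sup>2 + s\<^sup>2) / v" .
  \<comment> \<open>Remainder at y, minus its mean, plus the correction of the delta. The last part
    is bounded by |s| |y| / v \<le> (y^2 + s^2) / v, which doubles the sum of the other two
    bounds.\<close>
  have "bachelier v (x + y) - bachelier w x - bachelier_delta w x * y
      = R y - (bachelier w x - bachelier v x) + (bachelier_delta v x - bachelier_delta w x) * y"
    unfolding R_def by (simp add: algebra_simps)
  also have "\<bar>\<dots>\<bar> \<le> y\<^sup>2 / v + s\<^sup>2 / v + (y\<^sup>2 + s\<^sup>2) / v"
    using b1 b2 b3 by linarith
  also have "\<dots> = 2 * (y\<^sup>2 + s\<^sup>2) / v" by (simp add: add_divide_distrib algebra_simps)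
  finally show ?thesis .
qed

context bm_filtered
begin

text \<open>Pythagoras: the partial sum belongs to the past of the next difference, so the cross
  term vanishes. Its measurability is part of the induction for this reason.\<close>

lemma martingale_difference_sum:
  fixes D :: "nat \<Rightarrow> 'a \<Rightarrow> real"
  assumes p: "\<And>q. q < n \<Longrightarrow> 0 \<le> p q \<and> p q \<le> p (Suc q) \<and> p (Suc q) \<le> Tb"
    and D: "\<And>q. q < n \<Longrightarrow> D q \<in> borel_measurable (Fil (p (Suc q)))"
    and D2: "\<And>q. q < n \<Longrightarrow> integrable M (\<lambda>\<omega>. (D q \<omega>)\<^sup>2)"
    and orth: "\<And>q G. q < n \<Longrightarrow> G \<in> borel_measurable (Fil (p q)) \<Longrightarrow> integrable M (\<lambda>\<omega>. (G \<omega>)\<^sup>2) \<Longrightarrow>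
      (\<integral>\<omega>. G \<omega> * D q \<omega> \<partial>M) = 0"
  shows "integrable M (\<lambda>\<omega>. (\<Sum>q<n. D q \<omega>)\<^sup>2) \<and>
    (\<integral>\<omega>. (\<Sum>q<n. D q \<omega>)\<^sup>2 \<partial>M) = (\<Sum>q<n. \<integral>\<omega>. (D q \<omega>)\<^sup>2 \<partial>M) \<and>
    (0 < n \<longrightarrow> (\<lambda>\<omega>. \<Sum>q<n. D q \<omega>) \<in> borel_measurable (Fil (p n)))"
  using assms
proof (induction n)
  case 0
  then show ?case by simp
next
  case (Suc n)
  let ?S = "\<lambda>\<omega>. \<Sum>q<n. D q \<omega>"
  have IH: "integrable M (\<lambda>\<omega>. (?S \<omega>)\<^sup>2)" "(\<integral>\<omega>. (?S \<omega>)\<^sup>2 \<partial>M) = (\<Sum>q<n. \<integral>\<omega>. (D q \<omega>)\<^sup>2 \<partial>M)"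
    "0 < n \<longrightarrow> ?S \<in> borel_measurable (Fil (p n))"
    using Suc.IH Suc.prems by auto
  have o: "0 \<le> p n" "p n \<le> p (Suc n)" "p (Suc n) \<le> Tb" using Suc.prems(1)[of n] by auto
  have S: "?S \<in> borel_measurable (Fil (p n))" using IH(3) by (cases n) auto
  have SM[measurable]: "?S \<in> borel_measurable M" using o by (intro fil_measurable[OF S]) auto
  have DM[measurable]: "D n \<in> borel_measurable M" using o by (intro fil_measurable[OF Suc.prems(2)]) auto
  have D2: "integrable M (\<lambda>\<omega>. (D n \<omega>)\<^sup>2)" using Suc.prems(3) by simp
  have x: "integrable M (\<lambda>\<omega>. ?S \<omega> * D n \<omega>)" by (rule integrable_mult_L2[OF SM DM IH(1) D2])
  have z: "(\<integral>\<omega>. ?S \<omega> * D n \<omega> \<partial>M) = 0" by (rule Suc.prems(4)[OF _ S IH(1)]) simp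
  have eq: "(\<Sum>q<Suc n. D q \<omega>)\<^sup>2 = (?S \<omega>)\<^sup>2 + (D n \<omega>)\<^sup>2 + 2 * (?S \<omega> * D n \<omega>)" for \<omega>
    by (simp add: power2_sum)
  have "?S \<in> borel_measurable (Fil (p (Suc n)))" by (rule fil_measurable_mono[OF S]) (use o in auto)
  then have "(\<lambda>\<omega>. \<Sum>q<Suc n. D q \<omega>) \<in> borel_measurable (Fil (p (Suc n)))"
    using Suc.prems(2)[of n] by simp
  moreover have "integrable M (\<lambda>\<omega>. (\<Sum>q<Suc n. D q \<omega>)\<^sup>2)"
    unfolding eq using IH(1) D2 x by auto
  moreover have "(\<integral>\<omega>. (\<Sum>q<Suc n. D q \<omega>)\<^sup>2 \<partial>M) = (\<Sum>q<Suc n. \<integral>\<omega>. (D q \<omega>)\<^sup>2 \<partial>M)"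
    unfolding eq using IH(1,2) D2 x z by simp
  ultimately show ?case by simp
qed

text \<open>A weight from the past of size at most 1 shrinks the second moment of each difference.
  With all weights equal to 1 the sum telescopes, so the bound depends on the end points alone and
  survives every refinement.\<close>

lemma martingale_transform_bound:
  fixes Y :: "real \<Rightarrow> 'a \<Rightarrow> real" and c :: "nat \<Rightarrow> 'a \<Rightarrow> real"
  assumes p: "\<And>q. q < n \<Longrightarrow> 0 \<le> p q \<and> p q \<le> p (Suc q) \<and> p (Suc q) \<le> S" and S: "S \<le> Tb"
    and Y: "\<And>t. t \<in> {0..S} \<Longrightarrow> Y t \<in> borel_measurable (Fil t)"
    and Y2: "\<And>t. t \<in> {0..S} \<Longrightarrow> integrable M (\<lambda>\<omega>. (Y t \<omega>)\<^sup>2)"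
    and orth: "\<And>s t G. 0 \<le> s \<Longrightarrow> s \<le> t \<Longrightarrow> t \<le> S \<Longrightarrow> G \<in> borel_measurable (Fil s) \<Longrightarrow> integrable M (\<lambda>\<omega>. (G \<omega>)\<^sup>2) \<Longrightarrow>
      (\<integral>\<omega>. G \<omega> * (Y t \<omega> - Y s \<omega>) \<partial>M) = 0"
    and c: "\<And>q. q < n \<Longrightarrow> c q \<in> borel_measurable (Fil (p q))" "\<And>q \<omega>. \<bar>c q \<omega>\<bar> \<le> 1"
  shows "integrable M (\<lambda>\<omega>. (\<Sum>q<n. c q \<omega> * (Y (p (Suc q)) \<omega> - Y (p q) \<omega>))\<^sup>2)"
    and "(\<integral>\<omega>. (\<Sum>q<n. c q \<omega> * (Y (p (Suc q)) \<omega> - Y (p q) \<omega>))\<^sup>2 \<partial>M) \<le> (\<integral>\<omega>. (Y (p n) \<omega> - Y (p 0) \<omega>)\<^sup>2 \<partial>M)"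
proof -
  define D where "D b q \<omega> = b q \<omega> * (Y (p (Suc q)) \<omega> - Y (p q) \<omega>)" for b :: "nat \<Rightarrow> 'a \<Rightarrow> real" and q \<omega>
  have o: "0 \<le> p q \<and> p q \<le> p (Suc q) \<and> p (Suc q) \<le> Tb" if "q < n" for q using p[OF that] S by auto
  have diff2: "integrable M (\<lambda>\<omega>. (Y (p (Suc q)) \<omega> - Y (p q) \<omega>)\<^sup>2)" 
    and YM: "Y (p (Suc q)) \<in> borel_measurable M" "Y (p q) \<in> borel_measurable M" if "q < n" for q
  proof -
    have i: "p q \<in> {0..S}" "p (Suc q) \<in> {0..S}" using p[OF that] by auto
    then show m: "Y (p (Suc q)) \<in> borel_measurable M" "Y (p q) \<in> borel_measurable M"
      using Y S by (auto intro!: fil_measurable)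
    show "integrable M (\<lambda>\<omega>. (Y (p (Suc q)) \<omega> - Y (p q) \<omega>)\<^sup>2)"
      using integrable_add_L2[of "Y (p (Suc q))" M "\<lambda>\<omega>. - Y (p q) \<omega>"] m Y2[OF i(1)] Y2[OF i(2)] by simp
  qed
  have main: "integrable M (\<lambda>\<omega>. (\<Sum>q<n. D b q \<omega>)\<^sup>2) \<and>
      (\<integral>\<omega>. (\<Sum>q<n. D b q \<omega>)\<^sup>2 \<partial>M) = (\<Sum>q<n. \<integral>\<omega>. (D b q \<omega>)\<^sup>2 \<partial>M)"
    and int: "\<And>q. q < n \<Longrightarrow> integrable M (\<lambda>\<omega>. (D b q \<omega>)\<^sup>2)"
    if b: "\<And>q. q < n \<Longrightarrow> b q \<in> borel_measurable (Fil (p q))" "\<And>q \<omega>. \<bar>b q \<omega>\<bar> \<le> 1" for b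
  proof -
    have bM: "b q \<in> borel_measurable M" if "q < n" for q
      using o[OF that] by (intro fil_measurable[OF b(1)[OF that]]) auto
    show int: "integrable M (\<lambda>\<omega>. (D b q \<omega>)\<^sup>2)" if q: "q < n" for q
    proof (rule Bochner_Integration.integrable_bound[OF diff2[OF q]])
      note [measurable] = bM[OF q] YM[OF q]
      show "(\<lambda>\<omega>. (D b q \<omega>)\<^sup>2) \<in> borel_measurable M" unfolding D_def by measurable
      have "(b q \<omega>)\<^sup>2 \<le> 1" for \<omega> using b(2)[of q \<omega>] by (simp add: abs_square_le_1)
      then show "AE \<omega> in M. norm ((D b q \<omega>)\<^sup>2) \<le> norm ((Y (p (Suc q)) \<omega> - Y (p q) \<omega>)\<^sup>2)"
        by (simp add: D_def power_mult_distrib mult_left_le_one_le)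
    qed
    have "integrable M (\<lambda>\<omega>. (\<Sum>q<n. D b q \<omega>)\<^sup>2) \<and>
      (\<integral>\<omega>. (\<Sum>q<n. D b q \<omega>)\<^sup>2 \<partial>M) = (\<Sum>q<n. \<integral>\<omega>. (D b q \<omega>)\<^sup>2 \<partial>M) \<and>
      (0 < n \<longrightarrow> (\<lambda>\<omega>. \<Sum>q<n. D b q \<omega>) \<in> borel_measurable (Fil (p n)))"
    proof (rule martingale_difference_sum[where n=n and p=p and D="D b", OF o _ int])
      fix q assume q: "q < n"
      have i: "p q \<in> {0..S}" "p (Suc q) \<in> {0..S}" using p[OF q] by auto
      have [measurable]: "b q \<in> borel_measurable (Fil (p (Suc q)))" "Y (p q) \<in> borel_measurable (Fil (p (Suc q)))"
        "Y (p (Suc q)) \<in> borel_measurable (Fil (p (Suc q)))"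
        using o[OF q] fil_measurable_mono[OF b(1)[OF q], of "p (Suc q)"] fil_measurable_mono[OF Y[OF i(1)], of "p (Suc q)"] Y[OF i(2)] by auto
      show "D b q \<in> borel_measurable (Fil (p (Suc q)))" unfolding D_def[abs_def] by measurable
      fix G :: "'a \<Rightarrow> real" assume G: "G \<in> borel_measurable (Fil (p q))" "integrable M (\<lambda>\<omega>. (G \<omega>)\<^sup>2)"
      have Gb: "(\<lambda>\<omega>. G \<omega> * b q \<omega>) \<in> borel_measurable (Fil (p q))" using G(1) b(1)[OF q] by measurable
      have "integrable M (\<lambda>\<omega>. (G \<omega> * b q \<omega>)\<^sup>2)"
      proof (rule Bochner_Integration.integrable_bound[OF G(2)])
        show "(\<lambda>\<omega>. (G \<omega> * b q \<omega>)\<^sup>2) \<in> borel_measurable M"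
          using o[OF q] by (intro borel_measurable_power fil_measurable[OF Gb]) auto
        have "(b q \<omega>)\<^sup>2 \<le> 1" for \<omega> using b(2)[of q \<omega>] by (simp add: abs_square_le_1)
        then show "AE \<omega> in M. norm ((G \<omega> * b q \<omega>)\<^sup>2) \<le> norm ((G \<omega>)\<^sup>2)"
          by (simp add: power_mult_distrib mult_right_le_one_le)
      qed
      then show "(\<integral>\<omega>. G \<omega> * D b q \<omega> \<partial>M) = 0"
        unfolding D_def mult.assoc[symmetric] using p[OF q] by (intro orth Gb) auto
    qed
    then show "integrable M (\<lambda>\<omega>. (\<Sum>q<n. D b q \<omega>)\<^sup>2) \<and>
      (\<integral>\<omega>. (\<Sum>q<n. D b q \<omega>)\<^sup>2 \<partial>M) = (\<Sum>q<n. \<integral>\<omega>. (D b q \<omega>)\<^sup>2 \<partial>M)" by blast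
  qed
  note mc = main[of c, OF c] and ic = int[of c, OF c]
  note m1 = main[of "\<lambda>_ _. 1"] and i1 = int[of "\<lambda>_ _. 1"]
  show "integrable M (\<lambda>\<omega>. (\<Sum>q<n. c q \<omega> * (Y (p (Suc q)) \<omega> - Y (p q) \<omega>))\<^sup>2)"
    using mc by (simp add: D_def)
  have "(\<integral>\<omega>. (\<Sum>q<n. D c q \<omega>)\<^sup>2 \<partial>M) = (\<Sum>q<n. \<integral>\<omega>. (D c q \<omega>)\<^sup>2 \<partial>M)" using mc by simp
  also have "\<dots> \<le> (\<Sum>q<n. \<integral>\<omega>. (D (\<lambda>_ _. 1) q \<omega>)\<^sup>2 \<partial>M)"
  proof (intro sum_mono integral_mono ic i1)
    fix q \<omega>
    have "(c q \<omega>)\<^sup>2 \<le> 1" using c(2)[of q \<omega>] by (simp add: abs_square_le_1)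
    then show "(D c q \<omega>)\<^sup>2 \<le> (D (\<lambda>_ _. 1) q \<omega>)\<^sup>2" by (simp add: D_def power_mult_distrib mult_left_le_one_le)
  qed auto
  also have "\<dots> = (\<integral>\<omega>. (\<Sum>q<n. D (\<lambda>_ _. 1) q \<omega>)\<^sup>2 \<partial>M)" using m1 by simp
  also have "\<dots> = (\<integral>\<omega>. (Y (p n) \<omega> - Y (p 0) \<omega>)\<^sup>2 \<partial>M)"
    unfolding D_def by (simp add: sum_lessThan_telescope[of "\<lambda>q. Y (p q) _"])
  finally show "(\<integral>\<omega>. (\<Sum>q<n. c q \<omega> * (Y (p (Suc q)) \<omega> - Y (p q) \<omega>))\<^sup>2 \<partial>M) \<le> (\<integral>\<omega>. (Y (p n) \<omega> - Y (p 0) \<omega>)\<^sup>2 \<partial>M)"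
    unfolding D_def .
qed

end

section \<open>Price and delta processes for one forward\<close>

text \<open>\<open>k\<close> is the kernel of a forward with maturity \<open>U\<close>,
  \<open>T\<close> the expiry of the option, \<open>X\<close> the gain of the forward, and
  \<open>Z\<close> the forward minus the strike, so that the payoff is the positive part of
  \<open>Z T\<close>. The almost sure value \<open>c\<close> of \<open>Z 0\<close> supplies square
  integrability at time 0.\<close>

locale gauss_price = bm_filtered M Fil Tb W
  for M :: "'a measure" and Fil and Tb :: real and W :: "real \<Rightarrow> 'a \<Rightarrow> real^'n" +
  fixes k :: "real \<Rightarrow> real^'n" and U T :: real and X Z :: "real \<Rightarrow> 'a \<Rightarrow> real" and c :: real
  assumes ito: "has_ito_integral M Fil W U (\<lambda>t \<omega>. k t) X"
    and U: "U \<le> Tb" and T: "0 < T" "T \<le> U"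
    and k: "k \<in> borel_measurable (restrict_space lborel {0..U})"
    and k2: "set_integrable lborel {0..U} (\<lambda>u. (norm (k u))\<^sup>2)"
    and X0: "\<And>\<omega>. X 0 \<omega> = 0"
    and Z: "\<And>t \<omega>. Z t \<omega> = Z 0 \<omega> + X t \<omega>"
    and Z0: "Z 0 \<in> borel_measurable (Fil 0)" "AE \<omega> in M. Z 0 \<omega> = c"
begin

text \<open>The remaining variance until expiry; its root is the volatility in the pricing
  formula.\<close>

definition rv :: "real \<Rightarrow> real" where
  "rv t = (LBINT u:{t..T}. (norm (k u))\<^sup>2)"

lemma k2_sub: "0 \<le> s \<Longrightarrow> t \<le> U \<Longrightarrow> set_integrable lborel {s..t} (\<lambda>u. (norm (k u))\<^sup>2)"
  by (rule set_integrable_subset[OF k2]) auto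

lemma rv_integral: 
  assumes "0 \<le> s" "t \<le> U"
  shows "(LBINT u:{s..t}. (norm (k u))\<^sup>2) = integral {s..t} (\<lambda>u. (norm (k u))\<^sup>2)"
    "(\<lambda>u. (norm (k u))\<^sup>2) integrable_on {s..t}"
  using set_borel_integral_eq_integral[OF k2_sub[OF assms]] by auto

lemma rv_diff:
  assumes "0 \<le> s" "s \<le> t" "t \<le> T"
  shows "(LBINT u:{s..t}. (norm (k u))\<^sup>2) = rv s - rv t"
proof -
  have "integral {s..t} (\<lambda>u. (norm (k u))\<^sup>2) + integral {t..T} (\<lambda>u. (norm (k u))\<^sup>2) = integral {s..T} (\<lambda>u. (norm (k u))\<^sup>2)"
    using assms T by (intro Henstock_Kurzweil_Integration.integral_combine rv_integral(2)) auto
  then show ?thesis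
    unfolding rv_def using assms T rv_integral(1)[of s t] rv_integral(1)[of t T] rv_integral(1)[of s T] by auto
qed

lemma rv_nonneg: "0 \<le> rv t"
  unfolding rv_def set_lebesgue_integral_def by (intro integral_nonneg_AE AE_I2) auto

lemma rv_antimono: "0 \<le> s \<Longrightarrow> s \<le> t \<Longrightarrow> t \<le> T \<Longrightarrow> rv t \<le> rv s"
proof -
  assume "0 \<le> s" "s \<le> t" "t \<le> T"
  then have "rv s - rv t = (LBINT u:{s..t}. (norm (k u))\<^sup>2)" by (simp add: rv_diff)
  also have "\<dots> \<ge> 0" unfolding set_lebesgue_integral_def by (intro integral_nonneg_AE AE_I2) auto
  finally show "rv t \<le> rv s" by simp
qed

lemma rv_T: "rv T = 0"
  using rv_diff[of T T] T unfolding rv_def by simp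

text \<open>Up to a constant and a sign this is an indefinite integral. Uniform continuity on the
  compact interval later makes all variance increments small at once.\<close>

lemma rv_continuous: "continuous_on {0..T} rv"
proof -
  have "continuous_on {0..T} (\<lambda>t. rv 0 - integral {0..t} (\<lambda>u. (norm (k u))\<^sup>2))"
    using rv_integral(2)[of 0 T] T by (intro continuous_intros indefinite_integral_continuous_1) auto
  then show ?thesis
  proof (rule continuous_on_eq)
    fix t assume "t \<in> {0..T}"
    then show "rv 0 - integral {0..t} (\<lambda>u. (norm (k u))\<^sup>2) = rv t"
      using rv_diff[of 0 t] rv_integral(1)[of 0 t] T by auto
  qed
qed

text \<open>By continuity the zero set of \<open>rv\<close> has a least element t0. As
  \<open>rv t0 = 0\<close>, the kernel vanishes almost everywhere from t0 on, and every zero of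
  \<open>rv\<close> lies there.\<close>

lemma rv_eq_0_imp: "AE u in lborel. u \<in> {0..T} \<longrightarrow> rv u = 0 \<longrightarrow> k u = 0"
proof -
  define S where "S = {t \<in> {0..T}. rv t = 0}"
  have "closed S" unfolding S_def
    by (rule continuous_closed_preimage_constant[OF rv_continuous]) auto
  moreover have "T \<in> S" "bounded S" using T rv_T by (auto simp: S_def intro: bounded_subset[of "{0..T}"])
  ultimately obtain t0 where t0: "t0 \<in> S" "\<And>t. t \<in> S \<Longrightarrow> t0 \<le> t"
    using compact_attains_inf[of S] by (auto simp: compact_eq_bounded_closed)
  then have o: "0 \<le> t0" "t0 \<le> T" and z: "(\<integral>u. indicator {t0..T} u *\<^sub>R (norm (k u))\<^sup>2 \<partial>lborel) = 0"
    by (auto simp: S_def rv_def set_lebesgue_integral_def)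
  have "integrable lborel (\<lambda>u. indicator {t0..T} u *\<^sub>R (norm (k u))\<^sup>2)"
    using k2_sub[of t0 T] o T by (simp add: set_integrable_def)
  then have "AE u in lborel. indicator {t0..T} u *\<^sub>R (norm (k u))\<^sup>2 = 0"
    using z by (subst (asm) integral_nonneg_eq_0_iff_AE) auto
  then show ?thesis
  proof eventually_elim
    case (elim u)
    show ?case
    proof (intro impI)
      assume "u \<in> {0..T}" "rv u = 0"
      then have "t0 \<le> u" "u \<le> T" using t0(2)[of u] by (auto simp: S_def)
      then show "k u = 0" using elim by simp
    qed
  qed
qed

lemma Z_fil: "t \<in> {0..T} \<Longrightarrow> Z t \<in> borel_measurable (Fil t)"
proof -
  assume t: "t \<in> {0..T}"
  have [measurable]: "X t \<in> borel_measurable (Fil t)" 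
    using ito t T by (auto simp: has_ito_integral_def)
  have [measurable]: "Z 0 \<in> borel_measurable (Fil t)"
    using fil_measurable_mono[OF Z0(1), of t] t T U by auto
  have "(\<lambda>\<omega>. Z 0 \<omega> + X t \<omega>) \<in> borel_measurable (Fil t)" by measurable
  then show ?thesis using Z[of t] by presburger
qed

lemma Z_meas: "t \<in> {0..T} \<Longrightarrow> Z t \<in> borel_measurable M"
  using fil_measurable[OF Z_fil[of t]] T U by auto

lemma Z_incr:
  assumes "0 \<le> s" "s \<le> t" "t \<le> T"
  shows "gauss_indep M (Fil s) (sqrt (rv s - rv t)) (\<lambda>\<omega>. Z t \<omega> - Z s \<omega>)"
proof -
  have "Z t \<omega> - Z s \<omega> = X t \<omega> - X s \<omega>" for \<omega> using Z[of t \<omega>] Z[of s \<omega>] by linarith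
  then show ?thesis
    using deterministic_integral_gauss_indep[OF ito U k assms(1,2)] rv_diff[OF assms] assms T by simp
qed

lemma X_eq: "X t \<omega> = Z t \<omega> - Z 0 \<omega>"
  using Z[of t \<omega>] by linarith

lemma X_meas: "t \<in> {0..T} \<Longrightarrow> X t \<in> borel_measurable (Fil t)"
  using ito T by (auto simp: has_ito_integral_def)

lemma X_L2: "t \<in> {0..T} \<Longrightarrow> integrable M (\<lambda>\<omega>. (X t \<omega>)\<^sup>2)"
  unfolding X_eq using T by (intro gauss_indep_moments(3)[OF Z_incr[of 0 t]]) auto

lemma Z_L2: 
  assumes t: "t \<in> {0..T}" 
  shows "integrable M (\<lambda>\<omega>. (Z t \<omega>)\<^sup>2)"
proof -
  have [measurable]: "Z 0 \<in> borel_measurable M" using Z_meas[of 0] T by simp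
  have [measurable]: "X t \<in> borel_measurable M" using fil_measurable[OF X_meas[OF t]] t T U by auto
  have "integrable M (\<lambda>\<omega>. (Z 0 \<omega>)\<^sup>2)"
  proof (rule integrable_cong_AE_imp[of _ "\<lambda>\<omega>. c\<^sup>2"])
    show "AE \<omega> in M. c\<^sup>2 = (Z 0 \<omega>)\<^sup>2" using Z0(2) by eventually_elim simp
  qed auto
  then have "integrable M (\<lambda>\<omega>. (Z 0 \<omega> + X t \<omega>)\<^sup>2)"
    by (intro integrable_add_L2 X_L2[OF t]) auto
  then show ?thesis using Z[of t] by presburger
qed

lemma X_orthogonal:
  assumes "0 \<le> s" "s \<le> t" "t \<le> T" "G \<in> borel_measurable (Fil s)" "integrable M (\<lambda>\<omega>. (G \<omega>)\<^sup>2)"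
  shows "(\<integral>\<omega>. G \<omega> * (X t \<omega> - X s \<omega>) \<partial>M) = 0"
proof -
  have "G \<in> borel_measurable M" using fil_measurable[OF assms(4)] assms T U by auto
  then have "integrable M G" using abs_expectation_le_L2(1) assms(5) by blast
  from gauss_indep_mult_moments(2)[OF Z_incr[OF assms(1-3)] assms(4) this]
  show ?thesis by (simp add: X_eq)
qed

text \<open>A positive \<open>\<epsilon>\<close> smooths the payoff and makes the delta Lipschitz.\<close>

definition price :: "real \<Rightarrow> real \<Rightarrow> 'a \<Rightarrow> real" where
  "price \<epsilon> t \<omega> = bachelier (sqrt (rv t + \<epsilon>\<^sup>2)) (Z t \<omega>)"

definition delta :: "real \<Rightarrow> real \<Rightarrow> 'a \<Rightarrow> real" where
  "delta \<epsilon> t \<omega> = bachelier_delta (sqrt (rv t + \<epsilon>\<^sup>2)) (Z t \<omega>)"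

lemma price_fil: "t \<in> {0..T} \<Longrightarrow> price \<epsilon> t \<in> borel_measurable (Fil t)"
  unfolding price_def[abs_def] using Z_fil by measurable

lemma delta_fil: "t \<in> {0..T} \<Longrightarrow> delta \<epsilon> t \<in> borel_measurable (Fil t)"
  unfolding delta_def[abs_def] using Z_fil by measurable

lemma price_meas: "t \<in> {0..T} \<Longrightarrow> price \<epsilon> t \<in> borel_measurable M"
  using fil_measurable[OF price_fil[of t]] T U by auto

lemma delta_bounds: "0 \<le> delta \<epsilon> t \<omega>" "delta \<epsilon> t \<omega> \<le> 1" "\<bar>delta \<epsilon> t \<omega>\<bar> \<le> 1"
  using bachelier_delta_bounds[of "sqrt (rv t + \<epsilon>\<^sup>2)" "Z t \<omega>"] by (auto simp: delta_def)

lemma price_bound: "\<bar>price \<epsilon> t \<omega>\<bar> \<le> \<bar>Z t \<omega>\<bar> + sqrt (rv t + \<epsilon>\<^sup>2)"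
  using bachelier_lipschitz[of "sqrt (rv t + \<epsilon>\<^sup>2)" "Z t \<omega>" 0 0] rv_nonneg[of t]
  by (simp add: price_def bachelier_0)

lemma price_L2:
  assumes t: "t \<in> {0..T}"
  shows "integrable M (\<lambda>\<omega>. (price \<epsilon> t \<omega>)\<^sup>2)"
proof (rule Bochner_Integration.integrable_bound)
  have [measurable]: "Z t \<in> borel_measurable M" using Z_meas[OF t] .
  show "integrable M (\<lambda>\<omega>. (\<bar>Z t \<omega>\<bar> + sqrt (rv t + \<epsilon>\<^sup>2))\<^sup>2)"
    using Z_L2[OF t] by (intro integrable_add_L2) auto
  show "AE \<omega> in M. norm ((price \<epsilon> t \<omega>)\<^sup>2) \<le> norm ((\<bar>Z t \<omega>\<bar> + sqrt (rv t + \<epsilon>\<^sup>2))\<^sup>2)"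
    using power_mono[OF price_bound abs_ge_zero, of \<epsilon> t _ 2] by simp
qed (use price_meas[OF t] in auto)

lemma price_integrable: "t \<in> {0..T} \<Longrightarrow> integrable M (price \<epsilon> t)"
  by (rule abs_expectation_le_L2(1)[OF price_meas price_L2])

text \<open>Freezing \<open>Z s\<close> and averaging over an increment of variance
  \<open>rv s - rv t\<close> is the semigroup identity, which restores the remaining variance at s.
  For \<epsilon> = 0 and t = T this is the pricing formula, since \<open>rv T = 0\<close>.\<close>

lemma price_martingale:
  assumes st: "0 \<le> s" "s \<le> t" "t \<le> T"
  shows "AE \<omega> in M. real_cond_exp M (Fil s) (price \<epsilon> t) \<omega> = price \<epsilon> s \<omega>"
proof -
  have s: "s \<in> {0..T}" and t: "t \<in> {0..T}" using st by auto
  let ?v = "sqrt (rv t + \<epsilon>\<^sup>2)"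
  let ?h = "\<lambda>\<omega> y. bachelier ?v (Z s \<omega> + y)"
  have eq: "?h \<omega> (Z t \<omega> - Z s \<omega>) = price \<epsilon> t \<omega>" for \<omega> by (simp add: price_def)
  have [measurable]: "Z s \<in> borel_measurable (Fil s)" by (rule Z_fil[OF s])
  have "AE \<omega> in M. real_cond_exp M (Fil s) (\<lambda>\<omega>. ?h \<omega> (Z t \<omega> - Z s \<omega>)) \<omega>
      = (\<integral>z. ?h \<omega> (sqrt (rv s - rv t) * z) \<partial>std_normal_distribution)"
    by (rule gauss_indep_cond_exp[OF Z_incr[OF st]]) (use price_integrable[OF t, of \<epsilon>] in \<open>simp_all add: price_def[abs_def]\<close>)
  moreover have "(\<integral>z. ?h \<omega> (sqrt (rv s - rv t) * z) \<partial>std_normal_distribution) = price \<epsilon> s \<omega>" for \<omega>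
    using rv_nonneg[of t] rv_antimono[OF st] by (simp add: bachelier_semigroup price_def add.commute)
  ultimately show ?thesis unfolding eq by simp
qed

lemma price_orthogonal:
  assumes st: "0 \<le> s" "s \<le> t" "t \<le> T" and G: "G \<in> borel_measurable (Fil s)" "integrable M (\<lambda>\<omega>. (G \<omega>)\<^sup>2)"
  shows "(\<integral>\<omega>. G \<omega> * (price \<epsilon> t \<omega> - price \<epsilon> s \<omega>) \<partial>M) = 0"
proof -
  have s: "s \<in> {0..T}" and t: "t \<in> {0..T}" and sT: "s \<in> {0..Tb}" using st T U by auto
  have GM: "G \<in> borel_measurable M" using fil_measurable[OF G(1) sT] .
  interpret finite_measure_subalgebra M "Fil s" using subalg[OF sT] by unfold_locales
  have i: "integrable M (\<lambda>\<omega>. G \<omega> * price \<epsilon> t \<omega>)" "integrable M (\<lambda>\<omega>. G \<omega> * price \<epsilon> s \<omega>)"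
    by (auto intro!: integrable_mult_L2 GM G price_meas price_L2 s t)
  have "(\<integral>\<omega>. G \<omega> * price \<epsilon> t \<omega> \<partial>M) = (\<integral>\<omega>. G \<omega> * real_cond_exp M (Fil s) (price \<epsilon> t) \<omega> \<partial>M)"
    by (rule real_cond_exp_intg(2)[OF i(1) G(1) price_meas[OF t], symmetric])
  also have "\<dots> = (\<integral>\<omega>. G \<omega> * price \<epsilon> s \<omega> \<partial>M)"
  proof (rule integral_cong_AE)
    show "AE \<omega> in M. G \<omega> * real_cond_exp M (Fil s) (price \<epsilon> t) \<omega> = G \<omega> * price \<epsilon> s \<omega>"
      using price_martingale[OF st, of \<epsilon>] by eventually_elim simp
  qed (use GM price_meas[OF s] in auto)
  finally show ?thesis using i by (simp add: right_diff_distrib)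
qed

text \<open>The one-step estimate is applied with the smoothed volatility at t as v; adding the
  variance of the increment gives the one at s. Because v \<ge> \<epsilon>, the factor 1 / v becomes
  a constant along the path.\<close>

lemma hedging_error_bound:
  assumes st: "0 \<le> s" "s \<le> t" "t \<le> T" and \<epsilon>: "0 < \<epsilon>"
  shows "\<bar>price \<epsilon> t \<omega> - price \<epsilon> s \<omega> - delta \<epsilon> s \<omega> * (Z t \<omega> - Z s \<omega>)\<bar> \<le> 2 * ((Z t \<omega> - Z s \<omega>)\<^sup>2 + (rv s - rv t)) / \<epsilon>"
proof -
  let ?v = "sqrt (rv t + \<epsilon>\<^sup>2)" and ?s = "sqrt (rv s - rv t)" and ?y = "Z t \<omega> - Z s \<omega>"
  have v: "\<epsilon> \<le> ?v" using rv_nonneg[of t] by (intro real_le_rsqrt) auto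
  have pos: "0 < rv t + \<epsilon>\<^sup>2" using rv_nonneg[of t] \<epsilon> by (simp add: add_nonneg_pos)
  have w: "sqrt (?v\<^sup>2 + ?s\<^sup>2) = sqrt (rv s + \<epsilon>\<^sup>2)"
    using rv_nonneg[of t] rv_antimono[OF st] by simp
  have "\<bar>price \<epsilon> t \<omega> - price \<epsilon> s \<omega> - delta \<epsilon> s \<omega> * ?y\<bar> \<le> 2 * (?y\<^sup>2 + ?s\<^sup>2) / ?v"
    using bachelier_step[of ?v "Z s \<omega>" ?y ?s] pos unfolding w by (simp add: price_def delta_def)
  also have "\<dots> \<le> 2 * (?y\<^sup>2 + ?s\<^sup>2) / \<epsilon>" using v \<epsilon> pos by (intro divide_left_mono mult_pos_pos) auto
  finally show ?thesis using rv_antimono[OF st] by simp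
qed

text \<open>With r = \<open>rv s - rv t\<close> and y the increment, (2 (y^2 + r) / \<epsilon>)^2
  \<le> 8 (y^4 + r^2) / \<epsilon>^2, and the Gaussian fourth moment 3 r^2 gives 8 (3 + 1) =
  32.\<close>

lemma hedging_error_L2:
  assumes st: "0 \<le> s" "s \<le> t" "t \<le> T" and \<epsilon>: "0 < \<epsilon>"
  shows "integrable M (\<lambda>\<omega>. (price \<epsilon> t \<omega> - price \<epsilon> s \<omega> - delta \<epsilon> s \<omega> * (Z t \<omega> - Z s \<omega>))\<^sup>2)"
    and "(\<integral>\<omega>. (price \<epsilon> t \<omega> - price \<epsilon> s \<omega> - delta \<epsilon> s \<omega> * (Z t \<omega> - Z s \<omega>))\<^sup>2 \<partial>M) \<le> 32 / \<epsilon>\<^sup>2 * (rv s - rv t)\<^sup>2"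
proof -
  have s: "s \<in> {0..T}" and t: "t \<in> {0..T}" and sT: "s \<in> {0..Tb}" using st T U by auto
  let ?D = "\<lambda>\<omega>. price \<epsilon> t \<omega> - price \<epsilon> s \<omega> - delta \<epsilon> s \<omega> * (Z t \<omega> - Z s \<omega>)" and ?y = "\<lambda>\<omega>. Z t \<omega> - Z s \<omega>"
  let ?r = "rv s - rv t"
  have r: "0 \<le> ?r" using rv_antimono[OF st] by simp
  note mom = gauss_indep_moments[OF Z_incr[OF st]]
  have [measurable]: "Z s \<in> borel_measurable M" "Z t \<in> borel_measurable M" "price \<epsilon> s \<in> borel_measurable M"
      "price \<epsilon> t \<in> borel_measurable M" "delta \<epsilon> s \<in> borel_measurable M"
    using Z_meas price_meas s t fil_measurable[OF delta_fil[OF s] sT] by auto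
  have bd: "(?D \<omega>)\<^sup>2 \<le> 8 / \<epsilon>\<^sup>2 * ((?y \<omega>) ^ 4 + ?r\<^sup>2)" for \<omega>
  proof -
    have "(?D \<omega>)\<^sup>2 \<le> (2 * ((?y \<omega>)\<^sup>2 + ?r) / \<epsilon>)\<^sup>2"
      using power_mono[OF hedging_error_bound[OF st \<epsilon>, of \<omega>] abs_ge_zero, of 2] by simp
    also have "\<dots> = 4 / \<epsilon>\<^sup>2 * ((?y \<omega>)\<^sup>2 + ?r)\<^sup>2" unfolding power_mult_distrib power_divide by simp
    also have "\<dots> \<le> 4 / \<epsilon>\<^sup>2 * (2 * (((?y \<omega>)\<^sup>2)\<^sup>2 + ?r\<^sup>2))"
      using sum_squares_bound[of "(?y \<omega>)\<^sup>2" ?r] by (intro mult_left_mono) (auto simp: power2_sum)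
    finally show ?thesis by (simp add: power_mult[symmetric])
  qed
  have ib: "integrable M (\<lambda>\<omega>. 8 / \<epsilon>\<^sup>2 * ((?y \<omega>) ^ 4 + ?r\<^sup>2))" using mom(5) by auto
  show i: "integrable M (\<lambda>\<omega>. (?D \<omega>)\<^sup>2)"
    by (rule Bochner_Integration.integrable_bound[OF ib]) (use bd in \<open>auto intro!: AE_I2 order_trans[OF bd abs_ge_self]\<close>)
  have "(\<integral>\<omega>. (?D \<omega>)\<^sup>2 \<partial>M) \<le> (\<integral>\<omega>. 8 / \<epsilon>\<^sup>2 * ((?y \<omega>) ^ 4 + ?r\<^sup>2) \<partial>M)"
    by (rule integral_mono[OF i ib bd])
  also have "\<dots> = 8 / \<epsilon>\<^sup>2 * (3 * sqrt ?r ^ 4 + ?r\<^sup>2)" using mom(5,6) by (simp add: prob_space)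
  also have "sqrt ?r ^ 4 = ?r\<^sup>2" using r by (simp add: power4_eq_xxxx power2_eq_square)
  finally show "(\<integral>\<omega>. (?D \<omega>)\<^sup>2 \<partial>M) \<le> 32 / \<epsilon>\<^sup>2 * ?r\<^sup>2" by simp
qed

text \<open>The square of (|y| + s) / \<epsilon> is at most 2 (y^2 + s^2) / \<epsilon>^2; both terms
  have mean \<open>rv s - rv t\<close>, hence the factor 4.\<close>

lemma delta_increment:
  assumes st: "0 \<le> s" "s \<le> t" "t \<le> T" and \<epsilon>: "0 < \<epsilon>"
  shows "(\<integral>\<^sup>+\<omega>. ennreal ((delta \<epsilon> t \<omega> - delta \<epsilon> s \<omega>)\<^sup>2) \<partial>M) \<le> ennreal (4 / \<epsilon>\<^sup>2 * (rv s - rv t))"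
proof -
  let ?v = "sqrt (rv t + \<epsilon>\<^sup>2)" and ?s = "sqrt (rv s - rv t)" and ?y = "\<lambda>\<omega>. Z t \<omega> - Z s \<omega>"
  note mom = gauss_indep_moments[OF Z_incr[OF st]]
  have r: "0 \<le> rv s - rv t" using rv_antimono[OF st] by simp
  have v: "\<epsilon> \<le> ?v" using rv_nonneg[of t] by (intro real_le_rsqrt) auto
  have pos: "0 < rv t + \<epsilon>\<^sup>2" using rv_nonneg[of t] \<epsilon> by (simp add: add_nonneg_pos)
  have w: "sqrt (?v\<^sup>2 + ?s\<^sup>2) = sqrt (rv s + \<epsilon>\<^sup>2)"
    using rv_nonneg[of t] r by simp
  have bd: "(delta \<epsilon> t \<omega> - delta \<epsilon> s \<omega>)\<^sup>2 \<le> 2 / \<epsilon>\<^sup>2 * ((?y \<omega>)\<^sup>2 + (rv s - rv t))" for \<omega>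
  proof -
    have "\<bar>delta \<epsilon> t \<omega> - delta \<epsilon> s \<omega>\<bar> \<le> (\<bar>?y \<omega>\<bar> + \<bar>?s\<bar>) / ?v"
      using bachelier_delta_step[of ?v "Z s \<omega>" "?y \<omega>" ?s] pos unfolding w by (simp add: delta_def)
    also have "\<dots> \<le> (\<bar>?y \<omega>\<bar> + \<bar>?s\<bar>) / \<epsilon>" using v \<epsilon> pos by (intro divide_left_mono mult_pos_pos) auto
    finally have "(delta \<epsilon> t \<omega> - delta \<epsilon> s \<omega>)\<^sup>2 \<le> ((\<bar>?y \<omega>\<bar> + \<bar>?s\<bar>) / \<epsilon>)\<^sup>2"
      using power_mono[of "\<bar>delta \<epsilon> t \<omega> - delta \<epsilon> s \<omega>\<bar>" _ 2] by fastforce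
    also have "\<dots> = 1 / \<epsilon>\<^sup>2 * (\<bar>?y \<omega>\<bar> + \<bar>?s\<bar>)\<^sup>2" by (simp add: power_divide)
    also have "\<dots> \<le> 1 / \<epsilon>\<^sup>2 * (2 * (\<bar>?y \<omega>\<bar>\<^sup>2 + \<bar>?s\<bar>\<^sup>2))"
      using sum_squares_bound[of "\<bar>?y \<omega>\<bar>" "\<bar>?s\<bar>"] by (intro mult_left_mono) (auto simp: power2_sum)
    finally show ?thesis using r by simp
  qed
  have ib: "integrable M (\<lambda>\<omega>. 2 / \<epsilon>\<^sup>2 * ((?y \<omega>)\<^sup>2 + (rv s - rv t)))" using mom(3) by auto
  have "(\<integral>\<^sup>+\<omega>. ennreal ((delta \<epsilon> t \<omega> - delta \<epsilon> s \<omega>)\<^sup>2) \<partial>M) \<le> (\<integral>\<^sup>+\<omega>. ennreal (2 / \<epsilon>\<^sup>2 * ((?y \<omega>)\<^sup>2 + (rv s - rv t))) \<partial>M)"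
    by (intro nn_integral_mono ennreal_leI bd)
  also have "\<dots> = ennreal (\<integral>\<omega>. 2 / \<epsilon>\<^sup>2 * ((?y \<omega>)\<^sup>2 + (rv s - rv t)) \<partial>M)"
    using r by (intro nn_integral_eq_integral[OF ib]) auto
  also have "(\<integral>\<omega>. 2 / \<epsilon>\<^sup>2 * ((?y \<omega>)\<^sup>2 + (rv s - rv t)) \<partial>M) = 4 / \<epsilon>\<^sup>2 * (rv s - rv t)"
    using mom(3,4) r by (simp add: prob_space)
  finally show ?thesis .
qed

text \<open>The root is subadditive, so the extra variance raises the volatility by at most
  |\<epsilon>|, and the price is 1-Lipschitz in the volatility. The bound is uniform in time and
  path.\<close>

lemma price_smoothing: "\<bar>price \<epsilon> t \<omega> - price 0 t \<omega>\<bar> \<le> \<bar>\<epsilon>\<bar>"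
proof -
  have "\<bar>price \<epsilon> t \<omega> - price 0 t \<omega>\<bar> \<le> \<bar>sqrt (rv t + \<epsilon>\<^sup>2) - sqrt (rv t + 0\<^sup>2)\<bar>"
    using bachelier_lipschitz[of "sqrt (rv t + \<epsilon>\<^sup>2)" "Z t \<omega>" "sqrt (rv t + 0\<^sup>2)" "Z t \<omega>"] by (simp add: price_def)
  also have "\<dots> \<le> \<bar>\<epsilon>\<bar>"
    using sqrt_add_le_add_sqrt[OF rv_nonneg[of t] zero_le_power2[of \<epsilon>]] rv_nonneg[of t] by simp
  finally show ?thesis .
qed

end

section \<open>Partitions and their refinement\<close>

lemma partition_mono:
  fixes p :: "nat \<Rightarrow> real"
  assumes "\<And>q. q < n \<Longrightarrow> p q \<le> p (Suc q)" "i \<le> j" "j \<le> n"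
  shows "p i \<le> p j"
  using assms(2,3)
proof (induction j rule: dec_induct)
  case (step j)
  then show ?case using assms(1)[of j] by linarith
qed simp

lemma partition_cover:
  fixes p :: "nat \<Rightarrow> real"
  assumes "p 0 < t" "t \<le> p n"
  obtains q where "q < n" "p q < t" "t \<le> p (Suc q)"
proof -
  have "\<exists>q<n. p q < t \<and> t \<le> p (Suc q)"
    using assms(2)
  proof (induction n)
    case 0
    then show ?case using assms(1) by simp
  next
    case (Suc n)
    show ?case
    proof (cases "t \<le> p n")
      case True
      then show ?thesis using Suc.IH less_SucI by blast
    next
      case False
      then show ?thesis using Suc.prems by (intro exI[of _ n]) auto
    qed
  qed
  then show ?thesis using that by blast
qed

lemma simple_proc_on_cell:
  assumes "\<And>q. q < n \<Longrightarrow> p q \<le> p (Suc q)" "q < n" "p q < t" "t \<le> p (Suc q)"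
  shows "simple_proc n p \<xi> t \<omega> = \<xi> q \<omega>"
proof -
  have z: "indicator {p j<..p (Suc j)} t = (0::real)" if "j < n" "j \<noteq> q" for j
  proof (cases "j < q")
    case True
    then have "p (Suc j) \<le> p q" using assms(2) by (intro partition_mono[of n p, OF assms(1)]) auto
    then show ?thesis using assms(3) by simp
  next
    case False
    then have "p (Suc q) \<le> p j" using that by (intro partition_mono[of n p, OF assms(1)]) auto
    then show ?thesis using assms(4) by simp
  qed
  have "simple_proc n p \<xi> t \<omega> = (\<Sum>j\<in>{q}. indicator {p j<..p (Suc j)} t *\<^sub>R \<xi> j \<omega>)"
    unfolding simple_proc_def using assms(2) z by (intro sum.mono_neutral_right) auto
  then show ?thesis using assms(3,4) by simp
qed

text \<open>Each cell of \<tau> is cut into r equal pieces; \<open>q div r\<close> numbers the cell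
  and \<open>q mod r\<close> the piece inside it.\<close>

definition refine :: "(nat \<Rightarrow> real) \<Rightarrow> nat \<Rightarrow> nat \<Rightarrow> real" where
  "refine \<tau> r q = \<tau> (q div r) + real (q mod r) / real r * (\<tau> (Suc (q div r)) - \<tau> (q div r))"

text \<open>For the last piece of a cell the successor index moves to the next cell, where it stands
  for the same point: the fraction becomes 1 on the right-hand side.\<close>

lemma refine_Suc:
  assumes "0 < r"
  shows "refine \<tau> r (Suc q) = \<tau> (q div r) + real (Suc (q mod r)) / real r * (\<tau> (Suc (q div r)) - \<tau> (q div r))"
proof (cases "Suc (q mod r) = r")
  case True
  then have "Suc q mod r = 0" "Suc q div r = Suc (q div r)" by (auto simp: mod_Suc div_Suc)
  then show ?thesis using True assms by (simp add: refine_def del: of_nat_Suc)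
next
  case False
  then have "Suc q mod r = Suc (q mod r)" "Suc q div r = q div r" using assms by (auto simp: mod_Suc div_Suc)
  then show ?thesis by (simp add: refine_def)
qed

lemma refine_bounds:
  assumes "0 < r" "\<tau> (q div r) \<le> \<tau> (Suc (q div r))"
  shows "\<tau> (q div r) \<le> refine \<tau> r q" "refine \<tau> r q \<le> refine \<tau> r (Suc q)" "refine \<tau> r (Suc q) \<le> \<tau> (Suc (q div r))"
    "refine \<tau> r (Suc q) - refine \<tau> r q = (\<tau> (Suc (q div r)) - \<tau> (q div r)) / real r"
proof -
  let ?d = "\<tau> (Suc (q div r)) - \<tau> (q div r)"
  have d: "0 \<le> ?d" using assms by simp
  show "\<tau> (q div r) \<le> refine \<tau> r q" unfolding refine_def using d by simp
  show e: "refine \<tau> r (Suc q) - refine \<tau> r q = ?d / real r"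
  proof -
    have "real (Suc (q mod r)) / real r * ?d - real (q mod r) / real r * ?d = ?d / real r"
      unfolding left_diff_distrib[symmetric] diff_divide_distrib[symmetric] by simp
    then show ?thesis unfolding refine_Suc[OF assms(1)] unfolding refine_def by linarith
  qed
  then show "refine \<tau> r q \<le> refine \<tau> r (Suc q)" using d by (smt (verit) divide_nonneg_nonneg of_nat_0_le_iff)
  have "real (Suc (q mod r)) / real r \<le> 1"
    using assms(1) mod_less_divisor[of r q] by (simp add: divide_le_eq del: of_nat_Suc mod_less_divisor)
  then have "real (Suc (q mod r)) / real r * ?d \<le> 1 * ?d" by (rule mult_right_mono[OF _ d])
  then show "refine \<tau> r (Suc q) \<le> \<tau> (Suc (q div r))" unfolding refine_Suc[OF assms(1)] by simp
qed

lemma refine_ends: "0 < r \<Longrightarrow> refine \<tau> r 0 = \<tau> 0" "0 < r \<Longrightarrow> refine \<tau> r (N * r) = \<tau> N"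
  by (simp_all add: refine_def)

context bm_filtered
begin

text \<open>Telescoping over a refinement requires a partition that runs from 0 to T. The points are
  clamped to this interval, and a cell of value 0 is attached at either end.\<close>

lemma pad_simple:
  assumes s: "simple_adapted Fil U N \<tau> (\<lambda>i \<omega>. \<eta> i)" and T: "0 < T" "T \<le> U" "U \<le> Tb"
  obtains N' \<tau>' \<eta>' where "simple_adapted Fil T N' \<tau>' (\<lambda>i \<omega>. \<eta>' i)" "\<tau>' 0 = 0" "\<tau>' N' = T"
    and "\<And>t \<omega>. t \<in> {0..T} \<Longrightarrow> simple_integral_wrt W N' \<tau>' (\<lambda>i \<omega>. \<eta>' i) t \<omega> = simple_integral_wrt W N \<tau> (\<lambda>i \<omega>. \<eta> i) t \<omega>"
    and "\<And>t \<omega> \<omega>'. t \<in> {0..T} \<Longrightarrow> simple_proc N' \<tau>' (\<lambda>i \<omega>. \<eta>' i) t (\<omega>::'a) = simple_proc N \<tau> (\<lambda>i \<omega>. \<eta> i) t (\<omega>'::'a)"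
proof -
  note o = simple_adapted_term(1-3)[OF s T(3)]
  \<comment> \<open>The lower clamp matters for N = 0, where nothing is known about
    \<open>\<tau> 0\<close>.\<close>
  define cl where "cl x = max 0 (min T x)" for x :: real
  define \<tau>' where "\<tau>' i = (case i of 0 \<Rightarrow> 0 | Suc j \<Rightarrow> if j \<le> N then cl (\<tau> j) else T)" for i
  define \<eta>' where "\<eta>' i = (case i of 0 \<Rightarrow> 0 | Suc j \<Rightarrow> if j < N then \<eta> j else 0)" for i
  have cl: "0 \<le> cl x" "cl x \<le> T" for x using T by (auto simp: cl_def)
  have clm: "cl x \<le> cl y" if "x \<le> y" for x y using that by (auto simp: cl_def)
  have "simple_adapted Fil T (Suc (Suc N)) \<tau>' (\<lambda>i \<omega>. \<eta>' i)"
    unfolding simple_adapted_def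
  proof (intro allI impI conjI)
    fix i assume i: "i < Suc (Suc N)"
    show "0 \<le> \<tau>' i" "\<tau>' (Suc i) \<le> T" using cl T by (auto simp: \<tau>'_def split: nat.split)
    show "\<tau>' i \<le> \<tau>' (Suc i)"
    proof (cases i)
      case (Suc j)
      then show ?thesis using cl clm[OF o(2)[of j]] i by (auto simp: \<tau>'_def)
    qed (use cl in \<open>auto simp: \<tau>'_def\<close>)
  qed auto
  moreover have "\<tau>' 0 = 0" "\<tau>' (Suc (Suc N)) = T" by (auto simp: \<tau>'_def)
  moreover have "simple_integral_wrt W (Suc (Suc N)) \<tau>' (\<lambda>i \<omega>. \<eta>' i) t \<omega> = simple_integral_wrt W N \<tau> (\<lambda>i \<omega>. \<eta> i) t \<omega>"
    if t: "t \<in> {0..T}" for t \<omega>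
  proof -
    have "min t (cl (\<tau> i)) = min t (\<tau> i)" "min t (cl (\<tau> (Suc i))) = min t (\<tau> (Suc i))" if "i < N" for i
      using o[OF that] t by (auto simp: cl_def)
    then show ?thesis
      unfolding simple_integral_wrt_def
      by (subst sum.lessThan_Suc_shift, subst sum.lessThan_Suc) (auto simp: \<eta>'_def \<tau>'_def intro!: sum.cong)
  qed
  moreover have "simple_proc (Suc (Suc N)) \<tau>' (\<lambda>i \<omega>. \<eta>' i) t \<omega> = simple_proc N \<tau> (\<lambda>i \<omega>. \<eta> i) t \<omega>'"
    if t: "t \<in> {0..T}" for t and \<omega> \<omega>' :: 'a
  proof -
    have "indicator {cl (\<tau> i)<..cl (\<tau> (Suc i))} t = (indicator {\<tau> i<..\<tau> (Suc i)} t :: real)" if "i < N" for i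
      using o[OF that] t by (auto simp: cl_def split: split_indicator)
    then show ?thesis
      unfolding simple_proc_def
      by (subst sum.lessThan_Suc_shift, subst sum.lessThan_Suc) (auto simp: \<eta>'_def \<tau>'_def intro!: sum.cong)
  qed
  ultimately show ?thesis by (rule that)
qed

text \<open>Clamped to an interval within cell i, every other cell collapses to one of the two end
  points.\<close>

lemma simple_integral_on_cell:
  assumes s: "simple_adapted Fil T N \<tau> (\<lambda>i \<omega>. \<eta> i)" and T: "T \<le> Tb" and i: "i < N" "\<tau> i \<le> s" "s \<le> t" "t \<le> \<tau> (Suc i)"
  shows "simple_integral_wrt W N \<tau> (\<lambda>i \<omega>. \<eta> i) t \<omega> - simple_integral_wrt W N \<tau> (\<lambda>i \<omega>. \<eta> i) s \<omega> = \<eta> i \<bullet> (W t \<omega> - W s \<omega>)"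
proof -
  note o = simple_adapted_term(2)[OF s T]
  have z: "\<eta> j \<bullet> (W (max s (min t (\<tau> (Suc j)))) \<omega> - W (max s (min t (\<tau> j))) \<omega>) = 0" if "j < N" "j \<noteq> i" for j
  proof (cases "j < i")
    case True
    then have "\<tau> (Suc j) \<le> \<tau> i" "\<tau> j \<le> \<tau> (Suc j)"
      using i that by (auto intro!: o partition_mono[of N \<tau>, OF o])
    then have "max s (min t (\<tau> (Suc j))) = s" "max s (min t (\<tau> j)) = s" using i by auto
    then show ?thesis by simp
  next
    case False
    then have "\<tau> (Suc i) \<le> \<tau> j" "\<tau> j \<le> \<tau> (Suc j)"
      using i that by (auto intro!: o partition_mono[of N \<tau>, OF o])
    then have "max s (min t (\<tau> (Suc j))) = t" "max s (min t (\<tau> j)) = t" using i by auto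
    then show ?thesis by simp
  qed
  have "simple_integral_wrt W N \<tau> (\<lambda>i \<omega>. \<eta> i) t \<omega> - simple_integral_wrt W N \<tau> (\<lambda>i \<omega>. \<eta> i) s \<omega>
     = (\<Sum>j\<in>{i}. \<eta> j \<bullet> (W (max s (min t (\<tau> (Suc j)))) \<omega> - W (max s (min t (\<tau> j))) \<omega>))"
    unfolding simple_increment_clamp[OF i(3)] using i(1) z by (intro sum.mono_neutral_right) auto
  also have "\<dots> = \<eta> i \<bullet> (W t \<omega> - W s \<omega>)"
  proof -
    have "max s (min t (\<tau> (Suc i))) = t" "max s (min t (\<tau> i)) = s" using i by auto
    then show ?thesis by simp
  qed
  finally show ?thesis .
qed

lemma refine_cell:
  fixes \<eta> :: "nat \<Rightarrow> real^'n"
  assumes s: "simple_adapted Fil T N \<tau> (\<lambda>i \<omega>. \<eta> i)" "\<tau> 0 = 0" "\<tau> N = T" and T: "T \<le> Tb" and r: "0 < r"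
  shows "q < N * r \<Longrightarrow> q div r < N"
    and "q < N * r \<Longrightarrow> \<tau> (q div r) \<le> refine \<tau> r q"
    and "q < N * r \<Longrightarrow> refine \<tau> r q \<le> refine \<tau> r (Suc q)"
    and "q < N * r \<Longrightarrow> refine \<tau> r (Suc q) \<le> \<tau> (Suc (q div r))"
    and "q < N * r \<Longrightarrow> refine \<tau> r (Suc q) - refine \<tau> r q \<le> T / real r"
    and "refine \<tau> r 0 = 0" "refine \<tau> r (N * r) = T"
    and "q \<le> N * r \<Longrightarrow> 0 \<le> refine \<tau> r q" "q \<le> N * r \<Longrightarrow> refine \<tau> r q \<le> T"
proof -
  note st = simple_adapted_term(1-3)[OF s(1) T]
  show div: "q div r < N" if "q < N * r" for q using that by (simp add: less_mult_imp_div_less)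
  note b = refine_bounds[OF r st(2)[OF div]]
  show "\<tau> (q div r) \<le> refine \<tau> r q" "refine \<tau> r (Suc q) \<le> \<tau> (Suc (q div r))" if "q < N * r"
    using b[OF that] by auto
  show mono: "refine \<tau> r q \<le> refine \<tau> r (Suc q)" if "q < N * r" for q using b(2)[OF that] .
  show "refine \<tau> r (Suc q) - refine \<tau> r q \<le> T / real r" if "q < N * r"
    unfolding b(4)[OF that] using st[OF div[OF that]] by (intro divide_right_mono) auto
  show ends: "refine \<tau> r 0 = 0" "refine \<tau> r (N * r) = T" using refine_ends[OF r, of \<tau>] s by auto
  show "0 \<le> refine \<tau> r q" "refine \<tau> r q \<le> T" if "q \<le> N * r"
    using partition_mono[of "N * r" "refine \<tau> r" 0 q, OF mono] partition_mono[of "N * r" "refine \<tau> r" q "N * r", OF mono]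
      that ends by auto
qed

lemma AE_time_prod_snd:
  assumes "N \<in> null_sets M"
  shows "AE p in time_prod T. snd p \<notin> N"
proof (rule AE_I')
  have N: "N \<in> sets M" "emeasure M N = 0" using assms by auto
  let ?A = "space (restrict_space lborel {0..T}) \<times> N"
  have sp: "space (restrict_space lborel {0..T}) \<in> sets (restrict_space lborel {0..T})" by (rule sets.top)
  have "emeasure (time_prod T) ?A = emeasure (restrict_space lborel {0..T}) (space (restrict_space lborel {0..T})) * emeasure M N"
    by (rule emeasure_pair_measure_Times[OF sp N(1)])
  then show "?A \<in> null_sets (time_prod T)" using N pair_measureI[OF sp N(1)] by (intro null_setsI) (simp_all only: mult_zero_right)
  show "{p \<in> space (time_prod T). \<not> snd p \<notin> N} \<subseteq> ?A" by (auto simp: space_pair_measure)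
qed

end

section \<open>Joint measurability and the total hedging error on a partition\<close>

context gauss_price
begin

text \<open>On a continuous path \<open>Z\<close> is the limit of its values at the grid times floor
  (t (n + 1)) / (n + 1), and each approximation is measurable because it selects among countably
  many variables. The remaining paths are multiplied by zero.\<close>

lemma Z_joint:
  obtains N where "N \<in> null_sets M" "(\<lambda>p. indicator (space M - N) (snd p) * Z (fst p) (snd p)) \<in> borel_measurable (time_prod T)"
    "\<And>\<omega>. \<omega> \<in> space M - N \<Longrightarrow> continuous_on {0..T} (\<lambda>t. Z t \<omega>)"
proof -
  have "AE \<omega> in M. continuous_on {0..U} (\<lambda>t. X t \<omega>)" using ito by (simp add: has_ito_integral_def)
  then obtain N where N: "N \<in> null_sets M" "{\<omega> \<in> space M. \<not> continuous_on {0..U} (\<lambda>t. X t \<omega>)} \<subseteq> N"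
    unfolding eventually_ae_filter by auto
  have cont: "continuous_on {0..T} (\<lambda>t. Z t \<omega>)" if "\<omega> \<in> space M - N" for \<omega>
  proof -
    have "continuous_on {0..U} (\<lambda>t. X t \<omega>)" using N that by auto
    then have "continuous_on {0..T} (\<lambda>t. X t \<omega>)" by (rule continuous_on_subset) (use T in auto)
    then have "continuous_on {0..T} (\<lambda>t. Z 0 \<omega> + X t \<omega>)" by (intro continuous_intros)
    then show ?thesis by (rule continuous_on_eq) (rule Z[symmetric])
  qed
  \<comment> \<open>The clamp makes \<open>Z\<close> at the grid time measurable for every integer
    index, also outside the range reached by t.\<close>
  define cl where "cl x = max 0 (min T x)" for x
  define g where "g n t = cl (real_of_int \<lfloor>t * real (Suc n)\<rfloor> / real (Suc n))" for n t
  have [measurable]: "(\<lambda>x. x) \<in> borel_measurable (restrict_space lborel {0..T})"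
    by (rule measurable_restrict_space1) simp
  have [measurable]: "N \<in> sets M" using N(1) by auto
  have gm: "(\<lambda>p. indicator (space M - N) (snd p) * Z (g n (fst p)) (snd p)) \<in> borel_measurable (time_prod T)" for n
  proof -
    have [measurable]: "Z (cl x) \<in> borel_measurable M" for x using T by (intro Z_meas) (auto simp: cl_def)
    have "(\<lambda>p. (\<lambda>i p. indicator (space M - N) (snd p) * Z (cl (real_of_int i / real (Suc n))) (snd p)) \<lfloor>fst p * real (Suc n)\<rfloor> p)
      \<in> borel_measurable (time_prod T)"
      by (rule measurable_compose_countable[where f="\<lambda>i p. indicator (space M - N) (snd p) * Z (cl (real_of_int i / real (Suc n))) (snd p)"])
         measurable
    then show ?thesis by (simp add: g_def)
  qed
  have "(\<lambda>p. indicator (space M - N) (snd p) * Z (fst p) (snd p)) \<in> borel_measurable (time_prod T)"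
  proof (rule borel_measurable_LIMSEQ_real[OF _ gm])
    fix p assume p: "p \<in> space (time_prod T)"
    then have t: "fst p \<in> {0..T}" and \<omega>: "snd p \<in> space M" by (auto simp: space_pair_measure space_restrict_space)
    show "(\<lambda>n. indicator (space M - N) (snd p) * Z (g n (fst p)) (snd p)) \<longlonglongrightarrow> indicator (space M - N) (snd p) * Z (fst p) (snd p)"
    proof (cases "snd p \<in> N")
      case False
      have "(\<lambda>n. g n (fst p)) \<longlonglongrightarrow> fst p"
      proof -
        let ?h = "\<lambda>n. real_of_int \<lfloor>fst p * real (Suc n)\<rfloor> / real (Suc n)"
        have b: "norm (?h n - fst p) \<le> inverse (real (Suc n))" for n
        proof -
          have "\<bar>real_of_int \<lfloor>fst p * real (Suc n)\<rfloor> - fst p * real (Suc n)\<bar> \<le> 1" by linarith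
          then have "\<bar>real_of_int \<lfloor>fst p * real (Suc n)\<rfloor> - fst p * real (Suc n)\<bar> / real (Suc n) \<le> 1 / real (Suc n)"
            by (rule divide_right_mono) simp
          moreover have "\<bar>real_of_int \<lfloor>fst p * real (Suc n)\<rfloor> - fst p * real (Suc n)\<bar> / real (Suc n) = \<bar>?h n - fst p\<bar>"
          proof -
            have "?h n - fst p = (real_of_int \<lfloor>fst p * real (Suc n)\<rfloor> - fst p * real (Suc n)) / real (Suc n)"
              by (simp add: diff_divide_distrib del: of_nat_Suc)
            then show ?thesis by (simp add: abs_divide del: of_nat_Suc)
          qed
          ultimately show ?thesis by (simp add: inverse_eq_divide)
        qed
        have "(\<lambda>n. ?h n - fst p) \<longlonglongrightarrow> 0"
          by (rule Lim_null_comparison[OF always_eventually LIMSEQ_inverse_real_of_nat]) (use b in blast)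
        then have "?h \<longlonglongrightarrow> fst p" by (rule LIM_zero_cancel)
        then have "(\<lambda>n. g n (fst p)) \<longlonglongrightarrow> cl (fst p)"
          unfolding g_def cl_def by (intro tendsto_intros)
        then show ?thesis using t by (simp add: cl_def)
      qed
      moreover have "g n (fst p) \<in> {0..T}" for n using T by (auto simp: g_def cl_def)
      ultimately have "(\<lambda>n. Z (g n (fst p)) (snd p)) \<longlonglongrightarrow> Z (fst p) (snd p)"
        using continuous_on_tendsto_compose[OF cont[of "snd p"], of "\<lambda>n. g n (fst p)" "fst p" sequentially] False \<omega> t by auto
      then show ?thesis by (intro tendsto_intros)
    qed simp
  qed
  with N(1) show ?thesis using cont by (rule that)
qed

text \<open>Price and forward are both martingales, so the cell errors are martingale differences
  and their second moments add up.\<close>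

lemma hedging_error_sum:
  assumes p: "\<And>q. q < n \<Longrightarrow> p q \<le> p (Suc q)" "p 0 = 0" "p n \<le> T"
    and \<mu>: "\<And>q. q < n \<Longrightarrow> rv (p q) - rv (p (Suc q)) \<le> \<mu>" "0 \<le> \<mu>" and \<epsilon>: "0 < \<epsilon>"
  defines "E \<equiv> (\<lambda>\<omega>. \<Sum>q<n. price \<epsilon> (p (Suc q)) \<omega> - price \<epsilon> (p q) \<omega> - delta \<epsilon> (p q) \<omega> * (Z (p (Suc q)) \<omega> - Z (p q) \<omega>))"
  shows "integrable M (\<lambda>\<omega>. (E \<omega>)\<^sup>2)" "(\<integral>\<omega>. (E \<omega>)\<^sup>2 \<partial>M) \<le> 32 / \<epsilon>\<^sup>2 * (\<mu> * rv 0)"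
proof -
  define D where "D q \<omega> = price \<epsilon> (p (Suc q)) \<omega> - price \<epsilon> (p q) \<omega> - delta \<epsilon> (p q) \<omega> * (Z (p (Suc q)) \<omega> - Z (p q) \<omega>)" for q \<omega>
  have range: "0 \<le> p q" "p q \<le> T" if "q \<le> n" for q
    using partition_mono[of n p 0 q, OF p(1)] partition_mono[of n p q n, OF p(1)] that p(2,3) by auto
  have o: "0 \<le> p q \<and> p q \<le> p (Suc q) \<and> p (Suc q) \<le> T" if "q < n" for q
    using range[of q] range[of "Suc q"] p(1)[OF that] that by auto
  have o': "0 \<le> p q \<and> p q \<le> p (Suc q) \<and> p (Suc q) \<le> Tb" if "q < n" for q
    using o[OF that] T U by auto
  have fil: "D q \<in> borel_measurable (Fil (p (Suc q)))" if q: "q < n" for q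
  proof -
    have i: "p q \<in> {0..T}" "p (Suc q) \<in> {0..T}" using o[OF q] by auto
    have up: "f \<in> borel_measurable (Fil (p q)) \<Longrightarrow> f \<in> borel_measurable (Fil (p (Suc q)))" for f :: "'a \<Rightarrow> real"
      by (rule fil_measurable_mono) (use o'[OF q] in blast)+
    note [measurable] = up[OF price_fil[OF i(1)]] up[OF delta_fil[OF i(1)]] up[OF Z_fil[OF i(1)]] price_fil[OF i(2)] Z_fil[OF i(2)]
    show ?thesis unfolding D_def[abs_def] by measurable
  qed
  have D2: "integrable M (\<lambda>\<omega>. (D q \<omega>)\<^sup>2)" "(\<integral>\<omega>. (D q \<omega>)\<^sup>2 \<partial>M) \<le> 32 / \<epsilon>\<^sup>2 * (rv (p q) - rv (p (Suc q)))\<^sup>2" if "q < n" for q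
    unfolding D_def using hedging_error_L2[of "p q" "p (Suc q)" \<epsilon>] o[OF that] \<epsilon> by auto
  have orth: "(\<integral>\<omega>. G \<omega> * D q \<omega> \<partial>M) = 0"
    if q: "q < n" and G: "G \<in> borel_measurable (Fil (p q))" "integrable M (\<lambda>\<omega>. (G \<omega>)\<^sup>2)" for q and G :: "'a \<Rightarrow> real"
  proof -
    have i: "p q \<in> {0..T}" "p (Suc q) \<in> {0..T}" "p q \<in> {0..Tb}" "p (Suc q) \<in> {0..Tb}" using o[OF q] o'[OF q] by auto
    have Gd: "(\<lambda>\<omega>. G \<omega> * delta \<epsilon> (p q) \<omega>) \<in> borel_measurable (Fil (p q))" using G(1) delta_fil[OF i(1)] by measurable
    have Gd2: "integrable M (\<lambda>\<omega>. (G \<omega> * delta \<epsilon> (p q) \<omega>)\<^sup>2)"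
    proof (rule Bochner_Integration.integrable_bound[OF G(2)])
      show "(\<lambda>\<omega>. (G \<omega> * delta \<epsilon> (p q) \<omega>)\<^sup>2) \<in> borel_measurable M"
        by (intro borel_measurable_power fil_measurable[OF Gd] i)
      have "(delta \<epsilon> (p q) \<omega>)\<^sup>2 \<le> 1" for \<omega> using delta_bounds(3)[of \<epsilon> "p q" \<omega>] by (simp add: abs_square_le_1)
      then show "AE \<omega> in M. norm ((G \<omega> * delta \<epsilon> (p q) \<omega>)\<^sup>2) \<le> norm ((G \<omega>)\<^sup>2)"
        by (simp add: power_mult_distrib mult_right_le_one_le)
    qed
    have m: "G \<in> borel_measurable M" "(\<lambda>\<omega>. price \<epsilon> (p (Suc q)) \<omega> - price \<epsilon> (p q) \<omega>) \<in> borel_measurable M"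
      "(\<lambda>\<omega>. G \<omega> * delta \<epsilon> (p q) \<omega>) \<in> borel_measurable M" "(\<lambda>\<omega>. X (p (Suc q)) \<omega> - X (p q) \<omega>) \<in> borel_measurable M"
      using fil_measurable[OF G(1) i(3)] fil_measurable[OF Gd i(3)] price_meas[OF i(1), of \<epsilon>] price_meas[OF i(2), of \<epsilon>]
        fil_measurable[OF X_meas[OF i(1)] i(3)] fil_measurable[OF X_meas[OF i(2)] i(4)] by auto
    have m2: "integrable M (\<lambda>\<omega>. (price \<epsilon> (p (Suc q)) \<omega> - price \<epsilon> (p q) \<omega>)\<^sup>2)"
      "integrable M (\<lambda>\<omega>. (X (p (Suc q)) \<omega> - X (p q) \<omega>)\<^sup>2)"
      using integrable_add_L2[of "price \<epsilon> (p (Suc q))" M "\<lambda>\<omega>. - price \<epsilon> (p q) \<omega>"] price_meas[OF i(1), of \<epsilon>] price_meas[OF i(2), of \<epsilon>]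
        price_L2[OF i(1), of \<epsilon>] price_L2[OF i(2), of \<epsilon>]
        integrable_add_L2[of "X (p (Suc q))" M "\<lambda>\<omega>. - X (p q) \<omega>"] X_L2[OF i(1)] X_L2[OF i(2)]
        fil_measurable[OF X_meas[OF i(1)] i(3)] fil_measurable[OF X_meas[OF i(2)] i(4)] by auto
    have "(\<integral>\<omega>. G \<omega> * D q \<omega> \<partial>M) = (\<integral>\<omega>. G \<omega> * (price \<epsilon> (p (Suc q)) \<omega> - price \<epsilon> (p q) \<omega>)
        - (G \<omega> * delta \<epsilon> (p q) \<omega>) * (X (p (Suc q)) \<omega> - X (p q) \<omega>) \<partial>M)"
      unfolding D_def X_eq by (intro Bochner_Integration.integral_cong) (auto simp: algebra_simps)
    also have "\<dots> = (\<integral>\<omega>. G \<omega> * (price \<epsilon> (p (Suc q)) \<omega> - price \<epsilon> (p q) \<omega>) \<partial>M)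
        - (\<integral>\<omega>. (G \<omega> * delta \<epsilon> (p q) \<omega>) * (X (p (Suc q)) \<omega> - X (p q) \<omega>) \<partial>M)"
      by (rule Bochner_Integration.integral_diff) (auto intro!: integrable_mult_L2 m m2 G Gd2)
    also have "\<dots> = 0 - 0"
      using o[OF q] by (intro arg_cong2[where f=minus] price_orthogonal X_orthogonal G Gd Gd2) auto
    finally show ?thesis by simp
  qed
  note md = martingale_difference_sum[where n=n and p=p and D=D, OF o' fil D2(1) orth]
  show "integrable M (\<lambda>\<omega>. (E \<omega>)\<^sup>2)" using md unfolding E_def D_def by blast
  have "(\<integral>\<omega>. (E \<omega>)\<^sup>2 \<partial>M) = (\<Sum>q<n. \<integral>\<omega>. (D q \<omega>)\<^sup>2 \<partial>M)" using md unfolding E_def D_def by blast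
  \<comment> \<open>One factor of the squared variance increment is replaced by \<mu>; the other
    sums to at most the total variance \<open>rv 0\<close>.\<close>
  also have "\<dots> \<le> (\<Sum>q<n. 32 / \<epsilon>\<^sup>2 * (\<mu> * (rv (p q) - rv (p (Suc q)))))"
  proof (rule sum_mono)
    fix q assume "q \<in> {..<n}"
    then have q: "q < n" by simp
    have r: "0 \<le> rv (p q) - rv (p (Suc q))" using rv_antimono[of "p q" "p (Suc q)"] o[OF q] by auto
    have "(rv (p q) - rv (p (Suc q)))\<^sup>2 \<le> \<mu> * (rv (p q) - rv (p (Suc q)))"
      unfolding power2_eq_square by (rule mult_right_mono[OF \<mu>(1)[OF q] r])
    then have "32 / \<epsilon>\<^sup>2 * (rv (p q) - rv (p (Suc q)))\<^sup>2 \<le> 32 / \<epsilon>\<^sup>2 * (\<mu> * (rv (p q) - rv (p (Suc q))))"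
      by (rule mult_left_mono) simp
    with D2(2)[OF q] show "(\<integral>\<omega>. (D q \<omega>)\<^sup>2 \<partial>M) \<le> 32 / \<epsilon>\<^sup>2 * (\<mu> * (rv (p q) - rv (p (Suc q))))" by linarith
  qed
  also have "\<dots> = 32 / \<epsilon>\<^sup>2 * (\<mu> * (rv 0 - rv (p n)))"
    unfolding sum_distrib_left[symmetric] using sum_lessThan_telescope'[of "\<lambda>q. rv (p q)" n] p(2) by simp
  also have "\<dots> \<le> 32 / \<epsilon>\<^sup>2 * (\<mu> * rv 0)"
    using rv_nonneg[of "p n"] \<mu>(2) by (intro mult_left_mono) auto
  finally show "(\<integral>\<omega>. (E \<omega>)\<^sup>2 \<partial>M) \<le> 32 / \<epsilon>\<^sup>2 * (\<mu> * rv 0)" .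
qed

text \<open>The price of trading the step integral instead of the forward: \<open>Y\<close> is a
  martingale and the delta is a weight between 0 and 1, so the transform bound applies for every
  partition.\<close>

lemma replication_error:
  fixes \<eta> :: "nat \<Rightarrow> real^'n"
  assumes s: "simple_adapted Fil T N \<tau> (\<lambda>i \<omega>. \<eta> i)"
    and p: "\<And>q. q < n \<Longrightarrow> p q \<le> p (Suc q)" "p 0 = 0" "p n \<le> T"
  defines "Y \<equiv> (\<lambda>t \<omega>. simple_integral_wrt W N \<tau> (\<lambda>i \<omega>. \<eta> i) t \<omega> - X t \<omega>)"
  shows "integrable M (\<lambda>\<omega>. (\<Sum>q<n. delta \<epsilon> (p q) \<omega> * (Y (p (Suc q)) \<omega> - Y (p q) \<omega>))\<^sup>2)"
    and "(\<integral>\<omega>. (\<Sum>q<n. delta \<epsilon> (p q) \<omega> * (Y (p (Suc q)) \<omega> - Y (p q) \<omega>))\<^sup>2 \<partial>M) \<le> (\<integral>\<omega>. (Y T \<omega>)\<^sup>2 \<partial>M)"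
proof -
  let ?S = "simple_integral_wrt W N \<tau> (\<lambda>i \<omega>. \<eta> i)"
  have TTb: "T \<le> Tb" using T U by simp
  note sp = simple_integral_props[OF s TTb]
  have range: "0 \<le> p q" "p q \<le> T" if "q \<le> n" for q
    using partition_mono[of n p 0 q, OF p(1)] partition_mono[of n p q n, OF p(1)] that p(2,3) by auto
  have o: "0 \<le> p q \<and> p q \<le> p (Suc q) \<and> p (Suc q) \<le> T" if "q < n" for q
    using range[of q] range[of "Suc q"] p(1)[OF that] that by auto
  have XM: "X t \<in> borel_measurable M" if "t \<in> {0..T}" for t
    using fil_measurable[OF X_meas[OF that]] that TTb by auto
  have Yfil: "Y t \<in> borel_measurable (Fil t)" if "t \<in> {0..T}" for t
    unfolding Y_def using sp(1)[OF that] X_meas[OF that] by measurable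
  have Y2: "integrable M (\<lambda>\<omega>. (Y t \<omega>)\<^sup>2)" if "t \<in> {0..T}" for t
    unfolding Y_def using integrable_add_L2[of "?S t" M "\<lambda>\<omega>. - X t \<omega>"] sp(2,3)[of t] XM[OF that] X_L2[OF that] by simp
  have orth: "(\<integral>\<omega>. G \<omega> * (Y t \<omega> - Y s \<omega>) \<partial>M) = 0"
    if st: "0 \<le> s" "s \<le> t" "t \<le> T" and G: "G \<in> borel_measurable (Fil s)" "integrable M (\<lambda>\<omega>. (G \<omega>)\<^sup>2)" for s t and G :: "'a \<Rightarrow> real"
  proof -
    have GM: "G \<in> borel_measurable M" using fil_measurable[OF G(1)] st TTb by auto
    then have Gi: "integrable M G" using abs_expectation_le_L2(1) G(2) by blast
    note g1 = gauss_indep_mult_moments[OF deterministic_simple_gauss_indep(1)[OF s TTb st] G(1) Gi]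
    note g2 = gauss_indep_mult_moments[OF Z_incr[OF st] G(1) Gi]
    have "(\<integral>\<omega>. G \<omega> * (Y t \<omega> - Y s \<omega>) \<partial>M) = (\<integral>\<omega>. G \<omega> * (?S t \<omega> - ?S s \<omega>) - G \<omega> * (Z t \<omega> - Z s \<omega>) \<partial>M)"
      unfolding Y_def X_eq by (intro Bochner_Integration.integral_cong) (auto simp: algebra_simps)
    also have "\<dots> = 0" using g1(1,2) g2(1,2) by simp
    finally show ?thesis .
  qed
  have c: "\<And>q. q < n \<Longrightarrow> delta \<epsilon> (p q) \<in> borel_measurable (Fil (p q))"
    using range less_imp_le by (intro delta_fil) (simp only: atLeastAtMost_iff)
  note b = martingale_transform_bound[where n=n and p=p and S=T and Y=Y and c="\<lambda>q. delta \<epsilon> (p q)", OF o TTb Yfil Y2 orth c delta_bounds(3)]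
  show "integrable M (\<lambda>\<omega>. (\<Sum>q<n. delta \<epsilon> (p q) \<omega> * (Y (p (Suc q)) \<omega> - Y (p q) \<omega>))\<^sup>2)"
    by (rule b(1))
  have Y0: "Y 0 \<omega> = 0" for \<omega>
  proof -
    have "simple_integral_wrt W N \<tau> (\<lambda>i \<omega>. \<eta> i) 0 \<omega> = 0"
      unfolding simple_integral_wrt_def
    proof (rule sum.neutral, rule ballI)
      fix i assume "i \<in> {..<N}"
      then have "0 \<le> \<tau> i" "\<tau> i \<le> \<tau> (Suc i)" using simple_adapted_term(1,2)[OF s TTb] by auto
      then show "\<eta> i \<bullet> (W (min 0 (\<tau> (Suc i))) \<omega> - W (min 0 (\<tau> i)) \<omega>) = 0" by simp
    qed
    then show ?thesis by (simp add: Y_def X0)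
  qed
  \<comment> \<open>The transform bound on the partition 0, p n, T with weights 1 and 0 shows that
    the second moment of \<open>Y\<close> increases in time.\<close>
  define p2 where "p2 = (\<lambda>i::nat. if i = 0 then 0 else if i = 1 then p n else T)"
  define c2 :: "nat \<Rightarrow> 'a \<Rightarrow> real" where "c2 = (\<lambda>i \<omega>. if i = 0 then 1 else 0)"
  have o2: "0 \<le> p2 q \<and> p2 q \<le> p2 (Suc q) \<and> p2 (Suc q) \<le> T" for q
    using range[of n] T by (auto simp: p2_def)
  have "(\<integral>\<omega>. (\<Sum>q<2. c2 q \<omega> * (Y (p2 (Suc q)) \<omega> - Y (p2 q) \<omega>))\<^sup>2 \<partial>M) \<le> (\<integral>\<omega>. (Y (p2 2) \<omega> - Y (p2 0) \<omega>)\<^sup>2 \<partial>M)"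
    by (rule martingale_transform_bound(2)[where S=T and n=2 and p=p2 and Y=Y and c=c2, OF o2 TTb Yfil Y2 orth]) (auto simp: c2_def)
  then have YT: "(\<integral>\<omega>. (Y (p n) \<omega>)\<^sup>2 \<partial>M) \<le> (\<integral>\<omega>. (Y T \<omega>)\<^sup>2 \<partial>M)"
    by (simp add: c2_def p2_def Y0 numeral_2_eq_2)
  have "(\<integral>\<omega>. (\<Sum>q<n. delta \<epsilon> (p q) \<omega> * (Y (p (Suc q)) \<omega> - Y (p q) \<omega>))\<^sup>2 \<partial>M) \<le> (\<integral>\<omega>. (Y (p n) \<omega> - Y (p 0) \<omega>)\<^sup>2 \<partial>M)"
    by (rule b(2))
  also have "\<dots> = (\<integral>\<omega>. (Y (p n) \<omega>)\<^sup>2 \<partial>M)" by (simp only: p(2) Y0 diff_zero)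
  also note YT
  finally show "(\<integral>\<omega>. (\<Sum>q<n. delta \<epsilon> (p q) \<omega> * (Y (p (Suc q)) \<omega> - Y (p q) \<omega>))\<^sup>2 \<partial>M) \<le> (\<integral>\<omega>. (Y T \<omega>)\<^sup>2 \<partial>M)" .
qed

text \<open>The strategy \<xi> is the delta at the left end of each refined cell times the step
  value of the kernel on the coarse cell. Its gain minus the price change splits into the transform
  of \<open>Y\<close>, bounded by the kernel error, and the hedging error, bounded by the
  mesh.\<close>

lemma smoothed_replication:
  assumes \<epsilon>: "0 < \<epsilon>"
    and s: "simple_adapted Fil T N \<tau> (\<lambda>i \<omega>. \<eta> i)" "\<tau> 0 = 0" "\<tau> N = T"
    and r: "0 < r"
    and \<mu>: "\<And>s t. 0 \<le> s \<Longrightarrow> s \<le> t \<Longrightarrow> t \<le> T \<Longrightarrow> t - s \<le> T / real r \<Longrightarrow> rv s - rv t \<le> \<mu>"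
    and t: "t \<in> {0..T}"
  defines "\<xi> \<equiv> (\<lambda>q \<omega>. delta \<epsilon> (refine \<tau> r q) \<omega> *\<^sub>R \<eta> (q div r))"
  shows "simple_adapted Fil T (N * r) (refine \<tau> r) \<xi>"
    and "(\<integral>\<^sup>+\<omega>. ennreal ((simple_integral_wrt W (N * r) (refine \<tau> r) \<xi> t \<omega> - (price \<epsilon> t \<omega> - price \<epsilon> 0 \<omega>))\<^sup>2) \<partial>M)
      \<le> ennreal (2 * (\<integral>\<omega>. (simple_integral_wrt W N \<tau> (\<lambda>i \<omega>. \<eta> i) T \<omega> - X T \<omega>)\<^sup>2 \<partial>M) + 2 * (32 / \<epsilon>\<^sup>2 * (\<mu> * rv 0)))"
proof -
  have TTb: "T \<le> Tb" using T U by simp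
  let ?p = "refine \<tau> r" and ?n = "N * r"
  note rc = refine_cell[OF s TTb r]
  note div = rc(1) and cell = rc(2-5) and p0 = rc(6) and pn = rc(7) and range = rc(8,9)
  show "simple_adapted Fil T ?n ?p \<xi>"
    unfolding simple_adapted_def
  proof (intro allI impI conjI)
    fix q assume q: "q < ?n"
    show "0 \<le> ?p q" "?p q \<le> ?p (Suc q)" "?p (Suc q) \<le> T" using cell[OF q] range[of q] range[of "Suc q"] q by auto
    have "delta \<epsilon> (?p q) \<in> borel_measurable (Fil (?p q))" using range[of q] q by (intro delta_fil) auto
    then show "\<xi> q \<in> borel_measurable (Fil (?p q))" unfolding \<xi>_def by measurable
    have "norm (\<xi> q \<omega>) \<le> norm (\<eta> (q div r))" for \<omega>
      unfolding \<xi>_def using delta_bounds(3)[of \<epsilon> "?p q" \<omega>] by (simp add: mult_left_le_one_le)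
    then show "\<exists>B. \<forall>\<omega>\<in>space (Fil (?p q)). norm (\<xi> q \<omega>) \<le> B" by blast
  qed
  let ?S = "simple_integral_wrt W N \<tau> (\<lambda>i \<omega>. \<eta> i)"
  \<comment> \<open>Stopping the refined partition at t lets the estimates for whole partitions
    serve every intermediate time.\<close>
  define p where "p q = min t (?p q)" for q
  define Y where "Y u \<omega> = ?S u \<omega> - X u \<omega>" for u \<omega>
  have pp: "p q \<le> p (Suc q)" if "q < ?n" for q using cell[OF that] by (auto simp: p_def)
  have pe: "p 0 = 0" "p ?n = t" using p0 pn t by (auto simp: p_def)
  have p\<mu>: "rv (p q) - rv (p (Suc q)) \<le> \<mu>" if "q < ?n" for q
    using cell[OF that] range[of q] range[of "Suc q"] that t by (intro \<mu>) (auto simp: p_def)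
  have step: "\<xi> q \<omega> \<bullet> (W (min t (?p (Suc q))) \<omega> - W (min t (?p q)) \<omega>) = delta \<epsilon> (p q) \<omega> * (?S (p (Suc q)) \<omega> - ?S (p q) \<omega>)"
    if q: "q < ?n" for q \<omega>
  proof (cases "t \<le> ?p q")
    \<comment> \<open>Beyond t both end points are t, so the two sides vanish, whichever delta is
      written in front.\<close>
    case True
    then have "min t (?p (Suc q)) = t" "min t (?p q) = t" using cell(2)[OF q] by auto
    then show ?thesis by (simp add: p_def)
  next
    case False
    then have "p q = ?p q" "p (Suc q) = min t (?p (Suc q))" "p q \<le> p (Suc q)" using pp[OF q] by (auto simp: p_def)
    moreover have "?S (p (Suc q)) \<omega> - ?S (p q) \<omega> = \<eta> (q div r) \<bullet> (W (p (Suc q)) \<omega> - W (p q) \<omega>)"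
      using cell[OF q] False by (intro simple_integral_on_cell[OF s(1) TTb div[OF q]] pp q) (auto simp: p_def)
    ultimately show ?thesis by (simp add: \<xi>_def)
  qed
  let ?A = "\<lambda>\<omega>. \<Sum>q<?n. delta \<epsilon> (p q) \<omega> * (Y (p (Suc q)) \<omega> - Y (p q) \<omega>)"
  let ?E = "\<lambda>\<omega>. \<Sum>q<?n. price \<epsilon> (p (Suc q)) \<omega> - price \<epsilon> (p q) \<omega> - delta \<epsilon> (p q) \<omega> * (Z (p (Suc q)) \<omega> - Z (p q) \<omega>)"
  \<comment> \<open>Insert the delta-weighted increments of the forward: they turn the gain into
    \<open>?A\<close> and the telescoped price change into \<open>?E\<close>.\<close>
  have eq: "simple_integral_wrt W ?n ?p \<xi> t \<omega> - (price \<epsilon> t \<omega> - price \<epsilon> 0 \<omega>) = ?A \<omega> - ?E \<omega>" for \<omega>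
  proof -
    have "price \<epsilon> t \<omega> - price \<epsilon> 0 \<omega> = (\<Sum>q<?n. price \<epsilon> (p (Suc q)) \<omega> - price \<epsilon> (p q) \<omega>)"
      using sum_lessThan_telescope[of "\<lambda>q. price \<epsilon> (p q) \<omega>" ?n] pe by simp
    moreover have "simple_integral_wrt W ?n ?p \<xi> t \<omega> = (\<Sum>q<?n. delta \<epsilon> (p q) \<omega> * (?S (p (Suc q)) \<omega> - ?S (p q) \<omega>))"
      unfolding simple_integral_wrt_def[of W "N * r"] by (intro sum.cong refl step) simp
    ultimately show ?thesis
      unfolding Y_def X_eq
      by (simp only: sum_subtractf[symmetric]) (intro sum.cong refl, simp add: algebra_simps)
  qed
  have pT: "p ?n \<le> T" using pe t by simp
  note A = replication_error[where \<epsilon>=\<epsilon> and n="N * r" and p=p, OF s(1) pp pe(1) pT, folded Y_def]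
  have "0 \<le> \<mu>" using \<mu>[of 0 0] T by simp
  note E = hedging_error_sum[where n="N * r" and p=p, OF pp pe(1) pT p\<mu> this \<epsilon>]
  have A2: "integrable M (\<lambda>\<omega>. (?A \<omega>)\<^sup>2)" "(\<integral>\<omega>. (?A \<omega>)\<^sup>2 \<partial>M) \<le> (\<integral>\<omega>. (Y T \<omega>)\<^sup>2 \<partial>M)" using A by simp_all
  have E2: "integrable M (\<lambda>\<omega>. (?E \<omega>)\<^sup>2)" "(\<integral>\<omega>. (?E \<omega>)\<^sup>2 \<partial>M) \<le> 32 / \<epsilon>\<^sup>2 * (\<mu> * rv 0)" using E by simp_all
  have pt: "(?A \<omega> - ?E \<omega>)\<^sup>2 \<le> 2 * (?A \<omega>)\<^sup>2 + 2 * (?E \<omega>)\<^sup>2" for \<omega>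
  proof -
    have "(a - b)\<^sup>2 \<le> 2 * a\<^sup>2 + 2 * b\<^sup>2" for a b :: real
      using zero_le_power2[of "a + b"] by (simp add: power2_sum power2_diff)
    then show ?thesis .
  qed
  have "(\<integral>\<^sup>+\<omega>. ennreal ((?A \<omega> - ?E \<omega>)\<^sup>2) \<partial>M) \<le> (\<integral>\<^sup>+\<omega>. ennreal (2 * (?A \<omega>)\<^sup>2 + 2 * (?E \<omega>)\<^sup>2) \<partial>M)"
    by (intro nn_integral_mono ennreal_leI pt)
  also have "\<dots> = ennreal (\<integral>\<omega>. 2 * (?A \<omega>)\<^sup>2 + 2 * (?E \<omega>)\<^sup>2 \<partial>M)"
    using A2(1) E2(1) by (intro nn_integral_eq_integral) auto
  also have "(\<integral>\<omega>. 2 * (?A \<omega>)\<^sup>2 + 2 * (?E \<omega>)\<^sup>2 \<partial>M) = 2 * (\<integral>\<omega>. (?A \<omega>)\<^sup>2 \<partial>M) + 2 * (\<integral>\<omega>. (?E \<omega>)\<^sup>2 \<partial>M)"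
    using A2(1) E2(1) by simp
  also have "ennreal \<dots> \<le> ennreal (2 * (\<integral>\<omega>. (Y T \<omega>)\<^sup>2 \<partial>M) + 2 * (32 / \<epsilon>\<^sup>2 * (\<mu> * rv 0)))"
    using A2(2) E2(2) by (intro ennreal_leI add_mono mult_left_mono) auto
  finally show "(\<integral>\<^sup>+\<omega>. ennreal ((simple_integral_wrt W ?n ?p \<xi> t \<omega> - (price \<epsilon> t \<omega> - price \<epsilon> 0 \<omega>))\<^sup>2) \<partial>M)
      \<le> ennreal (2 * (\<integral>\<omega>. (?S T \<omega> - X T \<omega>)\<^sup>2 \<partial>M) + 2 * (32 / \<epsilon>\<^sup>2 * (\<mu> * rv 0)))"
    unfolding eq Y_def .
qed

end

section \<open>The hedge ratio as an Ito integrand\<close>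

text \<open>Preimages under g differ from those under f by subsets of a null set, which the
  completion contains.\<close>

lemma borel_measurable_completion_AE:
  assumes f: "f \<in> borel_measurable M" and ae: "AE x in M. f x = g x"
  shows "g \<in> borel_measurable (completion M)"
proof (rule measurableI)
  fix A :: "'b set" assume A: "A \<in> sets borel"
  show "g -` A \<inter> space (completion M) \<in> sets (completion M)"
  proof (rule completion.in_sets_AE)
    have "AE x in M. x \<in> f -` A \<inter> space M \<longleftrightarrow> x \<in> g -` A \<inter> space (completion M)"
      using ae by eventually_elim simp
    then show "AE x in completion M. x \<in> f -` A \<inter> space M \<longleftrightarrow> x \<in> g -` A \<inter> space (completion M)"
      by (rule AE_completion)
    show "f -` A \<inter> space M \<in> sets (completion M)" using measurable_sets[OF f A] by simp
  qed auto
qed simp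

context gauss_price
begin

lemma k_T: "k \<in> borel_measurable (restrict_space lborel {0..T})"
proof -
  have "(\<lambda>u. indicator {0..U} u *\<^sub>R k u) \<in> borel_measurable lborel"
    using k by (subst (asm) borel_measurable_restrict_space_iff) auto
  then have "(\<lambda>u. indicator {0..T} u *\<^sub>R (indicator {0..U} u *\<^sub>R k u)) \<in> borel_measurable lborel"
    by measurable
  also have "(\<lambda>u. indicator {0..T} u *\<^sub>R (indicator {0..U} u *\<^sub>R k u)) = (\<lambda>u. indicator {0..T} u *\<^sub>R k u)"
    using T by (auto split: split_indicator)
  finally show ?thesis by (subst borel_measurable_restrict_space_iff) auto
qed

lemma nn_integral_k: "(\<integral>\<^sup>+t. ennreal ((norm (k t))\<^sup>2) \<partial>restrict_space lborel {0..T}) = ennreal (rv 0)"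
proof -
  have "(\<integral>\<^sup>+t. ennreal ((norm (k t))\<^sup>2) \<partial>restrict_space lborel {0..T}) = (\<integral>\<^sup>+t. ennreal (indicator {0..T} t *\<^sub>R (norm (k t))\<^sup>2) \<partial>lborel)"
    by (subst nn_integral_restrict_space) (auto intro!: nn_integral_cong split: split_indicator)
  also have "\<dots> = ennreal (rv 0)"
    unfolding rv_def set_lebesgue_integral_def using k2_sub[of 0 T] T
    by (intro nn_integral_eq_integral) (auto simp: set_integrable_def)
  finally show ?thesis .
qed

lemma time_prod_k: "(\<integral>\<^sup>+p. ennreal ((norm (k (fst p)))\<^sup>2) \<partial>time_prod T) = ennreal (rv 0)"
proof -
  note [measurable] = k_T
  have "(\<integral>\<^sup>+p. ennreal ((norm (k (fst p)))\<^sup>2) \<partial>time_prod T) = (\<integral>\<^sup>+t. ennreal ((norm (k t))\<^sup>2) \<partial>restrict_space lborel {0..T})"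
    by (rule time_prod_deterministic) measurable
  then show ?thesis by (simp add: nn_integral_k)
qed

lemma rv_measurable[measurable]: "rv \<in> borel_measurable (restrict_space lborel {0..T})"
proof -
  have "rv \<in> borel_measurable (restrict_space borel {0..T})"
    by (rule borel_measurable_continuous_on_restrict[OF rv_continuous])
  then show ?thesis by (simp cong: measurable_cong_sets add: sets_restrict_space_cong[OF sets_lborel])
qed

text \<open>Where \<open>rv t = 0\<close>, the division by zero gives the value \<open>1/2\<close>; this is harmless, as \<open>k\<close> vanishes
  almost everywhere there.\<close>

definition hedge_ratio :: "real \<Rightarrow> 'a \<Rightarrow> real" where
  "hedge_ratio t \<omega> = std_normal_cdf (Z t \<omega> / sqrt (rv t))"

text \<open>The paths of \<open>Z\<close> are continuous only almost surely, so processes built from \<open>Z\<close> are jointly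
  measurable only up to a null set of paths.\<close>

lemma masked_versions:
  obtains N mdelta mratio where "N \<in> null_sets M"
    and "\<And>\<epsilon>. mdelta \<epsilon> \<in> borel_measurable (time_prod T)" "mratio \<in> borel_measurable (time_prod T)"
    and "\<And>\<epsilon> t \<omega>. \<omega> \<in> space M - N \<Longrightarrow> mdelta \<epsilon> (t, \<omega>) = delta \<epsilon> t \<omega>"
    and "\<And>t \<omega>. \<omega> \<in> space M - N \<Longrightarrow> mratio (t, \<omega>) = hedge_ratio t \<omega>"
    and "\<And>\<omega>. \<omega> \<in> space M - N \<Longrightarrow> continuous_on {0..T} (\<lambda>t. Z t \<omega>)"
proof -
  from Z_joint obtain N where N: "N \<in> null_sets M"
    and [measurable]: "(\<lambda>p. indicator (space M - N) (snd p) * Z (fst p) (snd p)) \<in> borel_measurable (time_prod T)"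
    and cont: "\<And>\<omega>. \<omega> \<in> space M - N \<Longrightarrow> continuous_on {0..T} (\<lambda>t. Z t \<omega>)"
    by blast
  define mZ where "mZ p = indicator (space M - N) (snd p) * Z (fst p) (snd p)" for p
  have mZ[measurable]: "mZ \<in> borel_measurable (time_prod T)" unfolding mZ_def[abs_def] by measurable
  define mdelta where "mdelta \<epsilon> p = bachelier_delta (sqrt (rv (fst p) + \<epsilon>\<^sup>2)) (mZ p)" for \<epsilon> p
  define mratio where "mratio p = std_normal_cdf (mZ p / sqrt (rv (fst p)))" for p
  have "mdelta \<epsilon> \<in> borel_measurable (time_prod T)" for \<epsilon>
  proof -
    have "(\<lambda>p. (sqrt (rv (fst p) + \<epsilon>\<^sup>2), mZ p)) \<in> measurable (time_prod T) (borel \<Otimes>\<^sub>M borel)" by measurable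
    from measurable_compose[OF this measurable_bachelier_delta] show ?thesis by (simp add: mdelta_def[abs_def])
  qed
  moreover have "mratio \<in> borel_measurable (time_prod T)" unfolding mratio_def[abs_def] by measurable
  ultimately show ?thesis
    by (rule that[OF N]) (auto simp: mdelta_def mratio_def mZ_def delta_def hedge_ratio_def intro: cont)
qed

text \<open>Inside a cell the error is at most |\<eta> - k| plus |k| times the change of the delta
  since the left end. The square of a sum contributes a factor 2 and the second moment of that
  change is at most 4 \<mu> / \<epsilon>^2, hence the constant 8.\<close>

lemma smoothed_integrand:
  assumes \<epsilon>: "0 < \<epsilon>"
    and s: "simple_adapted Fil T N \<tau> (\<lambda>i \<omega>. \<eta> i)" "\<tau> 0 = 0" "\<tau> N = T"
    and r: "0 < r"
    and \<mu>: "\<And>s t. 0 \<le> s \<Longrightarrow> s \<le> t \<Longrightarrow> t \<le> T \<Longrightarrow> t - s \<le> T / real r \<Longrightarrow> rv s - rv t \<le> \<mu>"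
    and sx: "simple_adapted Fil T (N * r) (refine \<tau> r) (\<lambda>q \<omega>. delta \<epsilon> (refine \<tau> r q) \<omega> *\<^sub>R \<eta> (q div r))"
  defines "\<xi> \<equiv> (\<lambda>q \<omega>. delta \<epsilon> (refine \<tau> r q) \<omega> *\<^sub>R \<eta> (q div r))"
  shows "(\<integral>\<^sup>+(t, \<omega>). ennreal ((norm (simple_proc (N * r) (refine \<tau> r) \<xi> t \<omega> - delta \<epsilon> t \<omega> *\<^sub>R k t))\<^sup>2) \<partial>time_prod T)
    \<le> 2 * (\<integral>\<^sup>+(t, \<omega>). ennreal ((norm (simple_proc N \<tau> (\<lambda>i \<omega>. \<eta> i) t \<omega> - k t))\<^sup>2) \<partial>time_prod T) + ennreal (8 / \<epsilon>\<^sup>2 * \<mu> * rv 0)"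
proof -
  have TTb: "T \<le> Tb" using T U by simp
  note [measurable] = k_T
  note sx' = sx[folded \<xi>_def]
  have \<mu>0: "0 \<le> \<mu>" using \<mu>[of 0 0] T by simp
  let ?p = "refine \<tau> r" and ?n = "N * r"
  let ?sx = "simple_proc ?n ?p \<xi>" and ?se = "simple_proc N \<tau> (\<lambda>i \<omega>. \<eta> i)"
  note st = simple_adapted_term(1-3)[OF s(1) TTb]
  note rc = refine_cell[OF s TTb r]
  note div = rc(1) and cell = rc(2-5) and p0 = rc(6) and pn = rc(7) and range = rc(8,9)
  obtain Nn mdelta where Nn: "Nn \<in> null_sets M" and [measurable]: "mdelta \<in> borel_measurable (time_prod T)"
    and md: "\<And>t \<omega>. \<omega> \<in> space M - Nn \<Longrightarrow> mdelta (t, \<omega>) = delta \<epsilon> t \<omega>"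
    using masked_versions by metis
  have AEM: "AE \<omega> in M. \<omega> \<in> space M - Nn" using AE_not_in[OF Nn] AE_space by eventually_elim auto
  have [measurable]: "(\<lambda>p. ?sx (fst p) (snd p)) \<in> borel_measurable (time_prod T)"
    "(\<lambda>p. ?se (fst p) (snd p)) \<in> borel_measurable (time_prod T)"
    using simple_proc_measurable[OF sx' TTb] simple_proc_measurable[OF s(1) TTb] by (simp_all add: case_prod_beta')
  define f where "f p = ennreal ((norm (?sx (fst p) (snd p) - mdelta p *\<^sub>R k (fst p)))\<^sup>2)" for p
  have [measurable]: "f \<in> borel_measurable (time_prod T)" unfolding f_def[abs_def] by measurable
  \<comment> \<open>The error of the step kernel does not depend on the path; as a function of time
    alone it leaves the inner integral and is returned to the product space at the end.\<close>
  define e where "e t = ennreal ((norm ((\<Sum>i<N. indicator {\<tau> i<..\<tau> (Suc i)} t *\<^sub>R \<eta> i) - k t))\<^sup>2)" for t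
  have [measurable]: "{a<..b} \<inter> {0..T} \<in> sets (restrict_space lborel {0..T})" for a b
    by (auto simp: sets_restrict_space_iff)
  have em[measurable]: "e \<in> borel_measurable (restrict_space lborel {0..T})"
  proof -
    have "(\<lambda>t. ennreal ((norm ((\<Sum>i<N. indicator ({\<tau> i<..\<tau> (Suc i)} \<inter> {0..T}) t *\<^sub>R \<eta> i) - k t))\<^sup>2)) \<in> borel_measurable (restrict_space lborel {0..T})"
      by measurable
    moreover have "e t = ennreal ((norm ((\<Sum>i<N. indicator ({\<tau> i<..\<tau> (Suc i)} \<inter> {0..T}) t *\<^sub>R \<eta> i) - k t))\<^sup>2)"
      if "t \<in> space (restrict_space lborel {0..T})" for t
    proof -
      have "indicator ({\<tau> i<..\<tau> (Suc i)} \<inter> {0..T}) t = (indicator {\<tau> i<..\<tau> (Suc i)} t :: real)" for i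
        using that by (auto simp: space_restrict_space split: split_indicator)
      then show ?thesis by (simp only: e_def)
    qed
    ultimately show ?thesis by (subst measurable_cong)
  qed
  have inner: "(\<integral>\<^sup>+\<omega>. f (t, \<omega>) \<partial>M) \<le> 2 * e t + ennreal (8 / \<epsilon>\<^sup>2 * \<mu>) * ennreal ((norm (k t))\<^sup>2)" if t: "0 < t" "t \<le> T" for t
  proof -
    obtain q where q: "q < ?n" "?p q < t" "t \<le> ?p (Suc q)"
      by (rule partition_cover[of ?p t ?n]) (use t p0 pn in auto)
    let ?i = "q div r"
    have sxe: "?sx t \<omega> = delta \<epsilon> (?p q) \<omega> *\<^sub>R \<eta> ?i" for \<omega>
      unfolding \<xi>_def by (rule simple_proc_on_cell[OF cell(2) q]) 
    have see: "?se t \<omega> = \<eta> ?i" for \<omega>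
      by (rule simple_proc_on_cell[of N \<tau> "q div r", OF st(2) div[OF q(1)]]) (use cell[OF q(1)] q in auto)
    then have ee: "e t = ennreal ((norm (\<eta> ?i - k t))\<^sup>2)"
      unfolding e_def simple_proc_def by simp
    have "rv (?p q) - rv t \<le> \<mu>"
      using cell[OF q(1)] q range[of q] t by (intro \<mu>) auto
    then have dinc: "(\<integral>\<^sup>+\<omega>. ennreal ((delta \<epsilon> t \<omega> - delta \<epsilon> (?p q) \<omega>)\<^sup>2) \<partial>M) \<le> ennreal (4 / \<epsilon>\<^sup>2 * \<mu>)"
      using range[of q] q t \<epsilon>
      by (intro order_trans[OF delta_increment ennreal_leI] mult_left_mono) auto
    have [measurable]: "delta \<epsilon> t \<in> borel_measurable M" "delta \<epsilon> (?p q) \<in> borel_measurable M"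
      using range[of q] q t TTb by (auto intro!: fil_measurable[OF delta_fil])
    have pt: "f (t, \<omega>) \<le> 2 * e t + ennreal (2 * (norm (k t))\<^sup>2) * ennreal ((delta \<epsilon> t \<omega> - delta \<epsilon> (?p q) \<omega>)\<^sup>2)" if "\<omega> \<in> space M - Nn" for \<omega>
    proof -
      let ?d = "delta \<epsilon> (?p q) \<omega>" and ?d' = "delta \<epsilon> t \<omega>"
      have "norm (?d *\<^sub>R \<eta> ?i - ?d' *\<^sub>R k t) = norm (?d *\<^sub>R (\<eta> ?i - k t) - (?d' - ?d) *\<^sub>R k t)"
        by (simp add: algebra_simps)
      also have "\<dots> \<le> norm (?d *\<^sub>R (\<eta> ?i - k t)) + norm ((?d' - ?d) *\<^sub>R k t)" by (rule norm_triangle_ineq4)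
      also have "\<dots> \<le> norm (\<eta> ?i - k t) + \<bar>?d' - ?d\<bar> * norm (k t)"
        using delta_bounds(3)[of \<epsilon> "?p q" \<omega>] by (simp add: mult_left_le_one_le)
      finally have "(norm (?d *\<^sub>R \<eta> ?i - ?d' *\<^sub>R k t))\<^sup>2 \<le> (norm (\<eta> ?i - k t) + \<bar>?d' - ?d\<bar> * norm (k t))\<^sup>2"
        by (rule power_mono) simp
      also have "\<dots> \<le> 2 * (norm (\<eta> ?i - k t))\<^sup>2 + (2 * (norm (k t))\<^sup>2) * (?d' - ?d)\<^sup>2"
        using sum_squares_bound[of "norm (\<eta> ?i - k t)" "\<bar>?d' - ?d\<bar> * norm (k t)"]
        by (simp add: power2_sum power_mult_distrib mult_ac)
      finally have "ennreal ((norm (?d *\<^sub>R \<eta> ?i - ?d' *\<^sub>R k t))\<^sup>2) \<le> ennreal (2 * (norm (\<eta> ?i - k t))\<^sup>2 + (2 * (norm (k t))\<^sup>2) * (?d' - ?d)\<^sup>2)"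
        by (rule ennreal_leI)
      also have "\<dots> = 2 * e t + ennreal (2 * (norm (k t))\<^sup>2) * ennreal ((?d' - ?d)\<^sup>2)"
        unfolding ee by (simp add: ennreal_mult)
      finally show ?thesis unfolding f_def by (simp add: sxe md[OF that])
    qed
    have "(\<integral>\<^sup>+\<omega>. f (t, \<omega>) \<partial>M) \<le> (\<integral>\<^sup>+\<omega>. 2 * e t + ennreal (2 * (norm (k t))\<^sup>2) * ennreal ((delta \<epsilon> t \<omega> - delta \<epsilon> (?p q) \<omega>)\<^sup>2) \<partial>M)"
      by (rule nn_integral_mono_AE) (use AEM in eventually_elim, rule pt)
    also have "\<dots> = 2 * e t + ennreal (2 * (norm (k t))\<^sup>2) * (\<integral>\<^sup>+\<omega>. ennreal ((delta \<epsilon> t \<omega> - delta \<epsilon> (?p q) \<omega>)\<^sup>2) \<partial>M)"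
      by (subst nn_integral_add) (auto simp: nn_integral_cmult emeasure_space_1)
    also have "\<dots> \<le> 2 * e t + ennreal (2 * (norm (k t))\<^sup>2) * ennreal (4 / \<epsilon>\<^sup>2 * \<mu>)"
      by (intro add_left_mono mult_left_mono dinc) auto
    also have "ennreal (2 * (norm (k t))\<^sup>2) * ennreal (4 / \<epsilon>\<^sup>2 * \<mu>) = ennreal (8 / \<epsilon>\<^sup>2 * \<mu>) * ennreal ((norm (k t))\<^sup>2)"
      using \<mu>0 by (simp add: ennreal_mult[symmetric] mult_ac)
    finally show ?thesis .
  qed
  have "(\<integral>\<^sup>+(t, \<omega>). ennreal ((norm (?sx t \<omega> - delta \<epsilon> t \<omega> *\<^sub>R k t))\<^sup>2) \<partial>time_prod T) = (\<integral>\<^sup>+p. f p \<partial>time_prod T)"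
  proof (rule nn_integral_cong_AE)
    show "AE p in time_prod T. (case p of (t, \<omega>) \<Rightarrow> ennreal ((norm (?sx t \<omega> - delta \<epsilon> t \<omega> *\<^sub>R k t))\<^sup>2)) = f p"
      using AE_time_prod_snd[OF Nn, of T] AE_space
      by eventually_elim (auto simp: f_def md space_pair_measure split_beta)
  qed
  also have "\<dots> = (\<integral>\<^sup>+t. (\<integral>\<^sup>+\<omega>. f (t, \<omega>) \<partial>M) \<partial>restrict_space lborel {0..T})"
    by (rule nn_integral_fst[symmetric]) measurable
  also have "\<dots> \<le> (\<integral>\<^sup>+t. 2 * e t + ennreal (8 / \<epsilon>\<^sup>2 * \<mu>) * ennreal ((norm (k t))\<^sup>2) \<partial>restrict_space lborel {0..T})"
  proof (rule nn_integral_mono_AE)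
    \<comment> \<open>Cells are open on the left, so time 0 belongs to none of them.\<close>
    have "AE t in lborel. t \<noteq> (0::real)" by (rule AE_lborel_singleton)
    then have "AE t in lborel. t \<in> {0..T} \<longrightarrow> (\<integral>\<^sup>+\<omega>. f (t, \<omega>) \<partial>M) \<le> 2 * e t + ennreal (8 / \<epsilon>\<^sup>2 * \<mu>) * ennreal ((norm (k t))\<^sup>2)"
      by eventually_elim (use inner in auto)
    then show "AE t in restrict_space lborel {0..T}. (\<integral>\<^sup>+\<omega>. f (t, \<omega>) \<partial>M) \<le> 2 * e t + ennreal (8 / \<epsilon>\<^sup>2 * \<mu>) * ennreal ((norm (k t))\<^sup>2)"
      by (subst AE_restrict_space_iff) auto
  qed
  also have "\<dots> = 2 * (\<integral>\<^sup>+t. e t \<partial>restrict_space lborel {0..T}) + ennreal (8 / \<epsilon>\<^sup>2 * \<mu>) * ennreal (rv 0)"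
    unfolding nn_integral_k[symmetric] by (subst nn_integral_add) (auto simp: nn_integral_cmult)
  also have "(\<integral>\<^sup>+t. e t \<partial>restrict_space lborel {0..T}) = (\<integral>\<^sup>+p. e (fst p) \<partial>time_prod T)"
    by (rule time_prod_deterministic[OF em, symmetric])
  also have "(\<integral>\<^sup>+p. e (fst p) \<partial>time_prod T) = (\<integral>\<^sup>+(t, \<omega>). ennreal ((norm (?se t \<omega> - k t))\<^sup>2) \<partial>time_prod T)"
    by (simp only: e_def simple_proc_def case_prod_beta')
  also have "ennreal (8 / \<epsilon>\<^sup>2 * \<mu>) * ennreal (rv 0) = ennreal (8 / \<epsilon>\<^sup>2 * \<mu> * rv 0)"
    using \<mu>0 rv_nonneg[of 0] by (intro ennreal_mult[symmetric]) auto
  finally show ?thesis .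
qed

lemma time_prod_mono:
  assumes f[measurable]: "f \<in> borel_measurable (time_prod U)"
  shows "(\<integral>\<^sup>+p. f p \<partial>time_prod T) \<le> (\<integral>\<^sup>+p. f p \<partial>time_prod U)"
proof -
  have sub: "(\<lambda>t. t) \<in> measurable (restrict_space lborel {0..T}) (restrict_space lborel {0..U})"
    using T by (intro measurable_restrict_space3) auto
  have "(\<lambda>p. (fst p, snd p)) \<in> measurable (time_prod T) (time_prod U)"
    by (intro measurable_Pair measurable_compose[OF measurable_fst sub] measurable_snd)
  then have fT[measurable]: "f \<in> borel_measurable (time_prod T)"
    using measurable_compose[OF _ f] by fastforce
  have g: "(\<lambda>t. \<integral>\<^sup>+\<omega>. f (t, \<omega>) \<partial>M) \<in> borel_measurable (restrict_space lborel {0..U})" by measurable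
  have "(\<integral>\<^sup>+p. f p \<partial>time_prod T) = (\<integral>\<^sup>+t. (\<integral>\<^sup>+\<omega>. f (t, \<omega>) \<partial>M) \<partial>restrict_space lborel {0..T})"
    by (rule nn_integral_fst[symmetric]) measurable
  also have "\<dots> = (\<integral>\<^sup>+t. (\<integral>\<^sup>+\<omega>. f (t, \<omega>) \<partial>M) * indicator {0..T} t \<partial>lborel)"
    by (subst nn_integral_restrict_space) auto
  also have "\<dots> \<le> (\<integral>\<^sup>+t. (\<integral>\<^sup>+\<omega>. f (t, \<omega>) \<partial>M) * indicator {0..U} t \<partial>lborel)"
    using T by (intro nn_integral_mono) (auto split: split_indicator)
  also have "\<dots> = (\<integral>\<^sup>+t. (\<integral>\<^sup>+\<omega>. f (t, \<omega>) \<partial>M) \<partial>restrict_space lborel {0..U})"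
    by (subst nn_integral_restrict_space) auto
  also have "\<dots> = (\<integral>\<^sup>+p. f p \<partial>time_prod U)"
    by (rule nn_integral_fst) measurable
  finally show ?thesis .
qed

text \<open>Uniform continuity, restated for the mesh T / r that r pieces per cell guarantee
  whatever the coarse partition is.\<close>

lemma rv_modulus:
  assumes "0 < \<mu>"
  obtains r where "0 < r" "\<And>s t. 0 \<le> s \<Longrightarrow> s \<le> t \<Longrightarrow> t \<le> T \<Longrightarrow> t - s \<le> T / real r \<Longrightarrow> rv s - rv t \<le> \<mu>"
proof -
  have "uniformly_continuous_on {0..T} rv"
    by (rule compact_uniformly_continuous[OF rv_continuous]) simp
  then obtain d where d: "0 < d" "\<And>x y. x \<in> {0..T} \<Longrightarrow> y \<in> {0..T} \<Longrightarrow> dist y x < d \<Longrightarrow> dist (rv y) (rv x) < \<mu>"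
    unfolding uniformly_continuous_on_def using assms by metis
  obtain r where r: "T / d < real r" using reals_Archimedean2 by blast
  have "0 < T / d" using T d by simp
  then have r0: "0 < real r" using r by linarith
  then have rd: "T / real r < d" using r d by (simp add: field_simps)
  show ?thesis
  proof (rule that[of r])
    show "0 < r" using r0 by simp
    fix s t assume st: "0 \<le> s" "s \<le> t" "t \<le> T" "t - s \<le> T / real r"
    then have "dist (rv s) (rv t) < \<mu>" using rd by (intro d(2)) (auto simp: dist_real_def)
    then show "rv s - rv t \<le> \<mu>" by (simp add: dist_real_def)
  qed
qed

text \<open>The step kernel is chosen first, with error \<delta> / 8; as its cost is independent of
  the mesh, r can then be taken large for this fixed kernel.\<close>

lemma smoothed_approximation:
  assumes \<epsilon>: "0 < \<epsilon>" and \<delta>: "0 < \<delta>"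
  shows "\<exists>N \<tau> \<xi>. simple_adapted Fil T N \<tau> \<xi> \<and>
    (\<integral>\<^sup>+(t, \<omega>). ennreal ((norm (simple_proc N \<tau> \<xi> t \<omega> - delta \<epsilon> t \<omega> *\<^sub>R k t))\<^sup>2) \<partial>time_prod T) \<le> ennreal \<delta> \<and>
    (\<forall>t\<in>{0..T}. (\<integral>\<^sup>+\<omega>. ennreal ((simple_integral_wrt W N \<tau> \<xi> t \<omega> - (price \<epsilon> t \<omega> - price \<epsilon> 0 \<omega>))\<^sup>2) \<partial>M) \<le> ennreal \<delta>)"
proof -
  have TTb: "T \<le> Tb" using T U by simp
  from deterministic_approximation[OF ito U k] obtain N \<tau> \<eta> where
    s: "\<And>n::nat. simple_adapted Fil U (N n) (\<tau> n) (\<lambda>i \<omega>. \<eta> n i)"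
    and lk: "(\<lambda>n. \<integral>\<^sup>+(t, \<omega>). ennreal ((norm (simple_proc (N n) (\<tau> n) (\<lambda>i \<omega>. \<eta> n i) t \<omega> - k t))\<^sup>2) \<partial>time_prod U) \<longlonglongrightarrow> 0"
    and lX: "\<And>t. t \<in> {0..U} \<Longrightarrow>
      (\<lambda>n. \<integral>\<^sup>+\<omega>. ennreal ((simple_integral_wrt W (N n) (\<tau> n) (\<lambda>i \<omega>. \<eta> n i) t \<omega> - X t \<omega>)\<^sup>2) \<partial>M) \<longlonglongrightarrow> 0"
    by blast
  have "\<forall>\<^sub>F n in sequentially. (\<integral>\<^sup>+(t, \<omega>). ennreal ((norm (simple_proc (N n) (\<tau> n) (\<lambda>i \<omega>. \<eta> n i) t \<omega> - k t))\<^sup>2) \<partial>time_prod U) < ennreal (\<delta> / 8)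
      \<and> (\<integral>\<^sup>+\<omega>. ennreal ((simple_integral_wrt W (N n) (\<tau> n) (\<lambda>i \<omega>. \<eta> n i) T \<omega> - X T \<omega>)\<^sup>2) \<partial>M) < ennreal (\<delta> / 8)"
    using \<delta> T by (intro eventually_conj order_tendstoD(2)[OF lk] order_tendstoD(2)[OF lX]) auto
  then obtain n where nk: "(\<integral>\<^sup>+(t, \<omega>). ennreal ((norm (simple_proc (N n) (\<tau> n) (\<lambda>i \<omega>. \<eta> n i) t \<omega> - k t))\<^sup>2) \<partial>time_prod U) < ennreal (\<delta> / 8)"
    and nX: "(\<integral>\<^sup>+\<omega>. ennreal ((simple_integral_wrt W (N n) (\<tau> n) (\<lambda>i \<omega>. \<eta> n i) T \<omega> - X T \<omega>)\<^sup>2) \<partial>M) < ennreal (\<delta> / 8)"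
    unfolding eventually_sequentially by blast
  obtain N' \<tau>' \<eta>' where s': "simple_adapted Fil T N' \<tau>' (\<lambda>i \<omega>. \<eta>' i)" "\<tau>' 0 = 0" "\<tau>' N' = T"
    and eqI: "\<And>t \<omega>. t \<in> {0..T} \<Longrightarrow> simple_integral_wrt W N' \<tau>' (\<lambda>i \<omega>. \<eta>' i) t \<omega> = simple_integral_wrt W (N n) (\<tau> n) (\<lambda>i \<omega>. \<eta> n i) t \<omega>"
    and eqP: "\<And>t \<omega> \<omega>'. t \<in> {0..T} \<Longrightarrow> simple_proc N' \<tau>' (\<lambda>i \<omega>. \<eta>' i) t (\<omega>::'a) = simple_proc (N n) (\<tau> n) (\<lambda>i \<omega>. \<eta> n i) t (\<omega>'::'a)"
    using pad_simple[OF s[of n] T U] by metis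
  \<comment> \<open>512 = 64 * 8 makes the mesh term 64 \<mu> \<open>rv 0\<close> / \<epsilon>^2 at
    most \<delta> / 8; the summand 1 avoids a division by zero when \<open>rv 0 = 0\<close>.\<close>
  define \<mu> where "\<mu> = \<delta> * \<epsilon>\<^sup>2 / (512 * (rv 0 + 1))"
  have \<mu>0: "0 < \<mu>" unfolding \<mu>_def using \<epsilon> \<delta> rv_nonneg[of 0] by (intro divide_pos_pos mult_pos_pos) auto
  have \<mu>b: "64 / \<epsilon>\<^sup>2 * (\<mu> * rv 0) \<le> \<delta> / 8"
  proof -
    have "64 / \<epsilon>\<^sup>2 * (\<delta> * \<epsilon>\<^sup>2 / (512 * R) * rv 0) = \<delta> / 8 * (rv 0 / R)" if "R \<noteq> 0" for R
      using \<epsilon> that by (simp add: field_simps)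
    then have "64 / \<epsilon>\<^sup>2 * (\<mu> * rv 0) = \<delta> / 8 * (rv 0 / (rv 0 + 1))"
      unfolding \<mu>_def using rv_nonneg[of 0] by (metis add_nonneg_eq_0_iff zero_le_one zero_neq_one)
    also have "\<dots> \<le> \<delta> / 8 * 1" using \<delta> rv_nonneg[of 0] by (intro mult_left_mono) auto
    finally show ?thesis by simp
  qed
  obtain r where r: "0 < r" and mod: "\<And>s t. 0 \<le> s \<Longrightarrow> s \<le> t \<Longrightarrow> t \<le> T \<Longrightarrow> t - s \<le> T / real r \<Longrightarrow> rv s - rv t \<le> \<mu>"
    using rv_modulus[OF \<mu>0] by blast
  let ?\<xi> = "\<lambda>q \<omega>. delta \<epsilon> (refine \<tau>' r q) \<omega> *\<^sub>R \<eta>' (q div r)"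
  have sa: "simple_adapted Fil T (N' * r) (refine \<tau>' r) ?\<xi>"
    using smoothed_replication(1)[OF \<epsilon> s' r mod, of 0] T by auto
  have mk: "(\<lambda>p. ennreal ((norm (simple_proc (N n) (\<tau> n) (\<lambda>i \<omega>. \<eta> n i) (fst p) (snd p) - k (fst p)))\<^sup>2)) \<in> borel_measurable (time_prod U)"
  proof -
    note [measurable] = k
    have [measurable]: "(\<lambda>p. simple_proc (N n) (\<tau> n) (\<lambda>i \<omega>. \<eta> n i) (fst p) (snd p)) \<in> borel_measurable (time_prod U)"
      using simple_proc_measurable[OF s[of n] U] by (simp add: case_prod_beta')
    show ?thesis by measurable
  qed
  have "(\<integral>\<^sup>+(t, \<omega>). ennreal ((norm (simple_proc N' \<tau>' (\<lambda>i \<omega>. \<eta>' i) t \<omega> - k t))\<^sup>2) \<partial>time_prod T)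
    = (\<integral>\<^sup>+p. ennreal ((norm (simple_proc (N n) (\<tau> n) (\<lambda>i \<omega>. \<eta> n i) (fst p) (snd p) - k (fst p)))\<^sup>2) \<partial>time_prod T)"
    unfolding case_prod_beta'
  proof (rule nn_integral_cong)
    fix p assume "p \<in> space (time_prod T)"
    then have "fst p \<in> {0..T}" by (auto simp: space_pair_measure space_restrict_space)
    then show "ennreal ((norm (simple_proc N' \<tau>' (\<lambda>i \<omega>. \<eta>' i) (fst p) (snd p) - k (fst p)))\<^sup>2)
      = ennreal ((norm (simple_proc (N n) (\<tau> n) (\<lambda>i \<omega>. \<eta> n i) (fst p) (snd p) - k (fst p)))\<^sup>2)"
      by (simp only: eqP[of "fst p" "snd p" "snd p"])
  qed
  also have "\<dots> \<le> ennreal (\<delta> / 8)"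
    using time_prod_mono[OF mk] nk by (simp add: case_prod_beta')
  finally have hk: "(\<integral>\<^sup>+(t, \<omega>). ennreal ((norm (simple_proc N' \<tau>' (\<lambda>i \<omega>. \<eta>' i) t \<omega> - k t))\<^sup>2) \<partial>time_prod T) \<le> ennreal (\<delta> / 8)" .
  have "(\<integral>\<^sup>+(t, \<omega>). ennreal ((norm (simple_proc (N' * r) (refine \<tau>' r) ?\<xi> t \<omega> - delta \<epsilon> t \<omega> *\<^sub>R k t))\<^sup>2) \<partial>time_prod T)
    \<le> 2 * ennreal (\<delta> / 8) + ennreal (8 / \<epsilon>\<^sup>2 * \<mu> * rv 0)"
  proof (rule order_trans)
    show "(\<integral>\<^sup>+(t, \<omega>). ennreal ((norm (simple_proc (N' * r) (refine \<tau>' r) ?\<xi> t \<omega> - delta \<epsilon> t \<omega> *\<^sub>R k t))\<^sup>2) \<partial>time_prod T)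
      \<le> 2 * (\<integral>\<^sup>+(t, \<omega>). ennreal ((norm (simple_proc N' \<tau>' (\<lambda>i \<omega>. \<eta>' i) t \<omega> - k t))\<^sup>2) \<partial>time_prod T) + ennreal (8 / \<epsilon>\<^sup>2 * \<mu> * rv 0)"
      by (rule smoothed_integrand[OF \<epsilon> s' r _ sa]) (rule mod)
  qed (intro add_right_mono mult_left_mono hk, auto)
  also have "\<dots> = ennreal (2 * (\<delta> / 8) + 8 / \<epsilon>\<^sup>2 * \<mu> * rv 0)"
  proof -
    have "2 * ennreal (\<delta> / 8) = ennreal (2 * (\<delta> / 8))" using \<delta> by (subst ennreal_mult) auto
    then show ?thesis using \<delta> \<mu>0 rv_nonneg[of 0] by (subst ennreal_plus) auto
  qed
  also have "\<dots> \<le> ennreal \<delta>"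
    using \<mu>b \<delta> by (intro ennreal_leI) simp
  finally have H: "(\<integral>\<^sup>+(t, \<omega>). ennreal ((norm (simple_proc (N' * r) (refine \<tau>' r) ?\<xi> t \<omega> - delta \<epsilon> t \<omega> *\<^sub>R k t))\<^sup>2) \<partial>time_prod T) \<le> ennreal \<delta>" .
  have YT: "(\<integral>\<omega>. (simple_integral_wrt W N' \<tau>' (\<lambda>i \<omega>. \<eta>' i) T \<omega> - X T \<omega>)\<^sup>2 \<partial>M) \<le> \<delta> / 8"
  proof -
    have TT: "T \<in> {0..T}" using T by simp
    have [measurable]: "X T \<in> borel_measurable M" using fil_measurable[OF X_meas[OF TT]] TTb T by auto
    have [measurable]: "simple_integral_wrt W N' \<tau>' (\<lambda>i \<omega>. \<eta>' i) T \<in> borel_measurable M" by (rule simple_integral_props(2)[OF s'(1) TTb])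
    have "(\<integral>\<omega>. (simple_integral_wrt W N' \<tau>' (\<lambda>i \<omega>. \<eta>' i) T \<omega> - X T \<omega>)\<^sup>2 \<partial>M)
      = enn2real (\<integral>\<^sup>+\<omega>. ennreal ((simple_integral_wrt W N' \<tau>' (\<lambda>i \<omega>. \<eta>' i) T \<omega> - X T \<omega>)\<^sup>2) \<partial>M)"
      by (rule integral_eq_nn_integral) auto
    also have "\<dots> \<le> enn2real (ennreal (\<delta> / 8))"
      using nX \<delta> unfolding eqI[OF TT] by (intro enn2real_mono) auto
    finally show ?thesis using \<delta> by simp
  qed
  have "(\<integral>\<^sup>+\<omega>. ennreal ((simple_integral_wrt W (N' * r) (refine \<tau>' r) ?\<xi> t \<omega> - (price \<epsilon> t \<omega> - price \<epsilon> 0 \<omega>))\<^sup>2) \<partial>M) \<le> ennreal \<delta>"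
    if t: "t \<in> {0..T}" for t
  proof (rule order_trans[OF smoothed_replication(2)[OF \<epsilon> s' r mod t]])
    show "ennreal (2 * (\<integral>\<omega>. (simple_integral_wrt W N' \<tau>' (\<lambda>i \<omega>. \<eta>' i) T \<omega> - X T \<omega>)\<^sup>2 \<partial>M) + 2 * (32 / \<epsilon>\<^sup>2 * (\<mu> * rv 0))) \<le> ennreal \<delta>"
      using YT \<mu>b \<delta> by (intro ennreal_leI) simp
  qed auto
  with sa H show ?thesis by blast
qed

text \<open>Where \<open>rv t > 0\<close> the deltas converge by continuity of the distribution
  function; where \<open>rv t = 0\<close> the kernel vanishes almost everywhere. All ratios lie
  between 0 and 1, so |k|^2 dominates.\<close>

lemma delta_limit:
  "(\<lambda>n. \<integral>\<^sup>+(t, \<omega>). ennreal ((norm (delta (1 / real (Suc n)) t \<omega> *\<^sub>R k t - hedge_ratio t \<omega> *\<^sub>R k t))\<^sup>2) \<partial>time_prod T) \<longlonglongrightarrow> 0"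
proof -
  note [measurable] = k_T
  obtain Nn mdelta mratio where Nn: "Nn \<in> null_sets M" and [measurable]: "\<And>\<epsilon>. mdelta \<epsilon> \<in> borel_measurable (time_prod T)"
      "mratio \<in> borel_measurable (time_prod T)"
    and md: "\<And>\<epsilon> t \<omega>. \<omega> \<in> space M - Nn \<Longrightarrow> mdelta \<epsilon> (t, \<omega>) = delta \<epsilon> t \<omega>"
    and mr: "\<And>t \<omega>. \<omega> \<in> space M - Nn \<Longrightarrow> mratio (t, \<omega>) = hedge_ratio t \<omega>"
    using masked_versions by metis
  let ?\<epsilon> = "\<lambda>n. 1 / real (Suc n)"
  define u where "u n p = ennreal ((norm (mdelta (?\<epsilon> n) p *\<^sub>R k (fst p) - mratio p *\<^sub>R k (fst p)))\<^sup>2)" for n p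
  have good: "AE p in time_prod T. fst p \<in> {0..T} \<and> snd p \<in> space M - Nn \<and> (rv (fst p) = 0 \<longrightarrow> k (fst p) = 0)"
  proof -
    have "AE t in restrict_space lborel {0..T}. rv t = 0 \<longrightarrow> k t = 0"
      using rv_eq_0_imp by (subst AE_restrict_space_iff) auto
    then have "AE p in time_prod T. rv (fst p) = 0 \<longrightarrow> k (fst p) = 0"
    proof -
      interpret pair_sigma_finite "restrict_space lborel {0..T}" M by (rule pair_time)
      assume ae: "AE t in restrict_space lborel {0..T}. rv t = 0 \<longrightarrow> k t = 0"
      have "AE t in restrict_space lborel {0..T}. AE \<omega> in M. rv (fst (t, \<omega>)) = 0 \<longrightarrow> k (fst (t, \<omega>)) = 0"
        using ae by eventually_elim simp
      then show ?thesis by (intro AE_pair_measure) measurable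
    qed
    then show ?thesis
      using AE_time_prod_snd[OF Nn, of T] AE_space
      by eventually_elim (auto simp: space_pair_measure space_restrict_space)
  qed
  have bd: "\<bar>delta \<epsilon> t \<omega> - hedge_ratio t \<omega>\<bar> \<le> 1" for \<epsilon> t \<omega>
    using delta_bounds(1,2)[of \<epsilon> t \<omega>] std_normal_cdf_bounds[of "Z t \<omega> / sqrt (rv t)"] by (auto simp: hedge_ratio_def)
  have "(\<lambda>n. \<integral>\<^sup>+p. u n p \<partial>time_prod T) \<longlonglongrightarrow> (\<integral>\<^sup>+p. 0 \<partial>time_prod T)"
  proof (rule nn_integral_dominated_convergence)
    show "u n \<in> borel_measurable (time_prod T)" for n unfolding u_def[abs_def] by measurable
    show "(\<lambda>p. ennreal ((norm (k (fst p)))\<^sup>2)) \<in> borel_measurable (time_prod T)" by measurable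
    show "(\<integral>\<^sup>+p. ennreal ((norm (k (fst p)))\<^sup>2) \<partial>time_prod T) < \<infinity>" unfolding time_prod_k by simp
    show "AE p in time_prod T. u n p \<le> ennreal ((norm (k (fst p)))\<^sup>2)" for n
      using good
    proof eventually_elim
      case (elim p)
      obtain t \<omega> where p: "p = (t, \<omega>)" by (cases p)
      have "(norm (delta (?\<epsilon> n) t \<omega> *\<^sub>R k t - hedge_ratio t \<omega> *\<^sub>R k t))\<^sup>2 \<le> (norm (k t))\<^sup>2"
        using bd[of "?\<epsilon> n" t \<omega>] unfolding scaleR_diff_left[symmetric]
        by (intro power_mono) (auto intro: mult_left_le_one_le)
      then show ?case using elim by (simp add: u_def p md mr)
    qed
    show "AE p in time_prod T. (\<lambda>n. u n p) \<longlonglongrightarrow> 0"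
      using good
    proof eventually_elim
      case (elim p)
      obtain t \<omega> where p: "p = (t, \<omega>)" by (cases p)
      have eq: "u n p = ennreal ((norm (delta (?\<epsilon> n) t \<omega> *\<^sub>R k t - hedge_ratio t \<omega> *\<^sub>R k t))\<^sup>2)" for n
        using elim by (simp add: u_def p md mr)
      show ?case
      proof (cases "rv t = 0")
        case True
        then show ?thesis using elim unfolding eq by (simp add: p)
      next
        case False
        then have pos: "0 < rv t" using rv_nonneg[of t] by simp
        have "(\<lambda>n. Z t \<omega> / sqrt (rv t + (?\<epsilon> n)\<^sup>2)) \<longlonglongrightarrow> Z t \<omega> / sqrt (rv t + 0\<^sup>2)"
          using pos LIMSEQ_Suc[OF lim_1_over_n] by (intro tendsto_intros) auto
        then have "(\<lambda>n. std_normal_cdf (Z t \<omega> / sqrt (rv t + (?\<epsilon> n)\<^sup>2))) \<longlonglongrightarrow> std_normal_cdf (Z t \<omega> / sqrt (rv t + 0\<^sup>2))"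
          by (rule isCont_tendsto_compose[OF isCont_std_normal_cdf])
        moreover have "std_normal_cdf (Z t \<omega> / sqrt (rv t + (?\<epsilon> n)\<^sup>2)) = delta (?\<epsilon> n) t \<omega>" for n
          unfolding delta_def using pos by (intro bachelier_delta_eq_cdf[symmetric]) (simp add: add_pos_nonneg)
        ultimately have "(\<lambda>n. delta (?\<epsilon> n) t \<omega>) \<longlonglongrightarrow> hedge_ratio t \<omega>" by (simp add: hedge_ratio_def)
        then have "(\<lambda>n. (norm (delta (?\<epsilon> n) t \<omega> *\<^sub>R k t - hedge_ratio t \<omega> *\<^sub>R k t))\<^sup>2) \<longlonglongrightarrow> (norm (hedge_ratio t \<omega> *\<^sub>R k t - hedge_ratio t \<omega> *\<^sub>R k t))\<^sup>2"
          by (intro tendsto_intros)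
        then have "(\<lambda>n. ennreal ((norm (delta (?\<epsilon> n) t \<omega> *\<^sub>R k t - hedge_ratio t \<omega> *\<^sub>R k t))\<^sup>2)) \<longlonglongrightarrow> ennreal 0"
          by (intro tendsto_ennrealI) simp
        then show ?thesis unfolding eq by simp
      qed
    qed
  qed simp
  moreover have "(\<integral>\<^sup>+p. u n p \<partial>time_prod T) = (\<integral>\<^sup>+(t, \<omega>). ennreal ((norm (delta (?\<epsilon> n) t \<omega> *\<^sub>R k t - hedge_ratio t \<omega> *\<^sub>R k t))\<^sup>2) \<partial>time_prod T)" for n
  proof (rule nn_integral_cong_AE)
    show "AE p in time_prod T. u n p = (case p of (t, \<omega>) \<Rightarrow> ennreal ((norm (delta (?\<epsilon> n) t \<omega> *\<^sub>R k t - hedge_ratio t \<omega> *\<^sub>R k t))\<^sup>2))"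
      using good by eventually_elim (auto simp: u_def md mr split_beta)
  qed
  ultimately show ?thesis by simp
qed

lemma AE_good_paths: "AE \<omega> in M. continuous_on {0..T} (\<lambda>t. Z t \<omega>)"
proof -
  obtain N where N: "N \<in> null_sets M" "\<And>\<omega>. \<omega> \<in> space M - N \<Longrightarrow> continuous_on {0..T} (\<lambda>t. Z t \<omega>)"
    using masked_versions by metis
  show ?thesis using AE_not_in[OF N(1)] AE_space by eventually_elim (use N(2) in blast)
qed

text \<open>Joint continuity of \<open>bachelier\<close> includes volatility zero, so the paths
  remain continuous up to expiry.\<close>

lemma price_continuous: "AE \<omega> in M. continuous_on {0..T} (\<lambda>t. price 0 t \<omega>)"
  using AE_good_paths
proof eventually_elim
  case (elim \<omega>)
  have "continuous_on {0..T} (\<lambda>t. (sqrt (rv t + 0\<^sup>2), Z t \<omega>))"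
    by (intro continuous_intros rv_continuous elim)
  then have "continuous_on {0..T} (\<lambda>t. (\<lambda>p. bachelier (fst p) (snd p)) (sqrt (rv t + 0\<^sup>2), Z t \<omega>))"
    by (rule continuous_on_compose2[OF continuous_bachelier]) simp
  then show ?case by (simp add: price_def)
qed

text \<open>The representation of the price as an Ito integral of delta times kernel. The
  approximating simple processes come from the smoothed problems, with \<epsilon> sent to 0 along a
  sequence.\<close>

lemma hedge_has_ito_integral:
  "has_ito_integral M Fil W T (\<lambda>t \<omega>. hedge_ratio t \<omega> *\<^sub>R k t) (\<lambda>t \<omega>. price 0 t \<omega> - price 0 0 \<omega>)"
  unfolding has_ito_integral_def
proof (intro conjI ballI)
  have TTb: "T \<le> Tb" using T U by simp
  note [measurable] = k_T
  let ?P = "completion (time_prod T)"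
  let ?\<epsilon> = "\<lambda>n. 1 / real (Suc n)"
  obtain Nn mdelta mratio where Nn: "Nn \<in> null_sets M" and [measurable]: "\<And>\<epsilon>. mdelta \<epsilon> \<in> borel_measurable (time_prod T)"
      "mratio \<in> borel_measurable (time_prod T)"
    and md: "\<And>\<epsilon> t \<omega>. \<omega> \<in> space M - Nn \<Longrightarrow> mdelta \<epsilon> (t, \<omega>) = delta \<epsilon> t \<omega>"
    and mr: "\<And>t \<omega>. \<omega> \<in> space M - Nn \<Longrightarrow> mratio (t, \<omega>) = hedge_ratio t \<omega>"
    using masked_versions by metis
  have good: "AE p in time_prod T. snd p \<in> space M - Nn"
    using AE_time_prod_snd[OF Nn, of T] AE_space by eventually_elim (auto simp: space_pair_measure)
  have mH: "(\<lambda>p. hedge_ratio (fst p) (snd p) *\<^sub>R k (fst p)) \<in> borel_measurable ?P"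
  proof (rule borel_measurable_completion_AE)
    show "(\<lambda>p. mratio p *\<^sub>R k (fst p)) \<in> borel_measurable (time_prod T)" by measurable
    show "AE p in time_prod T. mratio p *\<^sub>R k (fst p) = hedge_ratio (fst p) (snd p) *\<^sub>R k (fst p)"
      using good by eventually_elim (metis mr prod.collapse)
  qed
  have mD: "(\<lambda>p. delta \<epsilon> (fst p) (snd p) *\<^sub>R k (fst p)) \<in> borel_measurable ?P" for \<epsilon>
  proof (rule borel_measurable_completion_AE)
    show "(\<lambda>p. mdelta \<epsilon> p *\<^sub>R k (fst p)) \<in> borel_measurable (time_prod T)" by measurable
    show "AE p in time_prod T. mdelta \<epsilon> p *\<^sub>R k (fst p) = delta \<epsilon> (fst p) (snd p) *\<^sub>R k (fst p)"
      using good by eventually_elim (metis md prod.collapse)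
  qed
  show "(\<lambda>(t, \<omega>). hedge_ratio t \<omega> *\<^sub>R k t) \<in> borel_measurable ?P"
    using mH by (simp add: case_prod_beta')
  have ratio_bound: "\<bar>hedge_ratio t \<omega>\<bar> \<le> 1" for t \<omega>
    using std_normal_cdf_bounds[of "Z t \<omega> / sqrt (rv t)"] by (simp add: hedge_ratio_def)
  show "(\<lambda>\<omega>. hedge_ratio t \<omega> *\<^sub>R k t) \<in> borel_measurable (Fil t)" if "t \<in> {0..T}" for t
    unfolding hedge_ratio_def using Z_fil[OF that] by measurable
  have "(\<integral>\<^sup>+(t, \<omega>). ennreal ((norm (hedge_ratio t \<omega> *\<^sub>R k t))\<^sup>2) \<partial>time_prod T) \<le> (\<integral>\<^sup>+p. ennreal ((norm (k (fst p)))\<^sup>2) \<partial>time_prod T)"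
    unfolding case_prod_beta' using ratio_bound
    by (intro nn_integral_mono ennreal_leI power_mono) (auto intro!: mult_left_le_one_le)
  also have "\<dots> < \<infinity>" unfolding time_prod_k by simp
  finally show "(\<integral>\<^sup>+(t, \<omega>). ennreal ((norm (hedge_ratio t \<omega> *\<^sub>R k t))\<^sup>2) \<partial>time_prod T) < \<infinity>" .
  show "(\<lambda>\<omega>. price 0 t \<omega> - price 0 0 \<omega>) \<in> borel_measurable (Fil t)" if t: "t \<in> {0..T}" for t
  proof -
    have "price 0 0 \<in> borel_measurable (Fil t)"
      using fil_measurable_mono[OF price_fil[of 0], of t] t T TTb by auto
    with price_fil[OF t] show ?thesis by measurable
  qed
  show "AE \<omega> in M. continuous_on {0..T} (\<lambda>t. price 0 t \<omega> - price 0 0 \<omega>)"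
    using price_continuous by eventually_elim (intro continuous_intros)
  \<comment> \<open>A diagonal choice: smoothing parameter and approximation error are the same 1 /
    (n + 1).\<close>
  define close where "close n N \<tau> \<xi> \<longleftrightarrow> simple_adapted Fil T N \<tau> \<xi> \<and>
    (\<integral>\<^sup>+(t, \<omega>). ennreal ((norm (simple_proc N \<tau> \<xi> t \<omega> - delta (?\<epsilon> n) t \<omega> *\<^sub>R k t))\<^sup>2) \<partial>time_prod T) \<le> ennreal (?\<epsilon> n) \<and>
    (\<forall>t\<in>{0..T}. (\<integral>\<^sup>+\<omega>. ennreal ((simple_integral_wrt W N \<tau> \<xi> t \<omega> - (price (?\<epsilon> n) t \<omega> - price (?\<epsilon> n) 0 \<omega>))\<^sup>2) \<partial>M) \<le> ennreal (?\<epsilon> n))"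
    for n N \<tau> \<xi>
  have "0 < ?\<epsilon> n" for n by simp
  then have "\<exists>N \<tau> \<xi>. close n N \<tau> \<xi>" for n
    unfolding close_def by (intro smoothed_approximation)
  then obtain N \<tau> \<xi> where cl: "\<And>n. close n (N n) (\<tau> n) (\<xi> n)" by metis
  have s: "\<And>n. simple_adapted Fil T (N n) (\<tau> n) (\<xi> n)"
    and a: "\<And>n. (\<integral>\<^sup>+(t, \<omega>). ennreal ((norm (simple_proc (N n) (\<tau> n) (\<xi> n) t \<omega> - delta (?\<epsilon> n) t \<omega> *\<^sub>R k t))\<^sup>2) \<partial>time_prod T) \<le> ennreal (?\<epsilon> n)"
    and b: "\<And>n t. t \<in> {0..T} \<Longrightarrow> (\<integral>\<^sup>+\<omega>. ennreal ((simple_integral_wrt W (N n) (\<tau> n) (\<xi> n) t \<omega> - (price (?\<epsilon> n) t \<omega> - price (?\<epsilon> n) 0 \<omega>))\<^sup>2) \<partial>M) \<le> ennreal (?\<epsilon> n)"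
    using cl unfolding close_def by blast+
  have e0: "?\<epsilon> \<longlonglongrightarrow> 0" by (rule LIMSEQ_Suc[OF lim_1_over_n])
  then have l\<epsilon>: "(\<lambda>n. ennreal (?\<epsilon> n)) \<longlonglongrightarrow> 0" using tendsto_ennrealI[OF e0] by simp
  have H: "(\<lambda>n. \<integral>\<^sup>+(t, \<omega>). ennreal ((norm (simple_proc (N n) (\<tau> n) (\<xi> n) t \<omega> - hedge_ratio t \<omega> *\<^sub>R k t))\<^sup>2) \<partial>time_prod T) \<longlonglongrightarrow> 0"
  proof (rule ennreal_tendsto_0_triangle[OF _ l\<epsilon> delta_limit])
    fix n
    \<comment> \<open>The triangle inequality is applied on the completed product, where delta and
      hedge ratio are measurable; the integrals there agree with those on the product
      itself.\<close>
    have mS: "(\<lambda>p. simple_proc (N n) (\<tau> n) (\<xi> n) (fst p) (snd p)) \<in> borel_measurable ?P"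
      using measurable_completion[OF simple_proc_measurable[OF s TTb]] by (simp add: case_prod_beta')
    have "(\<integral>\<^sup>+p. ennreal ((norm (simple_proc (N n) (\<tau> n) (\<xi> n) (fst p) (snd p) - hedge_ratio (fst p) (snd p) *\<^sub>R k (fst p)))\<^sup>2) \<partial>?P)
      \<le> 2 * (\<integral>\<^sup>+p. ennreal ((norm (simple_proc (N n) (\<tau> n) (\<xi> n) (fst p) (snd p) - delta (?\<epsilon> n) (fst p) (snd p) *\<^sub>R k (fst p)))\<^sup>2) \<partial>?P)
      + 2 * (\<integral>\<^sup>+p. ennreal ((norm (delta (?\<epsilon> n) (fst p) (snd p) *\<^sub>R k (fst p) - hedge_ratio (fst p) (snd p) *\<^sub>R k (fst p)))\<^sup>2) \<partial>?P)"
      by (rule nn_L2_triangle) (intro borel_measurable_diff mS mD mH)+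
    also have "\<dots> \<le> 2 * ennreal (?\<epsilon> n)
      + 2 * (\<integral>\<^sup>+p. ennreal ((norm (delta (?\<epsilon> n) (fst p) (snd p) *\<^sub>R k (fst p) - hedge_ratio (fst p) (snd p) *\<^sub>R k (fst p)))\<^sup>2) \<partial>?P)"
      using a[of n] unfolding nn_integral_completion case_prod_beta' by (intro add_right_mono mult_left_mono) auto
    finally show "(\<integral>\<^sup>+(t, \<omega>). ennreal ((norm (simple_proc (N n) (\<tau> n) (\<xi> n) t \<omega> - hedge_ratio t \<omega> *\<^sub>R k t))\<^sup>2) \<partial>time_prod T)
      \<le> 2 * ennreal (?\<epsilon> n) + 2 * (\<integral>\<^sup>+(t, \<omega>). ennreal ((norm (delta (?\<epsilon> n) t \<omega> *\<^sub>R k t - hedge_ratio t \<omega> *\<^sub>R k t))\<^sup>2) \<partial>time_prod T)"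
      unfolding nn_integral_completion case_prod_beta' .
  qed
  have V: "(\<lambda>n. \<integral>\<^sup>+\<omega>. ennreal ((simple_integral_wrt W (N n) (\<tau> n) (\<xi> n) t \<omega> - (price 0 t \<omega> - price 0 0 \<omega>))\<^sup>2) \<partial>M) \<longlonglongrightarrow> 0"
    if t: "t \<in> {0..T}" for t
  proof -
    have z: "0 \<in> {0..T}" using T by simp
    note [measurable] = price_meas[OF t] price_meas[OF z] simple_integral_props(2)[OF s TTb]
    \<comment> \<open>Smoothing moves the price by at most \<epsilon> at time t and again at time 0;
      the square of 2 \<epsilon> gives the factor 4.\<close>
    have l2: "(\<lambda>n. ennreal (4 * (?\<epsilon> n)\<^sup>2)) \<longlonglongrightarrow> 0"
    proof -
      have "(\<lambda>n. 4 * (?\<epsilon> n)\<^sup>2) \<longlonglongrightarrow> 4 * 0\<^sup>2" by (intro tendsto_intros e0)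
      from tendsto_ennrealI[OF this] show ?thesis by simp
    qed
    show ?thesis
    proof (rule ennreal_tendsto_0_triangle[OF _ l\<epsilon> l2])
      fix n
      have e: "0 < ?\<epsilon> n" by simp
      have pt: "((price (?\<epsilon> n) t \<omega> - price (?\<epsilon> n) 0 \<omega>) - (price 0 t \<omega> - price 0 0 \<omega>))\<^sup>2 \<le> 4 * (?\<epsilon> n)\<^sup>2" for \<omega>
      proof -
        have "\<bar>(price (?\<epsilon> n) t \<omega> - price (?\<epsilon> n) 0 \<omega>) - (price 0 t \<omega> - price 0 0 \<omega>)\<bar> \<le> 2 * ?\<epsilon> n"
          using price_smoothing[of "?\<epsilon> n" t \<omega>] price_smoothing[of "?\<epsilon> n" 0 \<omega>] e by linarith
        from power_mono[OF this abs_ge_zero, of 2] show ?thesis by (simp only: power2_abs power_mult_distrib) simp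
      qed
      have "(\<integral>\<^sup>+\<omega>. ennreal ((simple_integral_wrt W (N n) (\<tau> n) (\<xi> n) t \<omega> - (price 0 t \<omega> - price 0 0 \<omega>))\<^sup>2) \<partial>M)
        \<le> 2 * (\<integral>\<^sup>+\<omega>. ennreal ((simple_integral_wrt W (N n) (\<tau> n) (\<xi> n) t \<omega> - (price (?\<epsilon> n) t \<omega> - price (?\<epsilon> n) 0 \<omega>))\<^sup>2) \<partial>M)
        + 2 * (\<integral>\<^sup>+\<omega>. ennreal (((price (?\<epsilon> n) t \<omega> - price (?\<epsilon> n) 0 \<omega>) - (price 0 t \<omega> - price 0 0 \<omega>))\<^sup>2) \<partial>M)"
        by (rule nn_L2_triangle_real) measurable
      also have "\<dots> \<le> 2 * ennreal (?\<epsilon> n) + 2 * (\<integral>\<^sup>+\<omega>. ennreal (4 * (?\<epsilon> n)\<^sup>2) \<partial>M)"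
        by (intro add_mono mult_left_mono b[OF t] nn_integral_mono ennreal_leI pt) auto
      also have "(\<integral>\<^sup>+\<omega>. ennreal (4 * (?\<epsilon> n)\<^sup>2) \<partial>M) = ennreal (4 * (?\<epsilon> n)\<^sup>2)" by (simp add: emeasure_space_1)
      finally show "(\<integral>\<^sup>+\<omega>. ennreal ((simple_integral_wrt W (N n) (\<tau> n) (\<xi> n) t \<omega> - (price 0 t \<omega> - price 0 0 \<omega>))\<^sup>2) \<partial>M)
        \<le> 2 * ennreal (?\<epsilon> n) + 2 * ennreal (4 * (?\<epsilon> n)\<^sup>2)" .
    qed
  qed
  show "\<exists>N \<tau> \<xi>. (\<forall>k. simple_adapted Fil T (N k) (\<tau> k) (\<xi> k)) \<and>
      (\<lambda>n. \<integral>\<^sup>+(t, \<omega>). ennreal ((norm (simple_proc (N n) (\<tau> n) (\<xi> n) t \<omega> - hedge_ratio t \<omega> *\<^sub>R k t))\<^sup>2) \<partial>time_prod T) \<longlonglongrightarrow> 0 \<and>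
      (\<forall>t\<in>{0..T}. (\<lambda>n. \<integral>\<^sup>+\<omega>. ennreal ((simple_integral_wrt W (N n) (\<tau> n) (\<xi> n) t \<omega> - (price 0 t \<omega> - price 0 0 \<omega>))\<^sup>2) \<partial>M) \<longlonglongrightarrow> 0)"
    using s H V by blast
qed

end

section \<open>Mean and uniqueness of Ito integrals\<close>

context bm_filtered
begin

text \<open>Simple integrals have mean zero, and convergence in L^2 carries this to the
  limit.\<close>

lemma ito_integral_mean_zero:
  assumes ito: "has_ito_integral M Fil W U H X" and U: "0 \<le> U" "U \<le> Tb"
  shows "integrable M (X U)" "(\<integral>\<omega>. X U \<omega> \<partial>M) = 0"
proof -
  have UU: "U \<in> {0..U}" using U by simp
  from ito obtain N \<tau> \<xi> where s: "\<And>n::nat. simple_adapted Fil U (N n) (\<tau> n) (\<xi> n)"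
    and lX: "(\<lambda>n. \<integral>\<^sup>+\<omega>. ennreal ((simple_integral_wrt W (N n) (\<tau> n) (\<xi> n) U \<omega> - X U \<omega>)\<^sup>2) \<partial>M) \<longlonglongrightarrow> 0"
    and Xm: "X U \<in> borel_measurable (Fil U)"
    unfolding has_ito_integral_def using UU by blast
  let ?S = "\<lambda>n. simple_integral_wrt W (N n) (\<tau> n) (\<xi> n) U"
  have [measurable]: "X U \<in> borel_measurable M" using fil_measurable[OF Xm] U by auto
  note sp = simple_integral_props[OF s U(2)]
  note [measurable] = sp(2)
  have ev: "\<forall>\<^sub>F n in sequentially. (\<integral>\<^sup>+\<omega>. ennreal ((?S n \<omega> - X U \<omega>)\<^sup>2) \<partial>M) < ennreal (e\<^sup>2)" if "0 < e" for e
    using that by (intro order_tendstoD(2)[OF lX]) auto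
  have i2: "integrable M (\<lambda>\<omega>. (?S n \<omega> - X U \<omega>)\<^sup>2)" if "(\<integral>\<^sup>+\<omega>. ennreal ((?S n \<omega> - X U \<omega>)\<^sup>2) \<partial>M) < ennreal (e\<^sup>2)" for n e
    using that by (subst integrable_iff_bounded) (auto intro: less_trans)
  have iS: "integrable M (?S n)" for n by (rule abs_expectation_le_L2(1)[OF sp(2) sp(3)])
  obtain n1 where "(\<integral>\<^sup>+\<omega>. ennreal ((?S n1 \<omega> - X U \<omega>)\<^sup>2) \<partial>M) < ennreal (1\<^sup>2)"
    using ev[of 1] unfolding eventually_sequentially by auto
  from abs_expectation_le_L2(1)[OF _ i2[OF this]] have "integrable M (\<lambda>\<omega>. ?S n1 \<omega> - X U \<omega>)" by simp
  from Bochner_Integration.integrable_diff[OF iS[of n1] this] show iX: "integrable M (X U)" by simp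
  have "\<bar>\<integral>\<omega>. X U \<omega> \<partial>M\<bar> \<le> e" if e: "0 < e" for e
  proof -
    obtain n where n: "(\<integral>\<^sup>+\<omega>. ennreal ((?S n \<omega> - X U \<omega>)\<^sup>2) \<partial>M) < ennreal (e\<^sup>2)"
      using ev[OF e] unfolding eventually_sequentially by auto
    note i = i2[OF n]
    have "(\<integral>\<omega>. X U \<omega> \<partial>M) = - (\<integral>\<omega>. ?S n \<omega> - X U \<omega> \<partial>M)"
      using iS[of n] iX sp(4) by simp
    then have "\<bar>\<integral>\<omega>. X U \<omega> \<partial>M\<bar> \<le> (\<integral>\<omega>. \<bar>?S n \<omega> - X U \<omega>\<bar> \<partial>M)"
      using integral_abs_bound[of M "\<lambda>\<omega>. ?S n \<omega> - X U \<omega>"] by simp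
    moreover have "(\<integral>\<omega>. \<bar>?S n \<omega> - X U \<omega>\<bar> \<partial>M)\<^sup>2 \<le> e\<^sup>2"
    proof -
      have "(\<integral>\<omega>. \<bar>?S n \<omega> - X U \<omega>\<bar> \<partial>M)\<^sup>2 \<le> (\<integral>\<omega>. (?S n \<omega> - X U \<omega>)\<^sup>2 \<partial>M)"
        by (rule abs_expectation_le_L2(2)[OF _ i]) measurable
      moreover have "ennreal (\<integral>\<omega>. (?S n \<omega> - X U \<omega>)\<^sup>2 \<partial>M) < ennreal (e\<^sup>2)"
        using n i by (simp add: nn_integral_eq_integral)
      ultimately show ?thesis by (simp add: ennreal_less_iff)
    qed
    then have "(\<integral>\<omega>. \<bar>?S n \<omega> - X U \<omega>\<bar> \<partial>M) \<le> e" using e by (simp add: power2_le_iff_abs_le)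
    ultimately show ?thesis by linarith
  qed
  then have "\<bar>\<integral>\<omega>. X U \<omega> \<partial>M\<bar> \<le> 0" by (meson dense_ge)
  then show "(\<integral>\<omega>. X U \<omega> \<partial>M) = 0" by simp
qed

text \<open>The isometry read backwards: two sequences of simple integrals with the same terminal
  limit come together, hence so do the simple processes and with them the integrands.\<close>

lemma ito_integrand_unique:
  fixes H H' :: "real \<Rightarrow> 'a \<Rightarrow> real^'n"
  assumes ito: "has_ito_integral M Fil W U H X" "has_ito_integral M Fil W U H' X'" and U: "0 \<le> U" "U \<le> Tb"
    and eq: "AE \<omega> in M. X U \<omega> = X' U \<omega>"
  shows "AE p in time_prod U. H (fst p) (snd p) = H' (fst p) (snd p)"
proof -
  have UU: "U \<in> {0..U}" using U by simp
  from ito(1) obtain N \<tau> \<xi> where s: "\<And>n::nat. simple_adapted Fil U (N n) (\<tau> n) (\<xi> n)"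
    and lH: "(\<lambda>n. \<integral>\<^sup>+(t, \<omega>). ennreal ((norm (simple_proc (N n) (\<tau> n) (\<xi> n) t \<omega> - H t \<omega>))\<^sup>2) \<partial>time_prod U) \<longlonglongrightarrow> 0"
    and lX: "(\<lambda>n. \<integral>\<^sup>+\<omega>. ennreal ((simple_integral_wrt W (N n) (\<tau> n) (\<xi> n) U \<omega> - X U \<omega>)\<^sup>2) \<partial>M) \<longlonglongrightarrow> 0"
    and Xm: "X U \<in> borel_measurable (Fil U)"
    and Hm: "(\<lambda>(t, \<omega>). H t \<omega>) \<in> borel_measurable (completion (time_prod U))"
    unfolding has_ito_integral_def using UU by blast
  from ito(2) obtain N' \<tau>' \<xi>' where s': "\<And>n::nat. simple_adapted Fil U (N' n) (\<tau>' n) (\<xi>' n)"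
    and lH': "(\<lambda>n. \<integral>\<^sup>+(t, \<omega>). ennreal ((norm (simple_proc (N' n) (\<tau>' n) (\<xi>' n) t \<omega> - H' t \<omega>))\<^sup>2) \<partial>time_prod U) \<longlonglongrightarrow> 0"
    and lX': "(\<lambda>n. \<integral>\<^sup>+\<omega>. ennreal ((simple_integral_wrt W (N' n) (\<tau>' n) (\<xi>' n) U \<omega> - X' U \<omega>)\<^sup>2) \<partial>M) \<longlonglongrightarrow> 0"
    and Hm': "(\<lambda>(t, \<omega>). H' t \<omega>) \<in> borel_measurable (completion (time_prod U))"
    unfolding has_ito_integral_def using UU by blast
  let ?P = "completion (time_prod U)"
  let ?S = "\<lambda>n. simple_integral_wrt W (N n) (\<tau> n) (\<xi> n) U" and ?S' = "\<lambda>n. simple_integral_wrt W (N' n) (\<tau>' n) (\<xi>' n) U"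
  let ?s = "\<lambda>n p. simple_proc (N n) (\<tau> n) (\<xi> n) (fst p) (snd p)" and ?s' = "\<lambda>n p. simple_proc (N' n) (\<tau>' n) (\<xi>' n) (fst p) (snd p)"
  let ?H = "\<lambda>p. H (fst p) (snd p)" and ?H' = "\<lambda>p. H' (fst p) (snd p)"
  have [measurable]: "X U \<in> borel_measurable M" using fil_measurable[OF Xm] U by auto
  note [measurable] = simple_integral_props(2)[OF s U(2)] simple_integral_props(2)[OF s' U(2)]
  have ms: "?s n \<in> borel_measurable ?P" "?s' n \<in> borel_measurable ?P" for n
    using measurable_completion[OF simple_proc_measurable[OF s U(2)]] measurable_completion[OF simple_proc_measurable[OF s' U(2)]]
    by (simp_all add: case_prod_beta')
  have mH: "?H \<in> borel_measurable ?P" "?H' \<in> borel_measurable ?P"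
    using Hm Hm' by (simp_all add: case_prod_beta')
  \<comment> \<open>Equality of the terminal values enters here, by letting the second sequence
    approximate \<open>X U\<close>.\<close>
  have lX2: "(\<lambda>n. \<integral>\<^sup>+\<omega>. ennreal ((X U \<omega> - ?S' n \<omega>)\<^sup>2) \<partial>M) \<longlonglongrightarrow> 0"
  proof -
    have "(\<integral>\<^sup>+\<omega>. ennreal ((X U \<omega> - ?S' n \<omega>)\<^sup>2) \<partial>M) = (\<integral>\<^sup>+\<omega>. ennreal ((?S' n \<omega> - X' U \<omega>)\<^sup>2) \<partial>M)" for n
      by (rule nn_integral_cong_AE) (use eq in eventually_elim, simp add: power2_commute)
    then show ?thesis using lX' by simp
  qed
  have lS: "(\<lambda>n. \<integral>\<^sup>+\<omega>. ennreal ((?S n \<omega> - ?S' n \<omega>)\<^sup>2) \<partial>M) \<longlonglongrightarrow> 0"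
    by (rule ennreal_tendsto_0_triangle[OF nn_L2_triangle_real lX lX2]) measurable
  then have ls: "(\<lambda>n. \<integral>\<^sup>+p. ennreal ((norm (?s n p - ?s' n p))\<^sup>2) \<partial>?P) \<longlonglongrightarrow> 0"
    unfolding simple_isometry_eq[OF s s' U(2)] nn_integral_completion by (simp add: case_prod_beta')
  have lH1: "(\<lambda>n. \<integral>\<^sup>+p. ennreal ((norm (?H p - ?s n p))\<^sup>2) \<partial>?P) \<longlonglongrightarrow> 0"
    using lH unfolding nn_integral_completion by (simp add: case_prod_beta' norm_minus_commute)
  have lH2: "(\<lambda>n. \<integral>\<^sup>+p. ennreal ((norm (?s' n p - ?H' p))\<^sup>2) \<partial>?P) \<longlonglongrightarrow> 0"
    using lH' unfolding nn_integral_completion by (simp add: case_prod_beta')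
  have t1: "(\<integral>\<^sup>+p. ennreal ((norm (?H p - ?s' n p))\<^sup>2) \<partial>?P) \<le> 2 * (\<integral>\<^sup>+p. ennreal ((norm (?H p - ?s n p))\<^sup>2) \<partial>?P)
      + 2 * (\<integral>\<^sup>+p. ennreal ((norm (?s n p - ?s' n p))\<^sup>2) \<partial>?P)" for n
    by (rule nn_L2_triangle) (intro borel_measurable_diff mH ms)+
  have t2: "(\<integral>\<^sup>+p. ennreal ((norm (?H p - ?H' p))\<^sup>2) \<partial>?P) \<le> 2 * (\<integral>\<^sup>+p. ennreal ((norm (?H p - ?s' n p))\<^sup>2) \<partial>?P)
      + 2 * (\<integral>\<^sup>+p. ennreal ((norm (?s' n p - ?H' p))\<^sup>2) \<partial>?P)" for n
    by (rule nn_L2_triangle) (intro borel_measurable_diff mH ms)+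
  have "(\<lambda>n::nat. \<integral>\<^sup>+p. ennreal ((norm (?H p - ?H' p))\<^sup>2) \<partial>?P) \<longlonglongrightarrow> 0"
    by (rule ennreal_tendsto_0_triangle[OF t2 ennreal_tendsto_0_triangle[OF t1 lH1 ls] lH2])
  then have "(\<integral>\<^sup>+p. ennreal ((norm (?H p - ?H' p))\<^sup>2) \<partial>?P) = 0"
    using LIMSEQ_unique[OF tendsto_const] by blast
  then have "AE p in ?P. ennreal ((norm (?H p - ?H' p))\<^sup>2) = 0"
    using mH by (subst (asm) nn_integral_0_iff_AE) auto
  then have "AE p in ?P. ?H p = ?H' p" by eventually_elim simp
  then show ?thesis by (simp only: AE_completion_iff)
qed

end

subsection \<open>The forward market\<close>

lemma completed_filtration_props:
  assumes W: "\<And>s. 0 \<le> s \<Longrightarrow> s \<le> t \<Longrightarrow> W s \<in> borel_measurable M"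
  shows "space (completed_filtration M W t) = space M"
    and "sets (completed_filtration M W t) =
      sigma_sets (space M) ({W s -` A \<inter> space M | s A. 0 \<le> s \<and> s \<le> t \<and> A \<in> sets borel} \<union> null_sets M)"
    and "subalgebra M (completed_filtration M W t)"
proof -
  let ?G = "{W s -` A \<inter> space M | s A. 0 \<le> s \<and> s \<le> t \<and> A \<in> sets borel} \<union> null_sets M"
  have G: "?G \<subseteq> sets M" using W by (auto intro: measurable_sets)
  then have P: "?G \<subseteq> Pow (space M)" using sets.sets_into_space by blast
  show sp: "space (completed_filtration M W t) = space M"
    unfolding completed_filtration_def by (rule space_measure_of[OF P])
  show st: "sets (completed_filtration M W t) = sigma_sets (space M) ?G"
    unfolding completed_filtration_def by (rule sets_measure_of[OF P])
  show "subalgebra M (completed_filtration M W t)"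
    unfolding subalgebra_def sp st using sets.sigma_sets_subset[OF G] by simp
qed

text \<open>Sets that are almost surely empty or almost surely everything form a sigma-algebra, and
  the generators belong to it: whether \<open>W 0\<close> lies in B is decided by whether 0
  does.\<close>

lemma completed_filtration_0_trivial:
  assumes W: "W 0 \<in> borel_measurable M" and W0: "AE \<omega> in M. W 0 \<omega> = 0"
    and A: "A \<in> sets (completed_filtration M W 0)"
  shows "(AE \<omega> in M. \<omega> \<notin> A) \<or> (AE \<omega> in M. \<omega> \<in> A)"
proof -
  have "A \<in> sigma_sets (space M) ({W s -` A \<inter> space M | s A. 0 \<le> s \<and> s \<le> 0 \<and> A \<in> sets borel} \<union> null_sets M)"
    using A completed_filtration_props(2)[of 0 W M] W by force
  then show ?thesis
  proof induction
    case (Basic a)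
    then show ?case
    proof
      assume "a \<in> {W s -` A \<inter> space M | s A. 0 \<le> s \<and> s \<le> 0 \<and> A \<in> sets borel}"
      then obtain B where B: "a = W 0 -` B \<inter> space M" by (auto dest: antisym)
      show ?thesis
      proof (cases "0 \<in> B")
        case True
        have "AE \<omega> in M. \<omega> \<in> a" using W0 AE_space by eventually_elim (use True B in auto)
        then show ?thesis ..
      next
        case False
        have "AE \<omega> in M. \<omega> \<notin> a" using W0 by eventually_elim (use False B in auto)
        then show ?thesis ..
      qed
    next
      assume "a \<in> null_sets M"
      then show ?thesis using AE_not_in by blast
    qed
  next
    case Empty
    then show ?case by simp
  next
    case (Compl a)
    from Compl.IH show ?case
    proof
      assume "AE \<omega> in M. \<omega> \<notin> a"
      then have "AE \<omega> in M. \<omega> \<in> space M - a" using AE_space by eventually_elim simp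
      then show ?thesis ..
    next
      assume "AE \<omega> in M. \<omega> \<in> a"
      then have "AE \<omega> in M. \<omega> \<notin> space M - a" by eventually_elim simp
      then show ?thesis ..
    qed
  next
    case (Union a)
    show ?case
    proof (cases "\<exists>i. AE \<omega> in M. \<omega> \<in> a i")
      case True
      then obtain i where "AE \<omega> in M. \<omega> \<in> a i" by blast
      then have "AE \<omega> in M. \<omega> \<in> (\<Union>i. a i)" by eventually_elim auto
      then show ?thesis ..
    next
      case False
      then have "\<forall>i. AE \<omega> in M. \<omega> \<notin> a i" using Union by blast
      then have "AE \<omega> in M. \<forall>i. \<omega> \<notin> a i" by (simp add: AE_all_countable)
      then have "AE \<omega> in M. \<omega> \<notin> (\<Union>i. a i)" by eventually_elim auto
      then show ?thesis ..
    qed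
  qed
qed

text \<open>f need not be integrable, so arctan replaces it by a bounded variable. Its conditional
  expectation given \<open>G\<close> is its mean by triviality and the variable itself by
  measurability.\<close>

lemma (in prob_space) AE_constant_if_trivial:
  fixes f :: "'a \<Rightarrow> real"
  assumes G: "subalgebra M G" and f: "f \<in> borel_measurable G"
    and triv: "\<And>A. A \<in> sets G \<Longrightarrow> (AE \<omega> in M. \<omega> \<notin> A) \<or> (AE \<omega> in M. \<omega> \<in> A)"
  shows "\<exists>c. AE \<omega> in M. f \<omega> = c"
proof -
  interpret finite_measure_subalgebra M G using G by unfold_locales
  let ?g = "\<lambda>\<omega>. arctan (f \<omega>)"
  have g: "?g \<in> borel_measurable G" using f by measurable
  have [measurable]: "?g \<in> borel_measurable M" by (rule measurable_from_subalg[OF G g])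
  have i: "integrable M ?g"
  proof (rule integrable_const_bound[of _ "pi / 2"])
    have "\<bar>arctan x\<bar> \<le> pi / 2" for x using arctan_lbound[of x] arctan_ubound[of x] by linarith
    then show "AE \<omega> in M. norm (?g \<omega>) \<le> pi / 2" by simp
  qed measurable
  have "AE \<omega> in M. real_cond_exp M G ?g \<omega> = expectation ?g"
  proof (rule real_cond_exp_charact)
    fix A assume A: "A \<in> sets G"
    then have [measurable]: "A \<in> sets M" using G by (auto simp: subalgebra_def)
    show "(\<integral>\<omega>\<in>A. ?g \<omega> \<partial>M) = (\<integral>\<omega>\<in>A. expectation ?g \<partial>M)"
      using triv[OF A]
    proof
      assume ae: "AE \<omega> in M. \<omega> \<notin> A"
      show ?thesis unfolding set_lebesgue_integral_def
        by (rule integral_cong_AE) (use ae in \<open>auto elim!: eventually_mono\<close>)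
    next
      assume ae: "AE \<omega> in M. \<omega> \<in> A"
      have eq: "(\<integral>\<omega>. indicator A \<omega> *\<^sub>R h \<omega> \<partial>M) = (\<integral>\<omega>. h \<omega> \<partial>M)" if [measurable]: "h \<in> borel_measurable M" for h :: "'a \<Rightarrow> real"
        by (rule integral_cong_AE) (use ae in \<open>auto elim!: eventually_mono\<close>)
      have "(\<integral>\<omega>. indicator A \<omega> *\<^sub>R expectation ?g \<partial>M) = (\<integral>\<omega>. expectation ?g \<partial>M)" by (rule eq) simp
      also have "\<dots> = expectation ?g" by (simp add: prob_space)
      also have "\<dots> = (\<integral>\<omega>. indicator A \<omega> *\<^sub>R ?g \<omega> \<partial>M)" by (rule eq[symmetric]) measurable
      finally show ?thesis unfolding set_lebesgue_integral_def ..
    qed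
  qed (use i in auto)
  moreover have "AE \<omega> in M. real_cond_exp M G ?g \<omega> = ?g \<omega>" by (rule real_cond_exp_F_meas[OF i g])
  ultimately have "AE \<omega> in M. f \<omega> = tan (expectation ?g)"
    by eventually_elim (metis tan_arctan)
  then show ?thesis ..
qed

text \<open>Uniqueness is stated among portfolios holding only forward j, since several forwards
  driven by the same Brownian motion may offer other replicating combinations, and only where the
  kernel is nonzero, since elsewhere a position yields no gain.\<close>

theorem proposition27:
  fixes M Q :: "'a measure"
    and Fil :: "real \<Rightarrow> 'a measure"
    and W WQ :: "real \<Rightarrow> 'a \<Rightarrow> real^'n"
    and \<theta> :: "real \<Rightarrow> real^'n"
    and L :: "real \<Rightarrow> 'a \<Rightarrow> real"
    and K :: "real \<Rightarrow> real \<Rightarrow> real^'n"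
    and F :: "real \<Rightarrow> real \<Rightarrow> 'a \<Rightarrow> real"
    and Tm :: "nat \<Rightarrow> real"
    and Tbar T \<kappa> :: real
    and m j :: nat
  assumes "prob_space M"
    and "Fil = completed_filtration M W"
    and "brownian_motion M Fil Tbar W"
    and "set_borel_measurable lborel {0..Tbar} \<theta>"
    and "set_integrable lborel {0..Tbar} (\<lambda>s. (norm (\<theta> s))\<^sup>2)"
    and "has_ito_integral M Fil W Tbar (\<lambda>t \<omega>. \<theta> t) L"
    and "prob_space Q" and "space Q = space M" and "sets Q = sets M"
    and "absolutely_continuous M Q" and "absolutely_continuous Q M"
    and "\<And>t A. t \<in> {0..Tbar} \<Longrightarrow> A \<in> sets (Fil t) \<Longrightarrow>
           emeasure Q A =
             (\<integral>\<^sup>+\<omega>\<in>A. ennreal (exp (- L t \<omega> - 1/2 * (LBINT s:{0..t}. (norm (\<theta> s))\<^sup>2))) \<partial>M)"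
    and "WQ = (\<lambda>t \<omega>. W t \<omega> + (LBINT s:{0..t}. \<theta> s))"
    and "brownian_motion Q Fil Tbar WQ"
    and "\<And>s. s \<in> {0..Tbar} \<Longrightarrow> set_borel_measurable lborel {0..s} (K s)"
    and "\<And>s. s \<in> {0..Tbar} \<Longrightarrow> set_integrable lborel {0..s} (\<lambda>u. (norm (K s u))\<^sup>2)"
    and "strict_mono_on {1..m} Tm"
    and "\<And>i. i \<in> {1..m} \<Longrightarrow> 0 \<le> Tm i \<and> Tm i \<le> Tbar"
    and "\<And>i. i \<in> {1..m} \<Longrightarrow> F 0 (Tm i) \<in> borel_measurable (Fil 0)"
    and "\<And>i. i \<in> {1..m} \<Longrightarrow>
           has_ito_integral Q Fil WQ (Tm i) (\<lambda>t \<omega>. K (Tm i) t)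
             (\<lambda>t \<omega>. F t (Tm i) \<omega> - F 0 (Tm i) \<omega>)"
    and "j \<in> {1..m}" and "0 < T" and "T < Tm j"
  shows "(\<forall>t. 0 \<le> t \<and> t < T \<and> 0 < fwd_vol K t T (Tm j) \<longrightarrow>
            (AE \<omega> in Q.
               real_cond_exp Q (Fil t) (\<lambda>\<omega>'. max (F T (Tm j) \<omega>' - \<kappa>) 0) \<omega> =
                 fwd_vol K t T (Tm j) *
                   (moneyness K F \<kappa> t T (Tm j) \<omega> * std_normal_cdf (moneyness K F \<kappa> t T (Tm j) \<omega>)
                    + std_normal_density (moneyness K F \<kappa> t T (Tm j) \<omega>)) \<and>
               real_cond_exp Q (Fil t) (\<lambda>\<omega>'. max (F T (Tm j) \<omega>' - \<kappa>) 0) \<omega> =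
                 (F t (Tm j) \<omega> - \<kappa>) * std_normal_cdf (moneyness K F \<kappa> t T (Tm j) \<omega>)
                 + fwd_vol K t T (Tm j) * std_normal_density (moneyness K F \<kappa> t T (Tm j) \<omega>)))
       \<and> (\<exists>\<phi> \<psi>.
            hedging_portfolio Q Fil WQ K m Tm F T (\<lambda>\<omega>. max (F T (Tm j) \<omega> - \<kappa>) 0) \<phi> \<psi> \<and>
            holds_only Q m j T \<phi> \<and>
            (\<forall>t. 0 \<le> t \<and> t < T \<and> 0 < fwd_vol K t T (Tm j) \<longrightarrow>
               (\<forall>\<omega>\<in>space Q. \<phi> j t \<omega> = std_normal_cdf (moneyness K F \<kappa> t T (Tm j) \<omega>))))
       \<and> (\<forall>\<phi> \<psi>.
            hedging_portfolio Q Fil WQ K m Tm F T (\<lambda>\<omega>. max (F T (Tm j) \<omega> - \<kappa>) 0) \<phi> \<psi> \<and>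
            holds_only Q m j T \<phi> \<longrightarrow>
            (AE (t, \<omega>) in restrict_space lborel {0..T} \<Otimes>\<^sub>M Q.
               K (Tm j) t \<noteq> 0 \<longrightarrow>
                 \<phi> j t \<omega> = std_normal_cdf (moneyness K F \<kappa> t T (Tm j) \<omega>)))"
proof -
  note prems = assms
  interpret Q: prob_space Q by (rule prems(7))
  let ?U = "Tm j"
  have U: "0 \<le> ?U" "?U \<le> Tbar" using prems(18)[OF prems(21)] by auto
  have TT: "0 < T" "T \<le> ?U" using prems(22,23) by auto
  have Wm: "W s \<in> borel_measurable M" if "0 \<le> s" "s \<le> Tbar" for s
    using prems(3) that by (auto simp: brownian_motion_def)
  have subM: "subalgebra M (Fil t)" if "t \<in> {0..Tbar}" for t
    unfolding prems(2) using that by (intro completed_filtration_props(3) Wm) auto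
  \<comment> \<open>The filtration is built from \<open>M\<close> and \<open>W\<close>; it also
    serves \<open>Q\<close> because the two measures share space and sets.\<close>
  have sub: "subalgebra Q (Fil t)" if "t \<in> {0..Tbar}" for t
    using subM[OF that] prems(8,9) by (simp add: subalgebra_def)
  have mono: "sets (Fil s) \<subseteq> sets (Fil t)" if "0 \<le> s" "s \<le> t" "t \<le> Tbar" for s t
  proof -
    have 1: "sets (Fil r) = sigma_sets (space M) ({W u -` A \<inter> space M | u A. 0 \<le> u \<and> u \<le> r \<and> A \<in> sets borel} \<union> null_sets M)"
      if "r \<le> Tbar" for r
      unfolding prems(2) by (rule completed_filtration_props(2)) (use that Wm in auto)
    show ?thesis
      unfolding 1[OF that(3)] 1[OF order_trans[OF that(2,3)]]
    proof (rule sigma_sets_mono', rule Un_mono[OF subsetI order_refl])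
      fix x assume "x \<in> {W u -` A \<inter> space M | u A. 0 \<le> u \<and> u \<le> s \<and> A \<in> sets borel}"
      then obtain u A where x: "x = W u -` A \<inter> space M" "0 \<le> u" "u \<le> s" "A \<in> sets borel" by blast
      moreover have "u \<le> t" using x(3) that(2) by simp
      ultimately show "x \<in> {W u -` A \<inter> space M | u A. 0 \<le> u \<and> u \<le> t \<and> A \<in> sets borel}" by blast
    qed
  qed
  interpret B: bm_filtered Q Fil Tbar WQ
    using sub mono prems(14) by unfold_locales auto
  \<comment> \<open>Triviality of \<open>Fil 0\<close> is proved under \<open>M\<close>, where the
    filtration is generated, and passes to \<open>Q\<close> because null sets of \<open>M\<close>
    are null for \<open>Q\<close>.\<close>
  have const: "\<exists>c. AE \<omega> in Q. f \<omega> = c" if f: "f \<in> borel_measurable (Fil 0)" for f :: "'a \<Rightarrow> real"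
  proof (rule Q.AE_constant_if_trivial[OF _ f])
    show "subalgebra Q (Fil 0)" using U by (intro sub) auto
    fix A assume "A \<in> sets (Fil 0)"
    then have "(AE \<omega> in M. \<omega> \<notin> A) \<or> (AE \<omega> in M. \<omega> \<in> A)"
      unfolding prems(2) using prems(3) U Wm[of 0] by (intro completed_filtration_0_trivial) (auto simp: brownian_motion_def)
    then show "(AE \<omega> in Q. \<omega> \<notin> A) \<or> (AE \<omega> in Q. \<omega> \<in> A)"
      using absolutely_continuous_AE[OF prems(9) prems(10)] by blast
  qed
  define X where "X t \<omega> = F t ?U \<omega> - F 0 ?U \<omega>" for t \<omega>
  \<comment> \<open>With the strike subtracted, the option becomes a call with strike 0 on
    \<open>Z\<close>.\<close>
  define Z where "Z t \<omega> = F t ?U \<omega> - \<kappa>" for t \<omega>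
  have F0: "F 0 (Tm i) \<in> borel_measurable (Fil 0)" if "i \<in> {1..m}" for i by (rule prems(19)[OF that])
  then have Z0m: "Z 0 \<in> borel_measurable (Fil 0)" unfolding Z_def[abs_def] using prems(21) by measurable
  then obtain c where c: "AE \<omega> in Q. Z 0 \<omega> = c" using const by blast
  have UT: "?U \<in> {0..Tbar}" using U by simp
  interpret G: gauss_price Q Fil Tbar WQ "K ?U" ?U T X Z c
  proof unfold_locales
    show "has_ito_integral Q Fil WQ ?U (\<lambda>t \<omega>. K ?U t) X"
      using prems(20)[OF prems(21)] unfolding X_def[abs_def] .
    show "K ?U \<in> borel_measurable (restrict_space lborel {0..?U})"
      using prems(15)[OF UT] by (subst borel_measurable_restrict_space_iff) (auto simp: set_borel_measurable_def)
    show "set_integrable lborel {0..?U} (\<lambda>u. (norm (K ?U u))\<^sup>2)" by (rule prems(16)[OF UT])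
  qed (use U TT Z0m c in \<open>auto simp: X_def Z_def\<close>)
  have vol: "fwd_vol K t T ?U = sqrt (G.rv t)" for t
    by (simp add: fwd_vol_def G.rv_def)
  have ratio: "std_normal_cdf (moneyness K F \<kappa> t T ?U \<omega>) = G.hedge_ratio t \<omega>" for t \<omega>
    by (simp add: moneyness_def vol G.hedge_ratio_def Z_def)
  have payoff: "G.price 0 T \<omega> = max (F T ?U \<omega> - \<kappa>) 0" for \<omega>
    by (simp add: G.price_def G.rv_T bachelier_0 Z_def)
  have payoff': "G.price 0 T = (\<lambda>\<omega>. max (F T ?U \<omega> - \<kappa>) 0)" using payoff by (rule ext)
  have TTb: "T \<le> Tbar" "0 \<le> T" using TT U by auto

  have formula: "AE \<omega> in Q.
      real_cond_exp Q (Fil t) (\<lambda>\<omega>'. max (F T ?U \<omega>' - \<kappa>) 0) \<omega> =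
        fwd_vol K t T ?U * (moneyness K F \<kappa> t T ?U \<omega> * std_normal_cdf (moneyness K F \<kappa> t T ?U \<omega>)
          + std_normal_density (moneyness K F \<kappa> t T ?U \<omega>)) \<and>
      real_cond_exp Q (Fil t) (\<lambda>\<omega>'. max (F T ?U \<omega>' - \<kappa>) 0) \<omega> =
        (F t ?U \<omega> - \<kappa>) * std_normal_cdf (moneyness K F \<kappa> t T ?U \<omega>)
        + fwd_vol K t T ?U * std_normal_density (moneyness K F \<kappa> t T ?U \<omega>)"
    if t: "0 \<le> t" "t < T" "0 < fwd_vol K t T ?U" for t
  proof -
    let ?v = "fwd_vol K t T ?U"
    have d: "?v * moneyness K F \<kappa> t T ?U \<omega> = F t ?U \<omega> - \<kappa>" for \<omega>
      using t(3) by (simp add: moneyness_def)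
    have p: "G.price 0 t \<omega> = (F t ?U \<omega> - \<kappa>) * std_normal_cdf (moneyness K F \<kappa> t T ?U \<omega>)
        + ?v * std_normal_density (moneyness K F \<kappa> t T ?U \<omega>)" for \<omega>
      using bachelier_formula[OF t(3), of "F t ?U \<omega> - \<kappa>"]
      by (simp add: G.price_def vol Z_def moneyness_def)
    have p': "G.price 0 t \<omega> = ?v * (moneyness K F \<kappa> t T ?U \<omega> * std_normal_cdf (moneyness K F \<kappa> t T ?U \<omega>)
        + std_normal_density (moneyness K F \<kappa> t T ?U \<omega>))" for \<omega>
      unfolding p d[symmetric] by (simp add: distrib_left)
    have "AE \<omega> in Q. real_cond_exp Q (Fil t) (\<lambda>\<omega>'. max (F T ?U \<omega>' - \<kappa>) 0) \<omega> = G.price 0 t \<omega>"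
      using G.price_martingale[of t T 0] t unfolding payoff' by simp
    then show ?thesis
    proof eventually_elim
      case (elim \<omega>)
      show ?case unfolding elim using p[of \<omega>] p'[of \<omega>] by (intro conjI)
    qed
  qed

  define \<phi>0 where "\<phi>0 = (\<lambda>i t \<omega>. if i = j then G.hedge_ratio t \<omega> else 0)"
  \<comment> \<open>The money account tops the position up to the price, so the portfolio value is
    the price at all times and self-financing is precisely its Ito representation.\<close>
  define \<psi>0 where "\<psi>0 = (\<lambda>t \<omega>. G.price 0 t \<omega> - G.hedge_ratio t \<omega> * F t ?U \<omega>)"
  have pv: "portfolio_value m Tm F \<phi>0 \<psi>0 t \<omega> = G.price 0 t \<omega>" for t \<omega>
  proof -
    have "(\<Sum>i=1..m. \<phi>0 i t \<omega> * F t (Tm i) \<omega>) = (\<Sum>i=1..m. if i = j then G.hedge_ratio t \<omega> * F t ?U \<omega> else 0)"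
      by (rule sum.cong) (auto simp: \<phi>0_def)
    also have "\<dots> = G.hedge_ratio t \<omega> * F t ?U \<omega>" using prems(21) by simp
    finally show ?thesis by (simp add: portfolio_value_def \<psi>0_def)
  qed
  have only_j: "(\<Sum>i=1..m. \<phi> i t \<omega> *\<^sub>R K (Tm i) t) = \<phi> j t \<omega> *\<^sub>R K ?U t"
    if "\<And>i. i \<in> {1..m} - {j} \<Longrightarrow> \<phi> i t \<omega> = 0" for \<phi> :: "nat \<Rightarrow> real \<Rightarrow> 'a \<Rightarrow> real" and t \<omega>
  proof -
    have "(\<Sum>i=1..m. \<phi> i t \<omega> *\<^sub>R K (Tm i) t) = (\<Sum>i\<in>{j}. \<phi> i t \<omega> *\<^sub>R K (Tm i) t)"
      using prems(21) that by (intro sum.mono_neutral_right) auto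
    then show ?thesis by simp
  qed
  have ratio_fil: "G.hedge_ratio t \<in> borel_measurable (Fil t)" if "t \<in> {0..T}" for t
    unfolding G.hedge_ratio_def[abs_def] using G.Z_fil[OF that] by measurable
  have "self_financing Q Fil WQ K m Tm F T \<phi>0 \<psi>0"
    unfolding self_financing_def
  proof (intro conjI ballI impI)
    fix t assume t: "t \<in> {0..T}"
    have "(\<lambda>\<omega>. Z t \<omega> + \<kappa>) \<in> borel_measurable (Fil t)" using G.Z_fil[OF t] by measurable
    then have "F t ?U \<in> borel_measurable (Fil t)" by (simp add: Z_def)
    then show "\<psi>0 t \<in> borel_measurable (Fil t)"
      unfolding \<psi>0_def using G.price_fil[OF t] ratio_fil[OF t] by measurable
    show "\<phi>0 i t \<in> borel_measurable (Fil t)" for i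
      using ratio_fil[OF t] by (cases "i = j") (simp_all add: \<phi>0_def)
    \<comment> \<open>The index j is excluded here because t \<le> T < \<open>Tm j\<close>.\<close>
    show "\<phi>0 i t \<omega> = 0" if "Tm i < t" for i \<omega>
      using that t prems(23) by (auto simp: \<phi>0_def)
  next
    have "(\<lambda>t \<omega>. \<Sum>i=1..m. \<phi>0 i t \<omega> *\<^sub>R K (Tm i) t) = (\<lambda>t \<omega>. G.hedge_ratio t \<omega> *\<^sub>R K ?U t)"
      by (intro ext, subst only_j) (auto simp: \<phi>0_def)
    then show "has_ito_integral Q Fil WQ T (\<lambda>t \<omega>. \<Sum>i=1..m. \<phi>0 i t \<omega> *\<^sub>R K (Tm i) t)
       (\<lambda>t \<omega>. portfolio_value m Tm F \<phi>0 \<psi>0 t \<omega> - portfolio_value m Tm F \<phi>0 \<psi>0 0 \<omega>)"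
      using G.hedge_has_ito_integral unfolding pv by simp
  qed
  then have hedge: "hedging_portfolio Q Fil WQ K m Tm F T (\<lambda>\<omega>. max (F T ?U \<omega> - \<kappa>) 0) \<phi>0 \<psi>0"
    unfolding hedging_portfolio_def pv payoff by simp
  have only: "holds_only Q m j T \<phi>0" by (auto simp: holds_only_def \<phi>0_def)
  have quantity: "\<phi>0 j t \<omega> = std_normal_cdf (moneyness K F \<kappa> t T ?U \<omega>)" for t \<omega>
    unfolding ratio by (simp add: \<phi>0_def)

  have unique: "AE (t, \<omega>) in restrict_space lborel {0..T} \<Otimes>\<^sub>M Q.
      K ?U t \<noteq> 0 \<longrightarrow> \<phi> j t \<omega> = std_normal_cdf (moneyness K F \<kappa> t T ?U \<omega>)"
    if h: "hedging_portfolio Q Fil WQ K m Tm F T (\<lambda>\<omega>. max (F T ?U \<omega> - \<kappa>) 0) \<phi> \<psi>" and o: "holds_only Q m j T \<phi>" for \<phi> \<psi>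
  proof -
    let ?V = "portfolio_value m Tm F \<phi> \<psi>"
    let ?H = "\<lambda>t \<omega>. \<Sum>i=1..m. \<phi> i t \<omega> *\<^sub>R K (Tm i) t"
    from h have ito: "has_ito_integral Q Fil WQ T ?H (\<lambda>t \<omega>. ?V t \<omega> - ?V 0 \<omega>)"
      and VT: "AE \<omega> in Q. ?V T \<omega> = max (F T ?U \<omega> - \<kappa>) 0"
      and \<psi>m: "\<psi> 0 \<in> borel_measurable (Fil 0)" and \<phi>m: "\<And>i. i \<in> {1..m} \<Longrightarrow> \<phi> i 0 \<in> borel_measurable (Fil 0)"
      using TT by (auto simp: hedging_portfolio_def self_financing_def)
    have V0: "?V 0 \<in> borel_measurable (Fil 0)"
      unfolding portfolio_value_def[abs_def] using \<psi>m \<phi>m F0 by measurable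
    have P0: "G.price 0 0 \<in> borel_measurable (Fil 0)" using G.price_fil[of 0 0] TT by simp
    have "(\<lambda>\<omega>. G.price 0 0 \<omega> - ?V 0 \<omega>) \<in> borel_measurable (Fil 0)" using V0 P0 by measurable
    \<comment> \<open>The initial value of an arbitrary hedge is not prescribed, but it differs from
      the initial price by a constant, \<open>Fil 0\<close> being trivial.\<close>
    then obtain d where d: "AE \<omega> in Q. G.price 0 0 \<omega> - ?V 0 \<omega> = d" using const by blast
    have diff: "AE \<omega> in Q. ?V T \<omega> - ?V 0 \<omega> = (G.price 0 T \<omega> - G.price 0 0 \<omega>) + d"
      using VT d by eventually_elim (simp add: payoff)
    note m1 = B.ito_integral_mean_zero[OF ito TTb(2,1)]
    note m2 = B.ito_integral_mean_zero[OF G.hedge_has_ito_integral TTb(2,1)]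
    have "(\<integral>\<omega>. ?V T \<omega> - ?V 0 \<omega> \<partial>Q) = (\<integral>\<omega>. (G.price 0 T \<omega> - G.price 0 0 \<omega>) + d \<partial>Q)"
      using m1(1) m2(1) diff by (intro integral_cong_AE) auto
    also have "\<dots> = (\<integral>\<omega>. G.price 0 T \<omega> - G.price 0 0 \<omega> \<partial>Q) + (\<integral>\<omega>. d \<partial>Q)"
      by (rule Bochner_Integration.integral_add[OF m2(1)]) simp
    \<comment> \<open>Both gains have mean zero, so every hedge starts with the same capital and the
      terminal gains agree.\<close>
    finally have "d = 0" using m1(2) m2(2) by (simp add: Q.prob_space)
    then have eq: "AE \<omega> in Q. G.price 0 T \<omega> - G.price 0 0 \<omega> = ?V T \<omega> - ?V 0 \<omega>"
      using diff by (auto elim!: eventually_mono)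
    have "AE p in B.time_prod T. G.hedge_ratio (fst p) (snd p) *\<^sub>R K ?U (fst p) = ?H (fst p) (snd p)"
      by (rule B.ito_integrand_unique[OF G.hedge_has_ito_integral ito TTb(2,1) eq])
    then have "AE p in B.time_prod T. K ?U (fst p) \<noteq> 0 \<longrightarrow> \<phi> j (fst p) (snd p) = std_normal_cdf (moneyness K F \<kappa> (fst p) T ?U (snd p))"
      using AE_space
    proof eventually_elim
      case (elim p)
      have "fst p \<in> {0..T}" "snd p \<in> space Q" using elim(2) by (auto simp: space_pair_measure space_restrict_space)
      then have "?H (fst p) (snd p) = \<phi> j (fst p) (snd p) *\<^sub>R K ?U (fst p)"
        using o by (intro only_j) (auto simp: holds_only_def)
      \<comment> \<open>Equality of the integrands is equality of two multiples of the kernel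
        vector, which can be cancelled where that vector is nonzero.\<close>
      with elim(1) show ?case unfolding ratio by auto
    qed
    then show ?thesis by (simp add: case_prod_beta')
  qed
  show ?thesis
    by (intro conjI allI impI ballI formula exI[of _ \<phi>0] exI[of _ \<psi>0] hedge only quantity unique; elim conjE)
qed

end
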